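(* Let $x,y,z$ be non-negative integers and let $\mathbf a=(a_1,\dots,a_m)$, $\mathbf b=(b_1,\dots,b_n)$ be two sequences of non-negative integers. Put $\mu=2\lfloor\frac{m+1}{2}\rfloor$, $\mu'=2\lceil\frac{m-1}{2}\rceil$, $\nu=2\lfloor\frac{n+1}{2}\rfloor$, $\nu'=2\lceil\frac{n-1}{2}\rceil$, and $$\mathbf t^{+}=(a_1,\dots,a_{\mu'},\,a_{\mu'+1}+x+y+b_{\nu},\,b_{\nu-1},\dots,b_1),\qquad \mathbf t^{-}=(0,a_1,\dots,a_{\mu-1},\,a_{\mu}+x+y+b_{\nu'+1},\,b_{\nu'},\dots,b_1,z).$$ Then $$M(NR^{(3)}_{x,y,z}(\mathbf a;\mathbf b))=\frac{M(NR^{(3)}_{x+y,0,z}(\mathbf a;\mathbf b))\,M(NR^{(3)}_{0,y,z}(\mathbf a;\mathbf b))}{M(NR^{(3)}_{y,0,z}(\mathbf a;\mathbf b))}\cdot\frac{T(x+1,2a+b+2y+z-1,y)\,T(x+a+1,b+2y+z-1,y)}{T(1,2a+b+2y+z-1,y)\,T(a+1,b+2y+z-1,y)}$$ $$=2^{-y}\,Q'(\mathbf t^{+})\,K(\mathbf t^{-})\cdot\frac{H_2(2e_a+2o_b+1)\,H_2(2o_a+2e_b+2z)}{H_2(2e_a+2o_b+2y+1)\,H_2(2o_a+2e_b+2y+2z)}\cdot\frac{H(2a+b+2y+z)\,H(b+y+z)}{H(2a+b+y+z)\,H(b+z)}$$ $$\cdot\frac{T(x+1,2a+b+2y+z-1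,y)\,T(x+a+1,b+2y+z-1,y)}{T(1,2a+b+2y+z-1,y)\,T(a+1,b+2y+z-1,y)}.$$
   Context: Lattice and tilings. For real $u,k$ let $[u;k]$ be the point of the plane with Cartesian coordinates $(u,\frac{\sqrt3}{2}k)$. The triangular lattice has as vertices all $[u;k]$ with $k\in\mathbb Z$, $u-k/2\in\mathbb Z$; its faces are unit equilateral triangles, up-pointing or down-pointing. A region is a finite union of unit triangles. A lozenge is the union of two unit triangles sharing an edge; it is vertical if that edge is horizontal. A tiling of a region is a covering of it by lozenges contained in it, without gaps or overlaps. $M(R)$ is the sum of the weights of all tilings of $R$, the weight of a tiling being the product of the weights of its lozenges; lozenges have weight $1$ unless stated otherwise; $M(\emptyset)=1$. Sequences. $a=\sum a_i$, $b=\sum b_j$; $o_a,e_a$ are the sums of the $a_i$ with $i$ odd, resp. even; $o_b,e_b$ likewise. $a_i=0$ for $i>m$, $b_j=0$ for $j>n$; an empty sequence is treated as the one-term sequence $(0)$. Functions. $H(n)=\prod_{i=0}^{n-1}i!$; $H_2(n)=\prod_{i=1}^{\lfloor n/2\rfloor}(n-2i)!$; for $n\ge0$, $(x)_n=x(x+1)\cdots(x+n-1)$ ($1$ for $n=0$); $T(x,n,m)=\prod_{i=0}^{m-1}(x+i)_{n-2i}$. Empty products are $1$. Quartered hexagons. For a sequence $\mathbf t=(t_1,\dots,t_{2l})$ of non-negative integers let $s_k=t_1+\dots+t_k$, $o_t=\sum_{i\text{ odd}}t_i$, $e_t=\sum_{i\text{ even}}t_i$. $Q'(\mathbf t)$: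 take the region bounded by the base from $[0;0]$ to $[o_t+e_t;0]$, the segment from $[o_t+e_t;0]$ to $[o_t;2e_t]$, the north side from $[o_t;2e_t]$ to $[0;2e_t]$, and the west zigzag through $[0;0],[-\frac12;1],[0;2],[-\frac12;3],\dots,[0;2e_t]$; remove from it, for each $1\le i\le l$, the up-pointing triangle with base from $[s_{2i-1};0]$ to $[s_{2i};0]$; give weight $\frac12$ to each vertical lozenge whose two western (left) sides both lie on the west zigzag. $Q'(\mathbf t)$ is $M$ of this weighted region. $K(\mathbf t)$: if $e_t\ge1$, take the region bounded by the base from $[0;0]$ to $[o_t+e_t;0]$, the segment from $[o_t+e_t;0]$ to $[o_t+\frac12;2e_t-1]$, the north side from there to $[\frac12;2e_t-1]$, and the west zigzag through $[0;0],[\frac12;1],[0;2],[\frac12;3],\dots,[\frac12;2e_t-1]$; remove the same up-pointing triangles. $K(\mathbf t)$ is the number of tilings of the resulting region; if $e_t=0$, $K(\mathbf t)=1$. The region $NR^{(3)}_{x,y,z}(\mathbf a;\mathbf b)$. Let $L=x+y+a+b$, $A=2(y+e_a+o_b)$, $B=2(y+z+o_a+e_b)-1$, and let $\ell$ be the line $k=0$. Upper part: bounded by $\ell$ between $[0;0]$ and $[L;0]$, the segment from $[L;0]$ to $[L-\frac A2;A]$, the horizontal north side at height $k=A$, and the west zigzag through the points $[\alpha(k);k]$, $0\le k\le A$, with $\alpha(k)=0$ for $k$ even and $-\frac12$ for $k$ odd. Lower part (empty if $B=-1$): bounded by $\ell$ between $[0;0]$ and $[L;0]$, the segments from $[L;0]$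 to $[L+\frac z2;-z]$ and from there to $[L+z-\frac B2;-B]$, the horizontal south side at $k=-B$, and the west zigzag through $[\beta(k);-k]$, $0\le k\le B$, with $\beta(k)=0$ for $k$ even and $\frac12$ for $k$ odd. The region is the union of the two parts (lozenges may cross $\ell$) after removing: (i) from the lower part, everything at points $[u;-k]$ with $u<a_1-k/2$ (a down-pointing half triangle of side $2a_1$); (ii) for $2\le i\le m$, the triangle of side $a_i$ having a side on $\ell$ from $[a_1+\dots+a_{i-1};0]$ to $[a_1+\dots+a_i;0]$, up-pointing (above $\ell$) if $i$ is even, down-pointing (below $\ell$) if $i$ is odd; (iii) for $1\le j\le n$, the triangle of side $b_j$ having a side on $\ell$ from $[L-b_1-\dots-b_j;0]$ to $[L-b_1-\dots-b_{j-1};0]$, up-pointing (above $\ell$) if $j$ is odd, down-pointing (below $\ell$) if $j$ is even. Each vertical lozenge whose two western (left) sides both lie on the upper west zigzag has weight $\frac12$; all others have weight $1$. *)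

theory Defs
  imports Complex_Main "HOL-Library.Disjoint_Sets"
begin

section \<open>Lattice, regions, weighted tilings\<close>

text \<open>
  The pair \<open>(p, k)\<close> stands for the point \<open>[p/2; k]\<close>, i.e. the first component is the
  doubled abscissa \<open>p = 2u\<close>. Hence \<open>u - k/2\<close> is an integer iff \<open>p - k\<close> is even.
\<close>

type_synonym point = "int \<times> int"
type_synonym triangle = "point set"
type_synonym region = "triangle set"
type_synonym lozenge = "triangle set"

definition lattice_vertex :: "point \<Rightarrow> bool" where
  "lattice_vertex v \<longleftrightarrow> even (fst v - snd v)"

text \<open>A unit triangle is given by its three vertices; in both cases \<open>(p, k)\<close> is the left
  end of the horizontal side.\<close>

definition up_tri :: "int \<Rightarrow> int \<Rightarrow> triangle" where
  "up_tri p k = {(p, k), (p + 2, k), (p + 1, k + 1)}"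

definition down_tri :: "int \<Rightarrow> int \<Rightarrow> triangle" where
  "down_tri p k = {(p, k), (p + 2, k), (p + 1, k - 1)}"

definition unit_triangle :: "triangle \<Rightarrow> bool" where
  "unit_triangle t \<longleftrightarrow>
     (\<exists>p k. lattice_vertex (p, k) \<and> (t = up_tri p k \<or> t = down_tri p k))"

definition is_lozenge :: "lozenge \<Rightarrow> bool" where
  "is_lozenge l \<longleftrightarrow>
     (\<exists>s t. unit_triangle s \<and> unit_triangle t \<and> s \<noteq> t \<and> card (s \<inter> t) = 2 \<and> l = {s, t})"

definition tilings :: "region \<Rightarrow> lozenge set set" where
  "tilings R = {T. partition_on R T \<and> (\<forall>l\<in>T. is_lozenge l)}"

definition tiling_sum :: "(lozenge \<Rightarrow> real) \<Rightarrow> region \<Rightarrow> real" where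
  "tiling_sum w R = (\<Sum>T\<in>tilings R. \<Prod>l\<in>T. w l)"

text \<open>
  All boundary lines below are straight inside every strip between two consecutive lattice
  rows, so a unit triangle lies in the described domain iff its three vertices do.
\<close>

definition triangles_in :: "(int \<Rightarrow> int \<Rightarrow> bool) \<Rightarrow> region" where
  "triangles_in P = {t. unit_triangle t \<and> (\<forall>(p, k)\<in>t. P p k)}"

text \<open>The triangles with a side from \<open>[s; 0]\<close> to \<open>[s'; 0]\<close>, above resp. below the line
  \<open>k = 0\<close>.\<close>

definition big_up :: "int \<Rightarrow> int \<Rightarrow> region" where
  "big_up s s' = triangles_in (\<lambda>p k. 0 \<le> k \<and> 2 * s + k \<le> p \<and> p \<le> 2 * s' - k)"

definition big_down :: "int \<Rightarrow> int \<Rightarrow> region" where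
  "big_down s s' = triangles_in (\<lambda>p k. k \<le> 0 \<and> 2 * s - k \<le> p \<and> p \<le> 2 * s' + k)"

text \<open>Doubled abscissa of the west zigzags: \<open>zig_out\<close> alternates \<open>0, -1/2\<close> and
  \<open>zig_in\<close> alternates \<open>0, 1/2\<close>.\<close>

definition zig_out :: "int \<Rightarrow> int" where
  "zig_out k = (if even k then 0 else - 1)"

definition zig_in :: "int \<Rightarrow> int" where
  "zig_in k = (if even k then 0 else 1)"

definition zig_out_edges :: "int \<Rightarrow> point set set" where
  "zig_out_edges h = {{(zig_out k, k), (zig_out (k + 1), k + 1)} | k. 0 \<le> k \<and> k < h}"

text \<open>\<open>{up_tri p k, down_tri p k}\<close> is the vertical lozenge whose western corner is
  \<open>(p, k)\<close>; its western sides go from there to \<open>(p + 1, k \<plusminus> 1)\<close>. The parameter \<open>h\<close> is the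
  height of the zigzag.\<close>

definition zigzag_weight :: "int \<Rightarrow> lozenge \<Rightarrow> real" where
  "zigzag_weight h l =
     (if \<exists>p k. l = {up_tri p k, down_tri p k} \<and>
               {(p, k), (p + 1, k + 1)} \<in> zig_out_edges h \<and>
               {(p, k), (p + 1, k - 1)} \<in> zig_out_edges h
      then 1 / 2 else 1)"


section \<open>Sequences and special functions\<close>

text \<open>Sequences are lists, indexed from 1 and extended by 0. The number of terms of the empty
  sequence is 1, as it is identified with the one-term sequence \<open>(0)\<close>.\<close>

definition entry :: "nat list \<Rightarrow> nat \<Rightarrow> nat" where
  "entry a i = (if 1 \<le> i \<and> i \<le> length a then a ! (i - 1) else 0)"

definition terms :: "nat list \<Rightarrow> nat" where
  "terms a = (if a = [] then 1 else length a)"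

definition osum :: "nat list \<Rightarrow> nat" where
  "osum a = (\<Sum>i | i \<in> {1..length a} \<and> odd i. entry a i)"

definition esum :: "nat list \<Rightarrow> nat" where
  "esum a = (\<Sum>i | i \<in> {1..length a} \<and> even i. entry a i)"

definition psum :: "nat list \<Rightarrow> nat \<Rightarrow> nat" where
  "psum a k = (\<Sum>i=1..k. entry a i)"

definition H :: "nat \<Rightarrow> real" where
  "H n = (\<Prod>i<n. fact i)"

definition H2 :: "nat \<Rightarrow> real" where
  "H2 n = (\<Prod>i=1..n div 2. fact (n - 2 * i))"

text \<open>The second argument is an integer, since \<open>T(x, n, 0)\<close> is also needed for \<open>n = -1\<close>.
  In all uses below every subscript \<open>n - 2 i\<close> with \<open>i < m\<close> is positive, so \<open>nat\<close> does not
  truncate.\<close>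

definition T :: "real \<Rightarrow> int \<Rightarrow> nat \<Rightarrow> real" where
  "T x n m = (\<Prod>i<m. pochhammer (x + real i) (nat (n - 2 * int i)))"


section \<open>Quartered hexagons\<close>

text \<open>Both are meant for sequences of even length \<open>2 l\<close>.\<close>

definition quartered_dents :: "nat list \<Rightarrow> region" where
  "quartered_dents t =
     (\<Union>i\<in>{1..length t div 2}. big_up (int (psum t (2 * i - 1))) (int (psum t (2 * i))))"

definition Q_region :: "nat list \<Rightarrow> region" where
  "Q_region t =
     triangles_in (\<lambda>p k. 0 \<le> k \<and> k \<le> 2 * int (esum t) \<and>
                         zig_out k \<le> p \<and> p \<le> 2 * int (osum t + esum t) - k)
     - quartered_dents t"

definition Q' :: "nat list \<Rightarrow> real" where
  "Q' t = tiling_sum (zigzag_weight (2 * int (esum t))) (Q_region t)"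

definition K_region :: "nat list \<Rightarrow> region" where
  "K_region t =
     triangles_in (\<lambda>p k. 0 \<le> k \<and> k \<le> 2 * int (esum t) - 1 \<and>
                         zig_in k \<le> p \<and> p \<le> 2 * int (osum t + esum t) - k)
     - quartered_dents t"

definition K :: "nat list \<Rightarrow> real" where
  "K t = (if esum t \<ge> 1 then real (card (tilings (K_region t))) else 1)"


section \<open>The regions $NR^{(3)}$\<close>

definition NR_L :: "nat \<Rightarrow> nat \<Rightarrow> nat list \<Rightarrow> nat list \<Rightarrow> int" where
  "NR_L x y a b = int (x + y + sum_list a + sum_list b)"

definition NR_A :: "nat \<Rightarrow> nat list \<Rightarrow> nat list \<Rightarrow> int" where
  "NR_A y a b = 2 * int (y + esum a + osum b)"

definition NR_B :: "nat \<Rightarrow> nat \<Rightarrow> nat list \<Rightarrow> nat list \<Rightarrow> int" where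
  "NR_B y z a b = 2 * int (y + z + osum a + esum b) - 1"

definition NR_upper :: "nat \<Rightarrow> nat \<Rightarrow> nat list \<Rightarrow> nat list \<Rightarrow> region" where
  "NR_upper x y a b =
     triangles_in (\<lambda>p k. 0 \<le> k \<and> k \<le> NR_A y a b \<and>
                         zig_out k \<le> p \<and> p \<le> 2 * NR_L x y a b - k)"

text \<open>Here the row index of the points is \<open>k = -d\<close> with depth \<open>d\<close>.\<close>

definition NR_lower :: "nat \<Rightarrow> nat \<Rightarrow> nat \<Rightarrow> nat list \<Rightarrow> nat list \<Rightarrow> region" where
  "NR_lower x y z a b =
     triangles_in (\<lambda>p k. let d = - k in
        0 \<le> d \<and> d \<le> NR_B y z a b \<and> zig_in d \<le> p \<and>
        p \<le> (if d \<le> int z then 2 * NR_L x y a b + d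
             else 2 * (NR_L x y a b + int z) - d))"

definition NR_half_dent :: "nat list \<Rightarrow> region" where
  "NR_half_dent a = triangles_in (\<lambda>p k. k \<le> 0 \<and> p \<le> 2 * int (entry a 1) + k)"

definition NR_a_dents :: "nat list \<Rightarrow> region" where
  "NR_a_dents a =
     (\<Union>i\<in>{2..length a}.
        (if even i then big_up else big_down) (int (psum a (i - 1))) (int (psum a i)))"

definition NR_b_dents :: "nat \<Rightarrow> nat \<Rightarrow> nat list \<Rightarrow> nat list \<Rightarrow> region" where
  "NR_b_dents x y a b =
     (\<Union>j\<in>{1..length b}.
        (if odd j then big_up else big_down)
          (NR_L x y a b - int (psum b j)) (NR_L x y a b - int (psum b (j - 1))))"

definition NR3 :: "nat \<Rightarrow> nat \<Rightarrow> nat \<Rightarrow> nat list \<Rightarrow> nat list \<Rightarrow> region" where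
  "NR3 x y z a b =
     (NR_upper x y a b \<union> (NR_lower x y z a b - NR_half_dent a))
     - NR_a_dents a - NR_b_dents x y a b"

definition M_NR3 :: "nat \<Rightarrow> nat \<Rightarrow> nat \<Rightarrow> nat list \<Rightarrow> nat list \<Rightarrow> real" where
  "M_NR3 x y z a b = tiling_sum (zigzag_weight (NR_A y a b)) (NR3 x y z a b)"

end

theory Submission
  imports Defs "Jordan_Normal_Form.Determinant" "HOL-Combinatorics.Multiset_Permutations"
begin

text \<open>
  Cut the region along the line \<open>k = 0\<close>. The set \<open>S\<close> of positions of the vertical lozenges that
  cross the line is a \<open>y\<close>-subset of the window of \<open>x + y\<close> positions left free by the dents, and for
  given \<open>S\<close> the upper and the lower part are a quartered hexagon of type \<open>Q'\<close> and \<open>K\<close> with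
  additional unit dents at \<open>S\<close>. Peeling off one row at a time, with interlacing sums turned into
  determinants, one finds that both tiling numbers are products: up to constants they are the
  Vandermonde product in the squares \<open>(p + 1/2)\<^sup>2\<close> of the dent positions \<open>p\<close>, for \<open>Q'\<close> multiplied by
  all \<open>p + 1/2\<close>. As the dents above and below the line together exhaust the positions outside the
  window, the sum over \<open>S\<close> is a discrete Selberg sum that depends only on the window.
  By Andreief's identity it is a determinant of moments, which have a closed form, and the
  resulting Hankel determinant is evaluated with the Chu--Vandermonde identity. For \<open>y = 0\<close> only
  \<open>S = {}\<close> contributes, so both formulas follow by comparing closed forms.
\<close>

section \<open>Determinants\<close>

text \<open>Products arise because both west zigzags act as a mirror at the axis u = 0. Summing over
  interlacing positions inverts a central difference, so each row replaces a function by an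
  antidifference, and the zigzag fixes the constant of summation: the inner zigzag makes the
  functions of odd index vanish on the axis, the outer one makes them antisymmetric, which is what
  the weight 1/2 achieves. What remains is even or odd about the axis, hence expressed by the square
  of the distance p + 1/2 of a dent from it.

  The half triangle and the step of length z do not disturb this. The former is what a run of a_1
  unit dents at the zigzag removes together with the lozenges it forces. The latter amounts to a
  trapezoid over a base of length L + z with a triangle of side z removed at its end, whence the
  last entry of t^-. Above and below together, the window has \<open>sum_list a\<close> dents on its
  left and \<open>sum_list b + z\<close> on its right.

  The height of a part prescribes its number of dents, and this forces |S| = y.\<close>

lemma det_mat_def:
  "det (mat n n f) = (\<Sum>p | p permutes {0..<n}. signof p * (\<Prod>i=0..<n. f (i, p i)))"
proof -
  have "(\<Prod>i=0..<n. mat n n f $$ (i, p i)) = (\<Prod>i=0..<n. f (i, p i))" if "p permutes {0..<n}" for p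
    using that by (intro prod.cong) auto
  then show ?thesis by (simp add: det_def)
qed

lemma det_row_factors:
  "det (mat n n (\<lambda>(i, j). c i * A i j)) = (\<Prod>i=0..<n. c i) * det (mat n n (\<lambda>(i, j). A i j))"
  by (simp add: det_mat_def prod.distrib sum_distrib_left mult.left_commute)

lemma det_col_factors:
  fixes c :: "nat \<Rightarrow> 'a :: comm_ring_1"
  shows "det (mat n n (\<lambda>(i, j). c j * A i j)) = (\<Prod>j=0..<n. c j) * det (mat n n (\<lambda>(i, j). A i j))"
proof -
  have "(\<Prod>i=0..<n. c (p i)) = (\<Prod>j=0..<n. c j)" if "p permutes {0..<n}" for p
    using prod.permute[OF that, of c] by (simp add: comp_def)
  then show ?thesis
    by (simp add: det_mat_def prod.distrib sum_distrib_left mult.left_commute)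
qed

lemma det_row_sums:
  fixes \<phi> :: "nat \<Rightarrow> nat \<Rightarrow> 'x \<Rightarrow> 'a :: comm_ring_1"
  assumes "\<And>i. i < n \<Longrightarrow> finite (I i)"
  shows "det (mat n n (\<lambda>(i, j). \<Sum>x\<in>I i. \<phi> i j x)) =
    (\<Sum>f\<in>PiE {0..<n} I. det (mat n n (\<lambda>(i, j). \<phi> i j (f i))))"
proof -
  have "(\<Prod>i=0..<n. \<Sum>x\<in>I i. \<phi> i (p i) x) = (\<Sum>f\<in>PiE {0..<n} I. \<Prod>i=0..<n. \<phi> i (p i) (f i))" for p
    using assms by (intro prod_sum_PiE) auto
  then show ?thesis
    by (simp add: det_mat_def sum_distrib_left) (rule sum.swap)
qed

text \<open>Leibniz expansion of the second determinant leaves, for each permutation p, a product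
  that scales the rows of the first one. Summing over f row by row gives the moment matrix with its
  rows permuted by p; the sign of this cancels \<open>signof p\<close>, so all n! terms
  agree.\<close>

lemma andreief:
  fixes \<phi> \<psi> :: "nat \<Rightarrow> 'x \<Rightarrow> 'a :: comm_ring_1"
  assumes "finite E"
  shows "(\<Sum>f\<in>PiE {0..<n} (\<lambda>_. E). det (mat n n (\<lambda>(i, j). \<phi> j (f i))) * det (mat n n (\<lambda>(i, j). \<psi> j (f i))))
    = of_nat (fact n) * det (mat n n (\<lambda>(k, j). \<Sum>x\<in>E. \<psi> k x * \<phi> j x))"
    (is "?L = _ * det ?M")
proof -
  have *: "(\<Sum>f\<in>PiE {0..<n} (\<lambda>_. E). (\<Prod>i=0..<n. \<psi> (p i) (f i)) * det (mat n n (\<lambda>(i, j). \<phi> j (f i))))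
      = signof p * det ?M" if p: "p permutes {0..<n}" for p
  proof -
    have "(\<Sum>f\<in>PiE {0..<n} (\<lambda>_. E). (\<Prod>i=0..<n. \<psi> (p i) (f i)) * det (mat n n (\<lambda>(i, j). \<phi> j (f i))))
        = (\<Sum>f\<in>PiE {0..<n} (\<lambda>_. E). det (mat n n (\<lambda>(i, j). \<psi> (p i) (f i) * \<phi> j (f i))))"
      by (simp only: det_row_factors)
    also have "\<dots> = det (mat n n (\<lambda>(i, j). \<Sum>x\<in>E. \<psi> (p i) x * \<phi> j x))"
      by (rule det_row_sums[symmetric]) (use assms in simp)
    also have "mat n n (\<lambda>(i, j). \<Sum>x\<in>E. \<psi> (p i) x * \<phi> j x) = mat n n (\<lambda>(i, j). ?M $$ (p i, j))"
      by (rule eq_matI) (use permutes_in_image[OF p] in auto)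
    also have "det \<dots> = signof p * det ?M"
      by (rule det_permute_rows[OF _ p]) simp
    finally show ?thesis .
  qed
  have "?L = (\<Sum>p | p permutes {0..<n}. signof p *
      (\<Sum>f\<in>PiE {0..<n} (\<lambda>_. E). (\<Prod>i=0..<n. \<psi> (p i) (f i)) * det (mat n n (\<lambda>(i, j). \<phi> j (f i)))))"
    by (subst (2) det_mat_def, simp add: sum_distrib_left, subst sum.swap, simp add: mult_ac)
  also have "\<dots> = (\<Sum>p | p permutes {0..<n}. det ?M)"
    by (intro sum.cong refl, subst *) (auto simp: sign_def)
  also have "\<dots> = of_nat (fact n) * det ?M"
    by (simp add: card_permutations)
  finally show ?thesis .
qed

lemma det_mult_mat:
  fixes A B :: "nat \<Rightarrow> nat \<Rightarrow> 'a :: comm_ring_1"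
  shows "det (mat n n (\<lambda>(i, j). \<Sum>k<n. A i k * B k j)) =
    det (mat n n (\<lambda>(i, j). A i j)) * det (mat n n (\<lambda>(i, j). B i j))"
proof -
  have "mat n n (\<lambda>(i, j). \<Sum>k<n. A i k * B k j) = mat n n (\<lambda>(i, j). A i j) * mat n n (\<lambda>(i, j). B i j)"
    by (rule eq_matI) (auto simp: scalar_prod_def lessThan_atLeast0)
  then show ?thesis by (simp add: det_mult[of _ n])
qed

lemma det_unit_upper:
  fixes A :: "nat \<Rightarrow> nat \<Rightarrow> 'a :: comm_ring_1"
  assumes "\<And>i j. j < i \<Longrightarrow> i < n \<Longrightarrow> A i j = 0" "\<And>i. i < n \<Longrightarrow> A i i = 1"
  shows "det (mat n n (\<lambda>(i, j). A i j)) = 1"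
proof -
  have "det (mat n n (\<lambda>(i, j). A i j)) = prod_list (diag_mat (mat n n (\<lambda>(i, j). A i j)))"
    by (rule det_upper_triangular[where n = n]) (auto simp: assms upper_triangular_def)
  also have "\<dots> = 1" by (simp add: prod_list_diag_prod assms)
  finally show ?thesis .
qed

lemma det_lower:
  fixes A :: "nat \<Rightarrow> nat \<Rightarrow> 'a :: idom"
  assumes "\<And>i j. i < j \<Longrightarrow> j < n \<Longrightarrow> A i j = 0"
  shows "det (mat n n (\<lambda>(i, j). A i j)) = (\<Prod>i<n. A i i)"
proof -
  have "det (mat n n (\<lambda>(i, j). A i j)) = prod_list (diag_mat (mat n n (\<lambda>(i, j). A i j)))"
    by (rule det_lower_triangular[where n = n]) (auto simp: assms)
  also have "\<dots> = (\<Prod>i<n. A i i)"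
    by (simp add: prod_list_diag_prod lessThan_atLeast0)
  finally show ?thesis .
qed

text \<open>Coefficients of the Newton basis with nodes \<open>b\<close> with respect to that with nodes \<open>c\<close>.\<close>

fun newton_coeff :: "(nat \<Rightarrow> 'a :: comm_ring_1) \<Rightarrow> (nat \<Rightarrow> 'a) \<Rightarrow> nat \<Rightarrow> nat \<Rightarrow> 'a" where
  "newton_coeff b c m 0 = (if m = 0 then 1 else 0)"
| "newton_coeff b c m (Suc j) =
    (if m = 0 then 0 else newton_coeff b c (m - 1) j) + (c m - b j) * newton_coeff b c m j"

lemma newton_coeff_lower: "j < m \<Longrightarrow> newton_coeff b c m j = 0"
  by (induction b c m j rule: newton_coeff.induct) auto

lemma newton_coeff_diag: "newton_coeff b c j j = 1"
  by (induction j) (auto simp: newton_coeff_lower)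

lemma newton_basis_change:
  fixes b c :: "nat \<Rightarrow> 'a :: comm_ring_1"
  assumes "j < n"
  shows "(\<Prod>t<j. Y - b t) = (\<Sum>m<n. (\<Prod>t<m. Y - c t) * newton_coeff b c m j)"
  using assms
proof (induction j)
  case 0
  have "(\<Sum>m<n. (\<Prod>t<m. Y - c t) * newton_coeff b c m 0) = (\<Sum>m\<in>{0}. (\<Prod>t<m. Y - c t) * newton_coeff b c m 0)"
    by (rule sum.mono_neutral_right) (use 0 in auto)
  then show ?case by simp
next
  case (Suc j)
  obtain n' where n: "n = Suc n'" using Suc.prems by (cases n) auto
  let ?N = "\<lambda>m. \<Prod>t<m. Y - c t"
  have "(\<Sum>m<n. ?N m * (if m = 0 then 0 else newton_coeff b c (m - 1) j))
      = (\<Sum>m<n'. ?N (Suc m) * newton_coeff b c m j)"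
    unfolding n by (subst sum.lessThan_Suc_shift) simp
  also have "\<dots> = (\<Sum>m<n. ?N (Suc m) * newton_coeff b c m j)"
    using Suc.prems by (simp add: n newton_coeff_lower)
  finally have "(\<Sum>m<n. ?N m * newton_coeff b c m (Suc j)) =
      (\<Sum>m<n. ?N (Suc m) * newton_coeff b c m j) + (\<Sum>m<n. ?N m * ((c m - b j) * newton_coeff b c m j))"
    by (simp add: distrib_left sum.distrib)
  also have "\<dots> = (\<Sum>m<n. ?N m * newton_coeff b c m j) * (Y - b j)"
    unfolding sum.distrib[symmetric] sum_distrib_right
    by (rule sum.cong) (simp_all add: algebra_simps)
  finally show ?case using Suc by simp
qed

text \<open>Choosing the \<open>y i\<close> themselves as nodes makes the matrix lower triangular,
  and the change of Newton basis is unitriangular. The nodes are kept arbitrary because later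
  determinants come with different ones: half-odd squares from various starting points, and
  integers.\<close>

lemma newton_vandermonde:
  fixes y b :: "nat \<Rightarrow> 'a :: idom"
  shows "det (mat n n (\<lambda>(i, j). \<Prod>t<j. y i - b t)) = (\<Prod>i<n. \<Prod>k<i. y i - y k)"
proof -
  have "mat n n (\<lambda>(i, j). \<Prod>t<j. y i - b t)
      = mat n n (\<lambda>(i, j). \<Sum>m<n. (\<Prod>t<m. y i - y t) * newton_coeff b y m j)"
    by (rule eq_matI) (auto intro!: newton_basis_change)
  also have "det \<dots> = det (mat n n (\<lambda>(i, j). \<Prod>t<j. y i - y t)) * det (mat n n (\<lambda>(i, j). newton_coeff b y i j))"
    by (rule det_mult_mat)
  also have "det (mat n n (\<lambda>(i, j). newton_coeff b y i j)) = 1"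
    by (rule det_unit_upper) (auto simp: newton_coeff_lower newton_coeff_diag)
  also have "det (mat n n (\<lambda>(i, j). \<Prod>t<j. y i - y t)) = (\<Prod>i<n. \<Prod>k<i. y i - y k)"
    by (rule det_lower) (auto intro!: prod_zero)
  finally show ?thesis by simp
qed

text \<open>The reversal matrix \<open>J\<close> enters once from each side. It squares to the
  identity, so its determinant squares to 1 and its sign need not be known.\<close>

lemma det_reverse:
  fixes A :: "nat \<Rightarrow> nat \<Rightarrow> 'a :: comm_ring_1"
  shows "det (mat n n (\<lambda>(i, j). A (n - 1 - i) (n - 1 - j))) = det (mat n n (\<lambda>(i, j). A i j))"
proof -
  define J :: "nat \<Rightarrow> nat \<Rightarrow> 'a" where "J i k = (if k = n - 1 - i then 1 else 0)" for i k
  have J1: "(\<Sum>k<n. J i k * f k) = f (n - 1 - i)" if "i < n" for i and f :: "nat \<Rightarrow> 'a"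
    using that by (simp add: J_def if_distrib if_distribR sum.delta cong: if_cong)
  have "det (mat n n (\<lambda>(i, j). A (n - 1 - i) (n - 1 - j))) =
      det (mat n n (\<lambda>(i, j). \<Sum>k<n. A (n - 1 - i) k * J k j))"
  proof (intro arg_cong[where f = det] eq_matI)
    fix i j assume "i < dim_row (mat n n (\<lambda>(i, j). \<Sum>k<n. A (n - 1 - i) k * J k j))"
      "j < dim_col (mat n n (\<lambda>(i, j). \<Sum>k<n. A (n - 1 - i) k * J k j))"
    then have ij: "i < n" "j < n" by auto
    have "J k j = J j k" if "k < n" for k using that ij by (auto simp: J_def)
    then have "(\<Sum>k<n. A (n - 1 - i) k * J k j) = (\<Sum>k<n. J j k * A (n - 1 - i) k)"
      by (intro sum.cong) (auto simp: mult.commute)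
    with ij J1[of j "A (n - 1 - i)"] show "mat n n (\<lambda>(i, j). A (n - 1 - i) (n - 1 - j)) $$ (i, j) =
        mat n n (\<lambda>(i, j). \<Sum>k<n. A (n - 1 - i) k * J k j) $$ (i, j)" by simp
  qed auto
  also have "\<dots> = det (mat n n (\<lambda>(i, j). A (n - 1 - i) j)) * det (mat n n (\<lambda>(i, j). J i j))"
    by (rule det_mult_mat)
  also have "mat n n (\<lambda>(i, j). A (n - 1 - i) j) = mat n n (\<lambda>(i, j). \<Sum>k<n. J i k * A k j)"
    by (rule eq_matI) (auto simp: J1)
  also have "det \<dots> = det (mat n n (\<lambda>(i, j). J i j)) * det (mat n n (\<lambda>(i, j). A i j))"
    by (rule det_mult_mat)
  finally have 1: "det (mat n n (\<lambda>(i, j). A (n - 1 - i) (n - 1 - j))) =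
      det (mat n n (\<lambda>(i, j). J i j)) * det (mat n n (\<lambda>(i, j). J i j)) * det (mat n n (\<lambda>(i, j). A i j))"
    by (simp add: mult_ac)
  have "det (mat n n (\<lambda>(i, j). J i j)) * det (mat n n (\<lambda>(i, j). J i j)) =
      det (mat n n (\<lambda>(i, j). \<Sum>k<n. J i k * J k j))"
    by (rule det_mult_mat[symmetric])
  also have "\<dots> = 1"
    by (rule det_unit_upper) (auto simp: J1, auto simp: J_def)
  finally show ?thesis using 1 by simp
qed

text \<open>The summation matrix that restores \<open>A\<close> from its row differences is unit
  lower triangular. Telescoping sums over gaps produce such differences.\<close>

lemma det_row_differences:
  fixes A :: "nat \<Rightarrow> nat \<Rightarrow> 'a :: idom"
  shows "det (mat n n (\<lambda>(i, j). A i j - (if i = 0 then 0 else A (i - 1) j))) = det (mat n n (\<lambda>(i, j). A i j))"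
proof -
  define D where "D i j = A i j - (if i = 0 then 0 else A (i - 1) j)" for i j
  have tele: "(\<Sum>k\<le>i. D k j) = A i j" for i j
    by (induction i) (auto simp: D_def)
  have "mat n n (\<lambda>(i, j). A i j) = mat n n (\<lambda>(i, j). \<Sum>k<n. (if k \<le> i then 1 else 0) * D k j)"
  proof (rule eq_matI)
    fix i j assume "i < dim_row (mat n n (\<lambda>(i, j). \<Sum>k<n. (if k \<le> i then 1 else 0) * D k j))"
      "j < dim_col (mat n n (\<lambda>(i, j). \<Sum>k<n. (if k \<le> i then 1 else 0) * D k j))"
    then have ij: "i < n" "j < n" by auto
    have "(\<Sum>k<n. (if k \<le> i then 1 else 0) * D k j) = (\<Sum>k\<le>i. D k j)"
      by (rule sum.mono_neutral_cong_right) (use ij in auto)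
    then show "mat n n (\<lambda>(i, j). A i j) $$ (i, j) =
        mat n n (\<lambda>(i, j). \<Sum>k<n. (if k \<le> i then 1 else 0) * D k j) $$ (i, j)"
      using ij by (simp add: tele)
  qed auto
  then have "det (mat n n (\<lambda>(i, j). A i j)) =
      det (mat n n (\<lambda>(i, j). if j \<le> i then 1 else 0 :: 'a)) * det (mat n n (\<lambda>(i, j). D i j))"
    using det_mult_mat[of n "\<lambda>i k. if k \<le> i then 1 else 0" D] by simp
  also have "det (mat n n (\<lambda>(i, j). if j \<le> i then 1 else 0 :: 'a)) = 1"
    by (subst det_lower) auto
  finally show ?thesis by (simp add: D_def)
qed

text \<open>Subtracting consecutive rows clears the constant first column except for its top entry.\<close>

lemma det_first_column_one:
  fixes A :: "nat \<Rightarrow> nat \<Rightarrow> 'a :: idom"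
  assumes "\<And>i. i \<le> n \<Longrightarrow> A i 0 = 1"
  shows "det (mat (Suc n) (Suc n) (\<lambda>(i, j). A i j)) =
    det (mat n n (\<lambda>(i, j). A (Suc i) (Suc j) - A i (Suc j)))"
proof -
  define D where "D i j = A i j - (if i = 0 then 0 else A (i - 1) j)" for i j
  have "det (mat (Suc n) (Suc n) (\<lambda>(i, j). A i j)) = det (mat (Suc n) (Suc n) (\<lambda>(i, j). D i j))"
    unfolding D_def by (rule det_row_differences[symmetric])
  also have "mat (Suc n) (Suc n) (\<lambda>(i, j). D i j) =
     four_block_mat (mat 1 1 (\<lambda>(i, j). D i j)) (mat 1 n (\<lambda>(i, j). D 0 (Suc j)))
       (0\<^sub>m n 1) (mat n n (\<lambda>(i, j). D (Suc i) (Suc j)))"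
    by (rule eq_matI) (auto simp: D_def assms Suc_diff_Suc)
  also have "det \<dots> = det (mat 1 1 (\<lambda>(i, j). D i j)) * det (mat n n (\<lambda>(i, j). D (Suc i) (Suc j)))"
    by (rule det_four_block_mat_lower_left_zero[of _ 1 _ n]) auto
  also have "det (mat 1 1 (\<lambda>(i, j). D i j)) = 1"
    by (subst det_single) (auto simp: D_def assms)
  finally show ?thesis by (simp add: D_def)
qed

section \<open>A discrete Selberg sum\<close>

text \<open>\<open>s + 1/2\<close> is the abscissa of the midpoint of the base segment from s to s +
  1, so this is its squared distance from the west axis.\<close>

definition sqh :: "nat \<Rightarrow> real" where
  "sqh s = (real s + 1 / 2)\<^sup>2"

lemma sqh_diff: "sqh s - sqh d = (real s - real d) * (real s + real d + 1)"
  by (simp add: sqh_def power2_eq_square algebra_simps)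

lemma sqh_strict_mono: "p < q \<Longrightarrow> sqh p < sqh q"
  by (auto simp: sqh_def intro!: power_strict_mono)

lemma sqh_less_iff: "sqh p < sqh q \<longleftrightarrow> p < q"
  using sqh_strict_mono[of p q] sqh_strict_mono[of q p] by (cases p q rule: linorder_cases) auto

text \<open>By \<open>sqh_diff\<close> the factors are s - d and s + d + 1; together they run
  through the 2a consecutive integers from s - a + 1 to s + a.\<close>

lemma prod_sqh_diff_pochhammer:
  "(\<Prod>d<a. sqh s - sqh d) = pochhammer (real s - real a + 1) (2 * a)"
proof (induction a)
  case (Suc a)
  have "pochhammer (real s - real a) (Suc (Suc (2 * a))) =
      (real s - real a) * pochhammer (real s - real a + 1) (2 * a) * (real s + real a + 1)"
    by (subst pochhammer_rec, subst pochhammer_Suc) (simp add: algebra_simps)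
  with Suc show ?case by (simp add: sqh_diff mult_ac)
qed simp

text \<open>The case c = 0 of the moment formula. The right side is an explicit antidifference in G
  of the summand.\<close>

lemma window_moment_aux:
  assumes "a \<le> G"
  shows "(\<Sum>s=a..<G. 2 * (real s + 1 / 2) * (\<Prod>d<a. sqh s - sqh d)) =
    pochhammer (real G - real a) (2 * a + 1) * real G / (real a + 1)"
  using assms
proof (induction G rule: dec_induct)
  case (step G)
  let ?P = "pochhammer (real G - real a + 1) (2 * a)"
  have 1: "pochhammer (real (Suc G) - real a) (2 * a + 1) = ?P * (real G + real a + 1)"
    by (simp add: pochhammer_Suc algebra_simps)
  have 2: "pochhammer (real G - real a) (2 * a + 1) = (real G - real a) * ?P"
    by (simp add: pochhammer_rec)
  show ?case using step unfolding 1 2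
    by (simp add: prod_sqh_diff_pochhammer) (simp add: field_simps)
qed (simp add: pochhammer_rec)

text \<open>The induction step is the identity
  \<open>sqh (G + c) - sqh s = (sqh (G + c) - sqh a) - (sqh s - sqh a)\<close>, which expresses the moment
  of \<open>(a, c + 1)\<close> by those of \<open>(a, c)\<close> and \<open>(a + 1, c)\<close>.\<close>

lemma window_moment:
  assumes "a \<le> G"
  shows "(\<Sum>s=a..<G. 2 * (real s + 1 / 2) * (\<Prod>d<a. sqh s - sqh d) * (\<Prod>t<c. sqh (G + t) - sqh s)) =
    fact a * fact c / fact (a + c + 1) * pochhammer (real G - real a) (2 * a + c + 1)
      * pochhammer (real G) (c + 1)"
  using assms
proof (induction c arbitrary: a)
  case 0
  have "fact (a + 0 + 1) = (real a + 1) * fact a" by (simp add: algebra_simps)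
  with 0 window_moment_aux[of a G] show ?case by simp
next
  case (Suc c)
  define f where "f a c = (\<Sum>s=a..<G. 2 * (real s + 1 / 2) * (\<Prod>d<a. sqh s - sqh d) * (\<Prod>t<c. sqh (G + t) - sqh s))"
    for a c
  show ?case
  \<comment> \<open>For a = G both sides are 0; for a < G the recursion may call the moment with a +
    1.\<close>
  proof (cases "a = G")
    case True
    then show ?thesis by (simp add: pochhammer_rec)
  next
    case False
    then have aG: "Suc a \<le> G" using Suc.prems by simp
    have split: "{a..<G} = insert a {Suc a..<G}" using aG by auto
    \<comment> \<open>The term s = a contains the factor \<open>sqh a - sqh a\<close>, so the moment
      of a + 1 may be summed over the window of a.\<close>
    have "f (Suc a) c = (\<Sum>s=a..<G. 2 * (real s + 1 / 2) * (\<Prod>d<Suc a. sqh s - sqh d) * (\<Prod>t<c. sqh (G + t) - sqh s))"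
      unfolding split f_def by simp
    then have "f a (Suc c) = (sqh (G + c) - sqh a) * f a c - f (Suc a) c"
      unfolding f_def by (simp add: sum_distrib_left sum_subtractf[symmetric] algebra_simps)
    also have "sqh (G + c) - sqh a = (real G + real c - real a) * (real G + real c + real a + 1)"
      by (simp add: sqh_diff)
    finally have rec: "f a (Suc c) =
        (real G + real c - real a) * (real G + real c + real a + 1) * f a c - f (Suc a) c" .
    let ?P = "pochhammer (real G - real a) (2 * a + c + 1)" and ?Q = "pochhammer (real G) (c + 1)"
    have P1: "pochhammer (real G - real a) (2 * a + Suc c + 1) = ?P * (real G + real a + real c + 1)"
      by (simp add: pochhammer_Suc algebra_simps)
    have "pochhammer (real G - real (Suc a)) (2 * Suc a + c + 1) =
        (real G - real a - 1) * pochhammer (real G - real a) (2 * a + Suc c + 1)"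
      using pochhammer_rec[of "real G - real (Suc a)" "2 * a + Suc c + 1"] by simp
    then have P2: "pochhammer (real G - real (Suc a)) (2 * Suc a + c + 1) =
        (real G - real a - 1) * (?P * (real G + real a + real c + 1))"
      unfolding P1 .
    have Q1: "pochhammer (real G) (Suc c + 1) = ?Q * (real G + real c + 1)"
      by (simp add: pochhammer_Suc algebra_simps)
    have IH1: "f a c = fact a * fact c / fact (a + c + 1) * ?P * ?Q"
      unfolding f_def by (rule Suc.IH) (use Suc.prems in simp)
    have IH2: "f (Suc a) c = fact (Suc a) * fact c / fact (Suc a + c + 1) *
        ((real G - real a - 1) * (?P * (real G + real a + real c + 1))) * ?Q"
      unfolding f_def P2[symmetric] by (rule Suc.IH) (use aG in simp)
    have F: "fact (a + Suc c + 1) = (real a + real c + 2) * fact (a + c + 1)"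
      "fact (Suc a + c + 1) = (real a + real c + 2) * fact (a + c + 1)"
      "fact (Suc a) = (real a + 1) * fact a" "fact (Suc c) = (real c + 1) * fact c"
      by (simp_all add: algebra_simps)
    have nz: "real a + real c + 2 \<noteq> 0" by linarith
    \<comment> \<open>With factorials and Pochhammer symbols replaced by letters, the recursion is a
      single rational identity.\<close>
    have alg: "(u + c' - a') * (u + c' + a' + 1) * (A * C / D * P * Q)
        - (a' + 1) * A * C / ((a' + c' + 2) * D) * ((u - a' - 1) * (P * (u + a' + c' + 1))) * Q
      = A * ((c' + 1) * C) / ((a' + c' + 2) * D) * (P * (u + a' + c' + 1)) * (Q * (u + c' + 1))"
      if "D \<noteq> 0" "a' + c' + 2 \<noteq> 0" for u c' a' A C D P Q :: real
      using that by (simp add: divide_simps) (simp add: algebra_simps)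
    show ?thesis
      unfolding f_def[symmetric] rec IH1 IH2 F P1 Q1
      by (rule alg) (use nz in simp_all)
  qed
qed

lemma fact_ratio_falling:
  "m \<le> N \<Longrightarrow> fact N / fact (N - m) = (\<Prod>t<m. real N - real t)"
proof (induction m)
  case (Suc m)
  then have "fact (N - m) = (real N - real m) * fact (N - Suc m)"
    by (metis Suc_diff_Suc Suc_le_eq fact_Suc of_nat_diff order_less_imp_le of_nat_fact of_nat_mult)
  moreover have "fact N = (\<Prod>t<m. real N - real t) * fact (N - m)"
    using Suc by (simp add: field_simps)
  ultimately show ?case by simp
qed simp

text \<open>The Chu--Vandermonde identity is a factorization of the matrix into one whose entries are
  polynomials in the row index and a unitriangular matrix of binomial coefficients.\<close>

lemma hankel_factorial_det:
  assumes "y \<le> Suc g"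
  shows "det (mat y y (\<lambda>(j, k). fact (E + j + k + g) / fact (E + j + k) :: real)) =
    (\<Prod>j<y. (-1) ^ j * fact j * (fact g / fact (g - j)) * (fact (E + j + g) / fact (E + j + y - 1)))"
proof -
  \<comment> \<open>Chu-Vandermonde splits an entry into a sum over m. \<open>R\<close> depends on
    the row only and \<open>C\<close> on m only; the numerator inserted into \<open>B\<close> and
    cancelled in \<open>R\<close> makes \<open>B\<close> a falling factorial.\<close>
  define R where "R j = (fact (E + j + g) / fact (E + j + y - 1) :: real)" for j
  define C where "C m = (fact g / fact (g - m) :: real)" for m
  define B where "B j m = (fact (E + j + y - 1) / fact (E + j + m) :: real)" for j m
  have entry: "(\<Sum>m<y. R j * (C m * B j m) * real (k choose m)) =
      fact (E + j + k + g) / fact (E + j + k)" if "k < y" for j k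
  proof -
    have "real (E + j + k + g choose g) = (\<Sum>m\<le>g. real (k choose m) * real (E + j + g choose (g - m)))"
      using vandermonde[of k "E + j + g" g] by (simp add: add_ac flip: of_nat_mult of_nat_sum)
    \<comment> \<open>All m < y occur because y \<le> g + 1, and the terms with m \<ge> y > k
      vanish.\<close>
    also have "\<dots> = (\<Sum>m<y. real (k choose m) * real (E + j + g choose (g - m)))"
      by (rule sum.mono_neutral_right) (use assms that in \<open>auto simp: not_less\<close>)
    finally have "fact g * real (E + j + k + g choose g) =
        (\<Sum>m<y. fact g * (real (k choose m) * real (E + j + g choose (g - m))))"
      by (simp add: sum_distrib_left)
    moreover have "fact g * real (E + j + k + g choose g) = fact (E + j + k + g) / fact (E + j + k)"
      by (simp add: binomial_fact)
    moreover have "fact g * (real (k choose m) * real (E + j + g choose (g - m))) =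
        R j * (C m * B j m) * real (k choose m)" if "m < y" for m
    proof -
      have "E + j + g - (g - m) = E + j + m" using that assms by simp
      then have "real (E + j + g choose (g - m)) = fact (E + j + g) / (fact (g - m) * fact (E + j + m))"
        by (simp add: binomial_fact)
      then show ?thesis by (simp add: R_def C_def B_def)
    qed
    ultimately show ?thesis by simp
  qed
  have "mat y y (\<lambda>(j, k). fact (E + j + k + g) / fact (E + j + k) :: real) =
      mat y y (\<lambda>(j, k). \<Sum>m<y. R j * (C m * B j m) * real (k choose m))"
    by (rule eq_matI) (auto simp: entry)
  also have "det \<dots> = det (mat y y (\<lambda>(j, m). R j * (C m * B j m))) * det (mat y y (\<lambda>(m, k). real (k choose m)))"
    by (rule det_mult_mat)
  also have "det (mat y y (\<lambda>(m, k). real (k choose m))) = 1"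
    by (rule det_unit_upper) auto
  also have "det (mat y y (\<lambda>(j, m). R j * (C m * B j m))) =
      (\<Prod>j=0..<y. R j) * ((\<Prod>j=0..<y. C j) * det (mat y y (\<lambda>(j, m). B j m)))"
    by (simp only: det_row_factors det_col_factors)
  \<comment> \<open>Read backwards, the entry in column m is a falling factorial with m factors,
    that is, a Newton polynomial with nodes 0, 1, 2, and so on.\<close>
  also have "det (mat y y (\<lambda>(j, m). B j m)) = det (mat y y (\<lambda>(j, m). B (y - 1 - j) (y - 1 - m)))"
    by (rule det_reverse[symmetric])
  also have "mat y y (\<lambda>(j, m). B (y - 1 - j) (y - 1 - m)) =
      mat y y (\<lambda>(j, m). \<Prod>t<m. real (E + 2 * y - 2 - j) - real t)"
  proof (rule eq_matI)
    fix j m assume "j < dim_row (mat y y (\<lambda>(j, m). \<Prod>t<m. real (E + 2 * y - 2 - j) - real t))"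
      "m < dim_col (mat y y (\<lambda>(j, m). \<Prod>t<m. real (E + 2 * y - 2 - j) - real t))"
    then have jm: "j < y" "m < y" by auto
    have 1: "E + (y - 1 - j) + y - 1 = E + 2 * y - 2 - j" using jm by simp
    have 2: "E + (y - 1 - j) + (y - 1 - m) = (E + 2 * y - 2 - j) - m" using jm by simp
    have "B (y - 1 - j) (y - 1 - m) = fact (E + 2 * y - 2 - j) / fact ((E + 2 * y - 2 - j) - m)"
      unfolding B_def 1 2 ..
    also have "\<dots> = (\<Prod>t<m. real (E + 2 * y - 2 - j) - real t)"
      by (rule fact_ratio_falling) (use jm in simp)
    finally show "mat y y (\<lambda>(j, m). B (y - 1 - j) (y - 1 - m)) $$ (j, m) =
        mat y y (\<lambda>(j, m). \<Prod>t<m. real (E + 2 * y - 2 - j) - real t) $$ (j, m)"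
      using jm by simp
  qed auto
  also have "det \<dots> = (\<Prod>i<y. \<Prod>k<i. real (E + 2 * y - 2 - i) - real (E + 2 * y - 2 - k))"
    by (rule newton_vandermonde)
  \<comment> \<open>The arguments E + 2y - 2 - i decrease with i; this is the origin of the
    sign.\<close>
  also have "\<dots> = (\<Prod>i<y. (-1) ^ i * fact i)"
  proof (rule prod.cong[OF refl])
    fix i assume "i \<in> {..<y}"
    then have "(\<Prod>k<i. real (E + 2 * y - 2 - i) - real (E + 2 * y - 2 - k)) = (\<Prod>k<i. (-1) * (real i - real k))"
      by (intro prod.cong) (auto simp: of_nat_diff)
    also have "\<dots> = (-1) ^ i * (\<Prod>k<i. real i - real k)"
      by (simp only: prod.distrib prod_constant card_lessThan)
    also have "(\<Prod>k<i. real i - real k) = fact i"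
      using fact_ratio_falling[of i i] by simp
    finally show "(\<Prod>k<i. real (E + 2 * y - 2 - i) - real (E + 2 * y - 2 - k)) = (-1) ^ i * fact i" .
  qed
  finally show ?thesis
    by (simp add: R_def C_def prod.distrib lessThan_atLeast0 mult_ac prod_dividef)
qed

section \<open>Vandermonde products over sets of positions, and sums over subsets\<close>

definition vdm :: "nat set \<Rightarrow> real" where
  "vdm S = (\<Prod>q\<in>S. \<Prod>p\<in>{p \<in> S. p < q}. sqh q - sqh p)"

lemma vdm_pos: "finite S \<Longrightarrow> vdm S > 0"
  unfolding vdm_def by (intro prod_pos) (auto simp: sqh_less_iff)

lemma prod_ordered_pairs:
  fixes A :: "'b :: linorder set" and h :: "'b \<Rightarrow> 'b \<Rightarrow> 'c :: comm_monoid_mult"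
  assumes "finite A" "\<And>i k. h i k = h k i"
  shows "(\<Prod>i\<in>A. \<Prod>k\<in>A - {i}. h i k) = (\<Prod>i\<in>A. \<Prod>k\<in>{k \<in> A. k < i}. h i k) * (\<Prod>i\<in>A. \<Prod>k\<in>{k \<in> A. k < i}. h i k)"
proof -
  have "(\<Prod>k\<in>A - {i}. h i k) = (\<Prod>k\<in>{k \<in> A. k < i}. h i k) * (\<Prod>k\<in>{k \<in> A. i < k}. h i k)" for i
  proof -
    have eq: "A - {i} = {k \<in> A. k < i} \<union> {k \<in> A. i < k}" by auto
    show ?thesis unfolding eq by (rule prod.union_disjoint) (use assms(1) in auto)
  qed
  moreover have "(\<Prod>i\<in>A. \<Prod>k\<in>{k \<in> A. i < k}. h i k) = (\<Prod>i\<in>A. \<Prod>k\<in>{k \<in> A. k < i}. h i k)"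
    by (subst prod.swap_restrict[OF assms(1) assms(1)]) (simp add: assms(2))
  ultimately show ?thesis by (simp add: prod.distrib)
qed

text \<open>An enumeration f may list the set in any order, which affects only signs. With absolute
  values the square is a product over all ordered pairs of distinct indices, and this symmetric form
  can be transported along f.\<close>

lemma vdm_square_image:
  fixes f :: "nat \<Rightarrow> nat"
  assumes "inj_on f {0..<y}"
  shows "(\<Prod>i<y. \<Prod>k<i. sqh (f i) - sqh (f k))\<^sup>2 = (vdm (f ` {0..<y}))\<^sup>2"
proof -
  define h where "h p q = \<bar>sqh p - sqh q\<bar>" for p q
  have h: "h p q = h q p" for p q by (simp add: h_def abs_minus_commute)
  let ?S = "f ` {0..<y}"
  have "(\<Prod>i<y. \<Prod>k<i. sqh (f i) - sqh (f k))\<^sup>2 = \<bar>\<Prod>i<y. \<Prod>k<i. sqh (f i) - sqh (f k)\<bar>\<^sup>2" by simp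
  also have "\<bar>\<Prod>i<y. \<Prod>k<i. sqh (f i) - sqh (f k)\<bar> = (\<Prod>i\<in>{0..<y}. \<Prod>k\<in>{k \<in> {0..<y}. k < i}. h (f i) (f k))"
    unfolding abs_prod h_def by (intro prod.cong) auto
  also have "\<dots>\<^sup>2 = (\<Prod>i\<in>{0..<y}. \<Prod>k\<in>{0..<y} - {i}. h (f i) (f k))"
    unfolding power2_eq_square by (rule prod_ordered_pairs[symmetric]) (auto simp: h)
  also have "\<dots> = (\<Prod>i\<in>{0..<y}. \<Prod>q\<in>?S - {f i}. h (f i) q)"
  proof (rule prod.cong[OF refl])
    fix i assume "i \<in> {0..<y}"
    then have "?S - {f i} = f ` ({0..<y} - {i})" using assms by (auto simp: inj_on_def)
    moreover have "inj_on f ({0..<y} - {i})" using assms by (rule inj_on_subset) auto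
    ultimately show "(\<Prod>k\<in>{0..<y} - {i}. h (f i) (f k)) = (\<Prod>q\<in>?S - {f i}. h (f i) q)"
      by (simp add: prod.reindex)
  qed
  also have "\<dots> = (\<Prod>p\<in>?S. \<Prod>q\<in>?S - {p}. h p q)"
    by (simp add: prod.reindex[OF assms])
  also have "\<dots> = (\<Prod>p\<in>?S. \<Prod>q\<in>{q \<in> ?S. q < p}. h p q) * (\<Prod>p\<in>?S. \<Prod>q\<in>{q \<in> ?S. q < p}. h p q)"
    by (rule prod_ordered_pairs) (auto simp: h)
  also have "(\<Prod>p\<in>?S. \<Prod>q\<in>{q \<in> ?S. q < p}. h p q) = vdm ?S"
    unfolding vdm_def h_def by (intro prod.cong refl) (auto simp: less_imp_le sqh_strict_mono)
  finally show ?thesis by (simp add: power2_eq_square)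
qed

text \<open>Listing the values identifies these functions with the orderings of S.\<close>

lemma card_injections_with_image:
  assumes "S \<subseteq> E" "finite S" "card S = y"
  shows "card {f \<in> PiE {0..<y} (\<lambda>_. E). inj_on f {0..<y} \<and> f ` {0..<y} = S} = fact y"
proof -
  have "bij_betw (\<lambda>f. map f [0..<y]) {f \<in> PiE {0..<y} (\<lambda>_. E). inj_on f {0..<y} \<and> f ` {0..<y} = S}
      (permutations_of_set S)"
  proof (rule bij_betw_byWitness[where f' = "\<lambda>xs. restrict (nth xs) {0..<y}"])
    show "\<forall>f\<in>{f \<in> PiE {0..<y} (\<lambda>_. E). inj_on f {0..<y} \<and> f ` {0..<y} = S}.
        restrict (nth (map f [0..<y])) {0..<y} = f"
      by (auto intro!: PiE_ext[of _ "{0..<y}" "\<lambda>_. E"])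
    show "\<forall>xs\<in>permutations_of_set S. map (restrict (nth xs) {0..<y}) [0..<y] = xs"
      using assms by (auto simp: permutations_of_set_def distinct_card intro!: nth_equalityI)
    show "(\<lambda>f. map f [0..<y]) ` {f \<in> PiE {0..<y} (\<lambda>_. E). inj_on f {0..<y} \<and> f ` {0..<y} = S}
        \<subseteq> permutations_of_set S"
      by (auto simp: permutations_of_set_def distinct_map)
    show "(\<lambda>xs. restrict (nth xs) {0..<y}) ` permutations_of_set S
        \<subseteq> {f \<in> PiE {0..<y} (\<lambda>_. E). inj_on f {0..<y} \<and> f ` {0..<y} = S}"
    proof (intro image_subsetI CollectI conjI)
      fix xs assume "xs \<in> permutations_of_set S"
      then have xs: "set xs = S" "distinct xs" "length xs = y"
        using assms by (auto simp: permutations_of_set_def distinct_card)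
      show "restrict (nth xs) {0..<y} \<in> PiE {0..<y} (\<lambda>_. E)" using xs assms by auto
      show "inj_on (restrict (nth xs) {0..<y}) {0..<y}"
        using xs by (auto simp: inj_on_def nth_eq_iff_index_eq)
      show "restrict (nth xs) {0..<y} ` {0..<y} = S"
        using xs by (auto simp: in_set_conv_nth image_iff intro!: bexI)
    qed
  qed
  then show ?thesis using assms by (simp add: bij_betw_same_card)
qed

text \<open>Turns a sum over subsets into one over functions, the form required by
  \<open>andreief\<close>.\<close>

lemma sum_over_injections:
  fixes g :: "'x set \<Rightarrow> real"
  assumes "finite E"
  shows "(\<Sum>f | f \<in> PiE {0..<y} (\<lambda>_. E) \<and> inj_on f {0..<y}. g (f ` {0..<y})) =
    fact y * (\<Sum>S | S \<subseteq> E \<and> card S = y. g S)"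
proof -
  let ?I = "{f. f \<in> PiE {0..<y} (\<lambda>_. E) \<and> inj_on f {0..<y}}"
  let ?T = "{S. S \<subseteq> E \<and> card S = y}"
  have fin: "finite ?I" by (rule finite_subset[of _ "PiE {0..<y} (\<lambda>_. E)"]) (auto intro!: finite_PiE assms)
  have "(\<Sum>f\<in>?I. g (f ` {0..<y})) = (\<Sum>S\<in>?T. \<Sum>f\<in>{f \<in> ?I. f ` {0..<y} = S}. g (f ` {0..<y}))"
    by (rule sum.group[symmetric]) (use fin assms in \<open>auto simp: card_image\<close>)
  also have "\<dots> = (\<Sum>S\<in>?T. fact y * g S)"
  proof (rule sum.cong[OF refl])
    fix S assume S: "S \<in> ?T"
    have "{f \<in> ?I. f ` {0..<y} = S} = {f \<in> PiE {0..<y} (\<lambda>_. E). inj_on f {0..<y} \<and> f ` {0..<y} = S}"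
      by auto
    moreover have "finite S" using S assms by (auto dest: finite_subset)
    ultimately have "card {f \<in> ?I. f ` {0..<y} = S} = fact y"
      using card_injections_with_image[of S E y] S by simp
    then show "(\<Sum>f\<in>{f \<in> ?I. f ` {0..<y} = S}. g (f ` {0..<y})) = fact y * g S"
      by simp
  qed
  finally show ?thesis by (simp add: sum_distrib_left)
qed

lemma prod_lessThan_add:
  "(\<Prod>i<m + k. g (i :: nat)) = (\<Prod>i<m. g i) * (\<Prod>t<k. g (m + t) :: 'a :: comm_monoid_mult)"
  by (induction k) (simp_all add: mult.assoc)

lemma pochhammer_fact_ratio:
  assumes "n \<ge> 1"
  shows "pochhammer (real n) m = fact (n + m - 1) / fact (n - 1)"
proof (induction m)
  case (Suc m)
  have "n + Suc m - 1 = Suc (n + m - 1)" using assms by simp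
  then have "fact (n + Suc m - 1) = real (Suc (n + m - 1)) * fact (n + m - 1)"
    by (simp only: fact_Suc of_nat_mult of_nat_fact)
  then have "fact (n + Suc m - 1) = (real n + real m) * fact (n + m - 1)"
    using assms by (simp add: of_nat_diff)
  with Suc show ?case by (simp add: pochhammer_Suc)
qed simp

text \<open>Both copies of the Vandermonde product are written in Newton form. The nodes of
  \<open>\<psi>\<close> continue the factors of the weight belonging to the left of the window,
  those of \<open>\<phi>\<close> the factors belonging to its right, so entry (k, j) is, up to sign
  and a factor 1/2, the window moment for a + k and c + j. Apart from factors of a row or a column
  its closed form depends on k + j only, and what is left is the Hankel determinant with g = G - 1
  and E = a + c + 1.\<close>

lemma discrete_selberg:
  assumes "a \<le> G" "y \<le> G - a"
  shows "(\<Sum>S | S \<subseteq> {a..<G} \<and> card S = y. (vdm S)\<^sup>2 *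
      (\<Prod>s\<in>S. (real s + 1 / 2) * (\<Prod>d<a. sqh s - sqh d) * (\<Prod>t<c. sqh (G + t) - sqh s))) =
    (\<Prod>k<y. fact (a + k) * fact (c + k) * fact k / fact (a + c + k + y)
      * (fact (G + c + k) / fact (G - 1 - k)) * (fact (G + a + c + k) / fact (G - a - 1 - k)) / 2)"
    (is "?L = ?R")
proof -
  let ?E = "{a..<G}"
  define \<omega> where "\<omega> s = (real s + 1 / 2) * (\<Prod>d<a. sqh s - sqh d) * (\<Prod>t<c. sqh (G + t) - sqh s)" for s
  define \<phi> where "\<phi> j s = (\<Prod>t<j. sqh s - sqh (G + c + t))" for j s
  define \<psi> where "\<psi> k s = (\<Prod>t<k. sqh s - sqh (a + t))" for k s
  define V where "V f = (\<Prod>i<y. \<Prod>k<i. sqh (f i) - sqh (f k))" for f :: "nat \<Rightarrow> nat"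
  have d\<phi>: "det (mat y y (\<lambda>(i, j). \<phi> j (f i))) = V f" for f
    unfolding \<phi>_def V_def by (rule newton_vandermonde)
  have d\<psi>: "det (mat y y (\<lambda>(i, j). \<omega> (f i) * \<psi> j (f i))) = (\<Prod>i=0..<y. \<omega> (f i)) * V f" for f
    unfolding \<psi>_def V_def by (subst det_row_factors, subst newton_vandermonde) simp
  have "fact y * ?L = (\<Sum>f | f \<in> PiE {0..<y} (\<lambda>_. ?E) \<and> inj_on f {0..<y}.
      (vdm (f ` {0..<y}))\<^sup>2 * (\<Prod>s\<in>f ` {0..<y}. \<omega> s))"
    unfolding \<omega>_def by (rule sum_over_injections[symmetric]) simp
  also have "\<dots> = (\<Sum>f | f \<in> PiE {0..<y} (\<lambda>_. ?E) \<and> inj_on f {0..<y}. V f * ((\<Prod>i=0..<y. \<omega> (f i)) * V f))"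
  proof (rule sum.cong[OF refl])
    fix f assume "f \<in> {f. f \<in> PiE {0..<y} (\<lambda>_. ?E) \<and> inj_on f {0..<y}}"
    then have inj: "inj_on f {0..<y}" by auto
    show "(vdm (f ` {0..<y}))\<^sup>2 * (\<Prod>s\<in>f ` {0..<y}. \<omega> s) = V f * ((\<Prod>i=0..<y. \<omega> (f i)) * V f)"
      unfolding vdm_square_image[OF inj, folded V_def, symmetric]
      by (simp add: prod.reindex[OF inj] power2_eq_square mult_ac)
  qed
  \<comment> \<open>Functions that are not injective contribute nothing, since two equal values
    annul the Vandermonde product.\<close>
  also have "\<dots> = (\<Sum>f\<in>PiE {0..<y} (\<lambda>_. ?E). V f * ((\<Prod>i=0..<y. \<omega> (f i)) * V f))"
  proof (rule sum.mono_neutral_left)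
    show "finite (PiE {0..<y} (\<lambda>_. ?E))" by (intro finite_PiE) auto
    show "\<forall>f\<in>PiE {0..<y} (\<lambda>_. ?E) - {f. f \<in> PiE {0..<y} (\<lambda>_. ?E) \<and> inj_on f {0..<y}}.
        V f * ((\<Prod>i=0..<y. \<omega> (f i)) * V f) = 0"
    proof
      fix f assume "f \<in> PiE {0..<y} (\<lambda>_. ?E) - {f. f \<in> PiE {0..<y} (\<lambda>_. ?E) \<and> inj_on f {0..<y}}"
      then have "\<not> inj_on f {0..<y}" by auto
      then obtain i k where "k < i" "i < y" "f i = f k"
        by (metis atLeastLessThan_iff linorder_inj_onI' linorder_neqE_nat)
      then have "(\<Prod>k<i. sqh (f i) - sqh (f k)) = 0" by (intro prod_zero) auto
      with \<open>i < y\<close> have "V f = 0" unfolding V_def by (intro prod_zero) auto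
      then show "V f * ((\<Prod>i=0..<y. \<omega> (f i)) * V f) = 0" by simp
    qed
  qed auto
  also have "\<dots> = (\<Sum>f\<in>PiE {0..<y} (\<lambda>_. ?E). det (mat y y (\<lambda>(i, j). \<phi> j (f i))) *
      det (mat y y (\<lambda>(i, j). \<omega> (f i) * \<psi> j (f i))))"
    by (simp only: d\<phi> d\<psi>)
  also have "\<dots> = of_nat (fact y) * det (mat y y (\<lambda>(k, j). \<Sum>s\<in>?E. \<omega> s * \<psi> k s * \<phi> j s))"
    using andreief[of ?E y \<phi> "\<lambda>j s. \<omega> s * \<psi> j s"] by simp
  finally have L: "?L = det (mat y y (\<lambda>(k, j). \<Sum>s\<in>?E. \<omega> s * \<psi> k s * \<phi> j s))"
    by simp
  have alg: "\<sigma> / 2 * (A * B / D * (X / Y) * (U / W)) = A / Y * (\<sigma> * B * (U / W) / 2 * (X / D))"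
    for \<sigma> A B D X Y U W :: real by (simp add: mult_ac)
  \<comment> \<open>\<open>\<sigma>\<close> stands for (-1)^k. It occurs once through the reversed
    differences in \<open>\<phi>\<close> and once in the Hankel determinant, so the two signs
    cancel.\<close>
  have alg': "A / Y * (\<sigma> * B * (U / W) / 2 * (\<sigma> * C * (W / V) * (X / Z))) = A * B * C / Z * (U / V) * (X / Y) / 2"
    if "\<sigma> * \<sigma> = 1" "W \<noteq> 0" for \<sigma> A B C X Y Z U V W :: real
  proof -
    have "A / Y * (\<sigma> * B * (U / W) / 2 * (\<sigma> * C * (W / V) * (X / Z))) =
        (\<sigma> * \<sigma>) * (A * B * C / Z * (U / V) * (X / Y) / 2)"
      using that(2) by (simp add: mult_ac)
    then show ?thesis unfolding that(1) by simp
  qed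
  define P where "P k = (fact (a + k) / fact (G - a - 1 - k) :: real)" for k
  define Q where "Q j = ((-1) ^ j * fact (c + j) * (fact (G + c + j) / fact (G - 1)) / 2 :: real)" for j
  have entry: "(\<Sum>s\<in>?E. \<omega> s * \<psi> k s * \<phi> j s) =
      P k * (Q j * (fact ((a + c + 1) + k + j + (G - 1)) / fact ((a + c + 1) + k + j)))"
    if kj: "k < y" "j < y" for k j
  proof -
    define F where "F s = 2 * (real s + 1 / 2) * (\<Prod>d<a + k. sqh s - sqh d) * (\<Prod>t<c + j. sqh (G + t) - sqh s)" for s
    have "(-1) ^ j * (\<Prod>t<j. sqh (G + c + t) - sqh s) = (\<Prod>t<j. - 1 * (sqh (G + c + t) - sqh s))" for s
      by (simp only: prod.distrib prod_constant card_lessThan)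
    then have "\<phi> j s = (-1) ^ j * (\<Prod>t<j. sqh (G + (c + t)) - sqh s)" for s
      unfolding \<phi>_def by (simp add: add.assoc)
    then have "\<omega> s * \<psi> k s * \<phi> j s = (-1) ^ j / 2 * F s" for s
      by (simp add: \<omega>_def \<psi>_def F_def prod_lessThan_add mult_ac)
    then have "(\<Sum>s\<in>?E. \<omega> s * \<psi> k s * \<phi> j s) = (-1) ^ j / 2 * (\<Sum>s\<in>?E. F s)"
      by (simp only: sum_distrib_left)
    \<comment> \<open>Below a + k one of the factors \<open>sqh s - sqh d\<close> is zero, so the
      sum may start where the moment formula does.\<close>
    also have "(\<Sum>s\<in>?E. F s) = (\<Sum>s\<in>{a + k..<G}. F s)"
    proof (rule sum.mono_neutral_right)
      show "\<forall>s\<in>?E - {a + k..<G}. F s = 0"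
      proof
        fix s assume "s \<in> ?E - {a + k..<G}"
        then have "s < a + k" by auto
        then have "(\<Prod>d<a + k. sqh s - sqh d) = 0" by (intro prod_zero bexI[of _ s]) simp_all
        then show "F s = 0" by (simp add: F_def)
      qed
    qed (use kj in auto)
    also have "\<dots> = fact (a + k) * fact (c + j) / fact (a + k + (c + j) + 1)
        * pochhammer (real G - real (a + k)) (2 * (a + k) + (c + j) + 1) * pochhammer (real G) (c + j + 1)"
      unfolding F_def by (rule window_moment) (use kj assms in simp)
    also have "real G - real (a + k) = real (G - (a + k))" using kj assms by (simp add: of_nat_diff)
    also have "pochhammer \<dots> (2 * (a + k) + (c + j) + 1) = fact ((a + c + 1) + k + j + (G - 1)) / fact (G - a - 1 - k)"
    proof -
      have "G - (a + k) + (2 * (a + k) + (c + j) + 1) - 1 = (a + c + 1) + k + j + (G - 1)"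
        "G - (a + k) - 1 = G - a - 1 - k" "1 \<le> G - (a + k)"
        using kj assms by auto
      then show ?thesis using pochhammer_fact_ratio[of "G - (a + k)" "2 * (a + k) + (c + j) + 1"]
        by (simp only:)
    qed
    also have "pochhammer (real G) (c + j + 1) = fact (G + c + j) / fact (G - 1)"
    proof -
      have "G + (c + j + 1) - 1 = G + c + j" "1 \<le> G" using kj assms by auto
      then show ?thesis using pochhammer_fact_ratio[of G "c + j + 1"] by (simp only:)
    qed
    also have "a + k + (c + j) + 1 = (a + c + 1) + k + j" by simp
    finally show ?thesis unfolding P_def Q_def by (rule trans) (rule alg)
  qed
  have "mat y y (\<lambda>(k, j). \<Sum>s\<in>?E. \<omega> s * \<psi> k s * \<phi> j s) =
      mat y y (\<lambda>(k, j). P k * (Q j * (fact ((a + c + 1) + k + j + (G - 1)) / fact ((a + c + 1) + k + j))))"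
    by (rule cong_mat[OF refl refl]) (simp only: case_prod_conv entry)
  then have "?L = (\<Prod>k=0..<y. P k) * ((\<Prod>j=0..<y. Q j) *
      det (mat y y (\<lambda>(k, j). fact ((a + c + 1) + k + j + (G - 1)) / fact ((a + c + 1) + k + j) :: real)))"
    unfolding L by (simp only: det_row_factors det_col_factors)
  also have "det (mat y y (\<lambda>(k, j). fact ((a + c + 1) + k + j + (G - 1)) / fact ((a + c + 1) + k + j) :: real)) =
      (\<Prod>j<y. (-1) ^ j * fact j * (fact (G - 1) / fact (G - 1 - j)) *
        (fact ((a + c + 1) + j + (G - 1)) / fact ((a + c + 1) + j + y - 1)))"
    by (rule hankel_factorial_det) (use assms in simp)
  also have "(\<Prod>k=0..<y. P k) * ((\<Prod>j=0..<y. Q j) * \<dots>) = ?R"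
    unfolding lessThan_atLeast0 prod.distrib[symmetric]
  proof (rule prod.cong[OF refl])
    fix k assume k: "k \<in> {0..<y}"
    have e: "(a + c + 1) + k + (G - 1) = G + a + c + k" "(a + c + 1) + k + y - 1 = a + c + k + y"
      using k assms by auto
    show "P k * (Q k * ((-1) ^ k * fact k * (fact (G - 1) / fact (G - 1 - k)) *
        (fact ((a + c + 1) + k + (G - 1)) / fact ((a + c + 1) + k + y - 1)))) =
      fact (a + k) * fact (c + k) * fact k / fact (a + c + k + y)
      * (fact (G + c + k) / fact (G - 1 - k)) * (fact (G + a + c + k) / fact (G - a - 1 - k)) / 2"
      unfolding e P_def Q_def
      by (rule alg') (simp_all flip: power_mult_distrib)
  qed
  finally show ?thesis .
qed

section \<open>Tilings and the triangular lattice\<close>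

lemma finite_tilings: "finite R \<Longrightarrow> finite (tilings R)"
  by (rule finite_subset[of _ "Pow (Pow R)"]) (auto simp: tilings_def partition_on_def)

lemma tilings_empty: "tilings {} = {{}}"
  by (auto simp: tilings_def partition_on_def)

lemma tiling_sum_empty: "tiling_sum w {} = 1"
  by (simp add: tiling_sum_def tilings_empty)

lemma tiling_sum_cong:
  assumes "\<And>l. is_lozenge l \<Longrightarrow> l \<subseteq> R \<Longrightarrow> w l = w' l"
  shows "tiling_sum w R = tiling_sum w' R"
  unfolding tiling_sum_def
  by (intro sum.cong prod.cong refl assms) (auto simp: tilings_def partition_on_def)

definition crossing :: "region \<Rightarrow> region \<Rightarrow> lozenge set set" where
  "crossing A B = {X. disjoint X \<and> (\<forall>l\<in>X. is_lozenge l \<and> l \<subseteq> A \<union> B \<and> \<not> l \<subseteq> A \<and> \<not> l \<subseteq> B)}"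

lemma lozenge_ne: "is_lozenge l \<Longrightarrow> l \<noteq> {}"
  by (auto simp: is_lozenge_def)

lemma disjointD': "disjoint S \<Longrightarrow> l \<in> S \<Longrightarrow> l' \<in> S \<Longrightarrow> t \<in> l \<Longrightarrow> t \<in> l' \<Longrightarrow> l = l'"
  unfolding disjoint_def by blast

lemma tilings_iff:
  "S \<in> tilings R \<longleftrightarrow> \<Union>S = R \<and> disjoint S \<and> (\<forall>l\<in>S. is_lozenge l)"
  by (auto simp: tilings_def partition_on_def dest: lozenge_ne)

text \<open>No geometry enters: the lozenges of a tiling are sorted into those inside A, those
  inside B and the rest. Since lozenges are nonempty and A, B are disjoint, the three classes
  exclude each other and determine the tiling.\<close>

lemma tiling_sum_split:
  assumes fin: "finite A" "finite B" and disj: "A \<inter> B = {}"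
  shows "tiling_sum w (A \<union> B) =
    (\<Sum>X\<in>crossing A B. (\<Prod>l\<in>X. w l) * tiling_sum w (A - \<Union>X) * tiling_sum w (B - \<Union>X))"
proof -
  let ?P = "SIGMA X:crossing A B. tilings (A - \<Union>X) \<times> tilings (B - \<Union>X)"
  have finX: "finite (crossing A B)"
    by (rule finite_subset[of _ "Pow (Pow (A \<union> B))"]) (use fin in \<open>auto simp: crossing_def\<close>)
  have finT: "finite (tilings (A - Y))" "finite (tilings (B - Y))" for Y
    using fin by (auto intro: finite_tilings)
  have finl: "finite S" if "S \<in> tilings R" "finite R" for S R
    using that by (auto simp: tilings_iff intro: finite_UnionD)
  have "(\<Sum>X\<in>crossing A B. (\<Prod>l\<in>X. w l) * tiling_sum w (A - \<Union>X) * tiling_sum w (B - \<Union>X)) =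
      (\<Sum>X\<in>crossing A B. \<Sum>(T1, T2)\<in>tilings (A - \<Union>X) \<times> tilings (B - \<Union>X).
        (\<Prod>l\<in>X. w l) * (\<Prod>l\<in>T1. w l) * (\<Prod>l\<in>T2. w l))"
    by (simp add: tiling_sum_def sum_product sum.cartesian_product[symmetric] sum_distrib_left sum_distrib_right mult_ac)
  also have "\<dots> = (\<Sum>(X, T1, T2)\<in>?P. (\<Prod>l\<in>X. w l) * (\<Prod>l\<in>T1. w l) * (\<Prod>l\<in>T2. w l))"
    by (subst sum.Sigma) (use finX finT in auto)
  also have "\<dots> = (\<Sum>S\<in>tilings (A \<union> B). \<Prod>l\<in>S. w l)"
  proof (rule sum.reindex_bij_witness[where
        i = "\<lambda>S. ({l \<in> S. \<not> l \<subseteq> A \<and> \<not> l \<subseteq> B}, {l \<in> S. l \<subseteq> A}, {l \<in> S. l \<subseteq> B})" and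
        j = "\<lambda>(X, T1, T2). X \<union> T1 \<union> T2"])
    fix u assume "u \<in> ?P"
    then obtain X T1 T2 where u: "u = (X, T1, T2)" and X: "X \<in> crossing A B"
      and S: "T1 \<in> tilings (A - \<Union>X)" "T2 \<in> tilings (B - \<Union>X)" by auto
    have UT: "\<Union>T1 = A - \<Union>X" "\<Union>T2 = B - \<Union>X" using S by (auto simp: tilings_iff)
    have loz: "is_lozenge l" if "l \<in> X \<union> T1 \<union> T2" for l
      using that X S by (auto simp: crossing_def tilings_iff)
    have X1: "l \<subseteq> A \<union> B" "\<not> l \<subseteq> A" "\<not> l \<subseteq> B" if "l \<in> X" for l
      using that X by (auto simp: crossing_def)
    have T1: "l \<subseteq> A" "\<not> l \<subseteq> B" if "l \<in> T1" for l
      using that UT lozenge_ne[OF loz[of l]] disj by blast+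
    have T2: "l \<subseteq> B" "\<not> l \<subseteq> A" if "l \<in> T2" for l
      using that UT lozenge_ne[OF loz[of l]] disj by blast+
    have parts: "{l \<in> X \<union> T1 \<union> T2. \<not> l \<subseteq> A \<and> \<not> l \<subseteq> B} = X"
      "{l \<in> X \<union> T1 \<union> T2. l \<subseteq> A} = T1" "{l \<in> X \<union> T1 \<union> T2. l \<subseteq> B} = T2"
      by (rule Set.set_eqI, simp only: mem_Collect_eq Un_iff, metis X1(2,3) T1 T2)+
    show "(case (case u of (X, T1, T2) \<Rightarrow> X \<union> T1 \<union> T2) of S \<Rightarrow>
        ({l \<in> S. \<not> l \<subseteq> A \<and> \<not> l \<subseteq> B}, {l \<in> S. l \<subseteq> A}, {l \<in> S. l \<subseteq> B})) = u"
      unfolding u by (simp only: prod.case parts)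
    have dX: "disjoint X" "disjoint T1" "disjoint T2" using X S by (auto simp: crossing_def tilings_iff)
    have "disjoint (X \<union> T1 \<union> T2)"
    proof (rule disjointI)
      fix l l' assume l: "l \<in> X \<union> T1 \<union> T2" "l' \<in> X \<union> T1 \<union> T2" "l \<noteq> l'"
      have "\<not> (t \<in> l \<and> t \<in> l')" for t
        using l dX UT disj disjointD'[OF dX(1), of l l' t] disjointD'[OF dX(2), of l l' t]
          disjointD'[OF dX(3), of l l' t] by blast
      then show "l \<inter> l' = {}" by blast
    qed
    moreover have "\<Union>(X \<union> T1 \<union> T2) = A \<union> B" using UT X1(1) by blast
    ultimately show "(case u of (X, T1, T2) \<Rightarrow> X \<union> T1 \<union> T2) \<in> tilings (A \<union> B)"
      using loz unfolding u by (simp add: tilings_iff)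
    have fins: "finite X" "finite T1" "finite T2"
      using X S fin finl by (auto simp: crossing_def intro!: finite_subset[of X "Pow (A \<union> B)"])
    have "X \<inter> T1 = {}" "(X \<union> T1) \<inter> T2 = {}"
      unfolding disjoint_iff Un_iff by (metis X1(2,3) T1 T2)+
    then show "prod w (case u of (X, T1, T2) \<Rightarrow> X \<union> T1 \<union> T2) =
        (case u of (X, T1, T2) \<Rightarrow> (\<Prod>l\<in>X. w l) * (\<Prod>l\<in>T1. w l) * (\<Prod>l\<in>T2. w l))"
      unfolding u using fins by (simp add: prod.union_disjoint)
  next
    fix S assume S: "S \<in> tilings (A \<union> B)"
    then have UT: "\<Union>S = A \<union> B" and dT: "disjoint S" and lT: "\<And>l. l \<in> S \<Longrightarrow> is_lozenge l"
      by (auto simp: tilings_iff)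
    define X where "X = {l \<in> S. \<not> l \<subseteq> A \<and> \<not> l \<subseteq> B}"
    show "(case ({l \<in> S. \<not> l \<subseteq> A \<and> \<not> l \<subseteq> B}, {l \<in> S. l \<subseteq> A}, {l \<in> S. l \<subseteq> B}) of
        (X, T1, T2) \<Rightarrow> X \<union> T1 \<union> T2) = S" by auto
    have "X \<in> crossing A B" using UT dT lT by (auto simp: crossing_def X_def disjoint_def)
    moreover have "{l \<in> S. l \<subseteq> A} \<in> tilings (A - \<Union>X)"
    proof -
      have "disjoint {l \<in> S. l \<subseteq> A}" using dT by (auto simp: disjoint_def)
      moreover have "\<Union>{l \<in> S. l \<subseteq> A} = A - \<Union>X"
      proof
        show "\<Union>{l \<in> S. l \<subseteq> A} \<subseteq> A - \<Union>X" using disjointD'[OF dT] unfolding X_def by blast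
        show "A - \<Union>X \<subseteq> \<Union>{l \<in> S. l \<subseteq> A}"
        proof
          fix t assume t: "t \<in> A - \<Union>X"
          then obtain l where l: "l \<in> S" "t \<in> l" using UT by auto
          then have "l \<notin> X" using t by auto
          moreover have "\<not> l \<subseteq> B" using l t disj by auto
          ultimately have "l \<subseteq> A" using l(1) unfolding X_def by simp
          then show "t \<in> \<Union>{l \<in> S. l \<subseteq> A}" using l by auto
        qed
      qed
      ultimately show ?thesis using lT by (auto simp: tilings_iff)
    qed
    moreover have "{l \<in> S. l \<subseteq> B} \<in> tilings (B - \<Union>X)"
    proof -
      have "disjoint {l \<in> S. l \<subseteq> B}" using dT by (auto simp: disjoint_def)
      moreover have "\<Union>{l \<in> S. l \<subseteq> B} = B - \<Union>X"
      proof
        show "\<Union>{l \<in> S. l \<subseteq> B} \<subseteq> B - \<Union>X" using disjointD'[OF dT] unfolding X_def by blast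
        show "B - \<Union>X \<subseteq> \<Union>{l \<in> S. l \<subseteq> B}"
        proof
          fix t assume t: "t \<in> B - \<Union>X"
          then obtain l where l: "l \<in> S" "t \<in> l" using UT by auto
          then have "l \<notin> X" using t by auto
          moreover have "\<not> l \<subseteq> A" using l t disj by auto
          ultimately have "l \<subseteq> B" using l(1) unfolding X_def by simp
          then show "t \<in> \<Union>{l \<in> S. l \<subseteq> B}" using l by auto
        qed
      qed
      ultimately show ?thesis using lT by (auto simp: tilings_iff)
    qed
    ultimately show "({l \<in> S. \<not> l \<subseteq> A \<and> \<not> l \<subseteq> B}, {l \<in> S. l \<subseteq> A}, {l \<in> S. l \<subseteq> B}) \<in> ?P"
      by (simp add: X_def)
  qed
  finally show ?thesis by (simp add: tiling_sum_def)
qed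

text \<open>Serves to reflect the lower part; for an involution the map on tilings is its own
  inverse.\<close>

lemma tiling_sum_involution:
  assumes inv: "\<And>t. \<phi> (\<phi> t) = t" and loz: "\<And>l. is_lozenge l \<Longrightarrow> is_lozenge (\<phi> ` l)"
  shows "tiling_sum w (\<phi> ` R) = tiling_sum (\<lambda>l. w (\<phi> ` l)) R"
proof -
  have ii: "\<phi> ` \<phi> ` l = l" for l by (force simp: image_iff inv)
  have inj: "inj \<phi>" by (metis injI inv)
  have til: "(\<lambda>l. \<phi> ` l) ` S \<in> tilings (\<phi> ` R)" if "S \<in> tilings R" for S R
    using that loz inj by (auto simp: tilings_iff disjoint_def inj_image_eq_iff image_Int[symmetric] image_Union)
  have injim: "inj (\<lambda>l. \<phi> ` l)" by (metis injI ii)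
  show ?thesis unfolding tiling_sum_def
  proof (rule sum.reindex_bij_witness[where i = "\<lambda>S. (\<lambda>l. \<phi> ` l) ` S" and j = "\<lambda>S. (\<lambda>l. \<phi> ` l) ` S"])
    fix S assume "S \<in> tilings (\<phi> ` R)"
    then show "(\<lambda>l. \<phi> ` l) ` S \<in> tilings R" using til[of S "\<phi> ` R"] by (simp add: ii)
    show "(\<Prod>l\<in>(\<lambda>l. \<phi> ` l) ` S. w (\<phi> ` l)) = prod w S"
      by (subst prod.reindex) (use injim in \<open>auto simp: ii inj_on_def\<close>)
  qed (auto simp: til image_image inv)
qed

text \<open>The unit triangle between the rows \<open>k\<close> and \<open>k + 1\<close> whose vertical axis has doubled abscissa
  \<open>c\<close>; it points up iff \<open>c - k\<close> is odd.\<close>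

definition tri :: "int \<Rightarrow> int \<Rightarrow> triangle" where
  "tri k c = (if odd (c - k) then up_tri (c - 1) k else down_tri (c - 1) (k + 1))"

lemma up_tri_conv: "even (p - k) \<Longrightarrow> up_tri p k = tri k (p + 1)"
  by (auto simp: tri_def)

lemma down_tri_conv: "even (p - k) \<Longrightarrow> down_tri p k = tri (k - 1) (p + 1)"
  by (auto simp: tri_def)

lemma unit_triangle_iff: "unit_triangle t \<longleftrightarrow> (\<exists>k c. t = tri k c)"
proof
  assume "unit_triangle t"
  then show "\<exists>k c. t = tri k c"
    unfolding unit_triangle_def lattice_vertex_def using up_tri_conv down_tri_conv by fastforce
next
  assume "\<exists>k c. t = tri k c"
  then obtain k c where t: "t = tri k c" by blast
  show "unit_triangle t"
  proof (cases "odd (c - k)")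
    case True
    then show ?thesis unfolding unit_triangle_def t tri_def lattice_vertex_def
      by (intro exI[of _ "c - 1"] exI[of _ k]) auto
  next
    case False
    then show ?thesis unfolding unit_triangle_def t tri_def lattice_vertex_def
      by (intro exI[of _ "c - 1"] exI[of _ "k + 1"]) auto
  qed
qed

lemma tri_up: "odd (c - k) \<Longrightarrow> tri k c = {(c - 1, k), (c + 1, k), (c, k + 1)}"
  by (simp add: tri_def up_tri_def add.commute)

lemma tri_down: "even (c - k) \<Longrightarrow> tri k c = {(c - 1, k + 1), (c + 1, k + 1), (c, k)}"
  by (simp add: tri_def down_tri_def add.commute)

text \<open>Two distinct triangles of equal orientation share at most one vertex. Triangles of
  opposite orientation share two only if they are neighbours in a row or meet along a horizontal
  side, and then the lower one points down.\<close>

lemma shared_edge_cases: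
  assumes "u \<in> tri k c \<inter> tri k' c'" "v \<in> tri k c \<inter> tri k' c'" "u \<noteq> v"
  shows "k' = k \<and> c' = c \<or> k' = k \<and> (c' = c + 1 \<or> c = c' + 1) \<or>
    c' = c \<and> k' = k + 1 \<and> even (c - k) \<or> c' = c \<and> k = k' + 1 \<and> even (c' - k')"
proof (cases "odd (c - k)"; cases "odd (c' - k')")
  assume p: "odd (c - k)" "odd (c' - k')"
  have "k' = k \<and> c' = c" using assms unfolding tri_up[OF p(1)] tri_up[OF p(2)]
    by (cases u; cases v) (simp only: Int_iff insert_iff empty_iff prod.inject simp_thms, elim disjE conjE; auto)
  then show ?thesis by simp
next
  assume p: "odd (c - k)" "\<not> odd (c' - k')"
  have "k' = k \<and> (c' = c + 1 \<or> c = c' + 1) \<or> c' = c \<and> k = k' + 1"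
    using assms unfolding tri_up[OF p(1)] tri_down[OF p(2)[simplified not_not]]
    by (cases u; cases v) (simp only: Int_iff insert_iff empty_iff prod.inject simp_thms, elim disjE conjE; auto)
  then show ?thesis using p(2) by blast
next
  assume p: "\<not> odd (c - k)" "odd (c' - k')"
  have "k' = k \<and> (c' = c + 1 \<or> c = c' + 1) \<or> c' = c \<and> k' = k + 1"
    using assms unfolding tri_up[OF p(2)] tri_down[OF p(1)[simplified not_not]]
    by (cases u; cases v) (simp only: Int_iff insert_iff empty_iff prod.inject simp_thms, elim disjE conjE; auto)
  then show ?thesis using p(1) by blast
next
  assume p: "\<not> odd (c - k)" "\<not> odd (c' - k')"
  have "k' = k \<and> c' = c"
    using assms unfolding tri_down[OF p(1)[simplified not_not]] tri_down[OF p(2)[simplified not_not]]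
    by (cases u; cases v) (simp only: Int_iff insert_iff empty_iff prod.inject simp_thms, elim disjE conjE; auto)
  then show ?thesis by simp
qed

lemma tri_inject: "tri k c = tri k' c' \<longleftrightarrow> k = k' \<and> c = c'"
proof
  assume eq: "tri k c = tri k' c'"
  have "(c - 1, if odd (c - k) then k else k + 1) \<in> tri k c" "(c + 1, if odd (c - k) then k else k + 1) \<in> tri k c"
    "(c, if odd (c - k) then k + 1 else k) \<in> tri k c"
    by (auto simp: tri_up tri_down)
  then have "(c - 1, if odd (c - k) then k else k + 1) \<in> tri k' c'" "(c + 1, if odd (c - k) then k else k + 1) \<in> tri k' c'"
    "(c, if odd (c - k) then k + 1 else k) \<in> tri k' c'"
    using eq by auto
  then show "k = k' \<and> c = c'"
    by (cases "odd (c - k)"; cases "odd (c' - k')") (auto simp: tri_up tri_down)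
qed simp

lemma lozenge_strip: "is_lozenge {tri k c, tri k (c + 1)}"
proof -
  have "card (tri k c \<inter> tri k (c + 1)) = 2"
  proof (cases "odd (c - k)")
    case True
    then have "tri k c \<inter> tri k (c + 1) = {(c + 1, k), (c, k + 1)}" by (auto simp: tri_up tri_down)
    then show ?thesis by simp
  next
    case False
    then have "tri k c \<inter> tri k (c + 1) = {(c + 1, k + 1), (c, k)}" by (auto simp: tri_up tri_down)
    then show ?thesis by simp
  qed
  then show ?thesis unfolding is_lozenge_def
    by (intro exI[of _ "tri k c"] exI[of _ "tri k (c + 1)"]) (auto simp: unit_triangle_iff tri_inject)
qed

lemma lozenge_vertical:
  assumes "even (c - k)"
  shows "is_lozenge {tri k c, tri (k + 1) c}"
proof -
  have "tri k c \<inter> tri (k + 1) c = {(c - 1, k + 1), (c + 1, k + 1)}"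
    using assms by (auto simp: tri_up tri_down)
  then have "card (tri k c \<inter> tri (k + 1) c) = 2" by simp
  then show ?thesis unfolding is_lozenge_def
    by (intro exI[of _ "tri k c"] exI[of _ "tri (k + 1) c"]) (auto simp: unit_triangle_iff tri_inject)
qed

lemma lozenge_cases:
  assumes "is_lozenge l"
  obtains k c where "l = {tri k c, tri k (c + 1)}"
  | k c where "even (c - k)" "l = {tri k c, tri (k + 1) c}"
proof -
  obtain s t where st: "unit_triangle s" "unit_triangle t" "s \<noteq> t" "card (s \<inter> t) = 2" "l = {s, t}"
    using assms unfolding is_lozenge_def by blast
  obtain k c k' c' where t: "s = tri k c" "t = tri k' c'" using st(1,2) unfolding unit_triangle_iff by blast
  obtain u v where "u \<in> s \<inter> t" "v \<in> s \<inter> t" "u \<noteq> v"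
    using st(4) by (metis card_2_iff insertCI)
  then have "k' = k \<and> (c' = c + 1 \<or> c = c' + 1) \<or> c' = c \<and> k' = k + 1 \<and> even (c - k) \<or> c' = c \<and> k = k' + 1 \<and> even (c' - k')"
    using shared_edge_cases[of u k c k' c' v] st(3) t by auto
  then show thesis
  proof (elim disjE conjE)
    assume "k' = k" "c' = c + 1"
    then show thesis using that(1)[of k c] st(5) t by simp
  next
    assume "k' = k" "c = c' + 1"
    then show thesis using that(1)[of k c'] st(5) t by (simp add: insert_commute)
  next
    assume "c' = c" "k' = k + 1" "even (c - k)"
    then show thesis using that(2)[of c k] st(5) t by simp
  next
    assume "c' = c" "k = k' + 1" "even (c' - k')"
    then show thesis using that(2)[of c' k'] st(5) t by (simp add: insert_commute)
  qed
qed

lemma lozenge_neighbours: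
  assumes "is_lozenge {tri k c, t}"
  shows "t = tri k (c + 1) \<or> t = tri k (c - 1) \<or> even (c - k) \<and> t = tri (k + 1) c \<or>
    odd (c - k) \<and> t = tri (k - 1) c"
  using assms
proof (cases rule: lozenge_cases)
  case (1 k' c')
  then show ?thesis by (auto simp: doubleton_eq_iff tri_inject)
next
  case (2 k' c')
  then show ?thesis by (auto simp: doubleton_eq_iff tri_inject)
qed

text \<open>Every tiling contains the lozenge \<open>{s, t}\<close>, so deleting it is a bijection
  onto the tilings of the rest.\<close>

lemma tiling_sum_forced:
  assumes "s \<in> R" "t \<in> R" "is_lozenge {s, t}" "finite R"
    and only: "\<And>t'. t' \<in> R \<Longrightarrow> is_lozenge {s, t'} \<Longrightarrow> t' = t"
  shows "tiling_sum w R = w {s, t} * tiling_sum w (R - {s, t})"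
proof -
  have st: "s \<noteq> t" using assms(3) by (auto simp: is_lozenge_def doubleton_eq_iff)
  have mem: "{s, t} \<in> S" if "S \<in> tilings R" for S
  proof -
    from that obtain l where l: "l \<in> S" "s \<in> l" "is_lozenge l" "l \<subseteq> R"
      using assms(1) by (auto simp: tilings_iff)
    then obtain t' where t': "l = {s, t'}" by (auto simp: is_lozenge_def)
    then have "t' = t" using l only[of t'] by auto
    with l t' show ?thesis by simp
  qed
  show ?thesis unfolding tiling_sum_def sum_distrib_left
  proof (rule sum.reindex_bij_witness[where i = "insert {s, t}" and j = "\<lambda>S. S - {{s, t}}"])
    fix S assume S: "S \<in> tilings R"
    show "insert {s, t} (S - {{s, t}}) = S" using mem[OF S] by auto
    have "\<Union>(S - {{s, t}}) = R - {s, t}"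
    proof
      show "\<Union>(S - {{s, t}}) \<subseteq> R - {s, t}"
        using S mem[OF S] disjointD'[of S _ "{s, t}"] unfolding tilings_iff by blast
      show "R - {s, t} \<subseteq> \<Union>(S - {{s, t}})" using S unfolding tilings_iff by blast
    qed
    then show "S - {{s, t}} \<in> tilings (R - {s, t})" using S by (auto simp: tilings_iff disjoint_def)
    have "finite S" using S assms(4) by (auto simp: tilings_iff intro: finite_UnionD)
    then show "w {s, t} * prod w (S - {{s, t}}) = prod w S" using mem[OF S] by (simp add: prod.remove)
  next
    fix S assume S: "S \<in> tilings (R - {s, t})"
    then have US: "\<Union>S = R - {s, t}" and dS: "disjoint S" and lS: "\<forall>l\<in>S. is_lozenge l"
      by (auto simp: tilings_iff)
    have st_notin: "s \<notin> l" "t \<notin> l" if "l \<in> S" for l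
      using US that by blast+
    then have "{s, t} \<notin> S" by blast
    then show "insert {s, t} S - {{s, t}} = S" by simp
    have "disjoint (insert {s, t} S)"
      using dS st_notin unfolding disjoint_def by (simp add: Int_commute)
    moreover have "\<Union>(insert {s, t} S) = R" using US assms(1,2) by auto
    ultimately show "insert {s, t} S \<in> tilings R" using lS assms(3) by (simp add: tilings_iff)
  qed
qed

lemma tiling_sum_no_neighbour:
  assumes "s \<in> R" "\<And>t. t \<in> R \<Longrightarrow> \<not> is_lozenge {s, t}"
  shows "tiling_sum w R = 0"
proof -
  have "tilings R = {}"
  proof (rule ccontr)
    assume "tilings R \<noteq> {}"
    then obtain S where "S \<in> tilings R" by blast
    then obtain l where l: "l \<in> S" "s \<in> l" "is_lozenge l" "l \<subseteq> R"
      using assms(1) by (auto simp: tilings_iff)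
    then obtain t' where "l = {s, t'}" by (auto simp: is_lozenge_def)
    with l assms(2)[of t'] show False by auto
  qed
  then show ?thesis by (simp add: tiling_sum_def)
qed

text \<open>Only vertical lozenges join different rows, so the sets of lozenges that cross the line
  correspond to the subsets X of \<open>D\<close>. The parity in \<open>D\<close> says that the cell
  above the line points up.\<close>

lemma tiling_sum_rows:
  assumes fin: "finite A" "finite B"
    and A: "\<And>t. t \<in> A \<Longrightarrow> \<exists>k' c. k' \<ge> k \<and> t = tri k' c"
    and B: "\<And>t. t \<in> B \<Longrightarrow> \<exists>k' c. k' < k \<and> t = tri k' c"
    and D: "D = {c. odd (c - k) \<and> tri k c \<in> A \<and> tri (k - 1) c \<in> B}"
  shows "tiling_sum w (A \<union> B) = (\<Sum>X\<in>Pow D. (\<Prod>c\<in>X. w {tri (k - 1) c, tri k c}) *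
    tiling_sum w (A - tri k ` X) * tiling_sum w (B - tri (k - 1) ` X))"
proof -
  define V where "V c = {tri (k - 1) c, tri k c}" for c
  have disj: "A \<inter> B = {}"
  proof (rule ccontr)
    assume "A \<inter> B \<noteq> {}"
    then obtain t where "t \<in> A" "t \<in> B" by blast
    with A[of t] B[of t] show False by (auto simp: tri_inject)
  qed
  have inA: "k' \<ge> k" if "tri k' c \<in> A" for k' c using A[OF that] by (auto simp: tri_inject)
  have inB: "k' < k" if "tri k' c \<in> B" for k' c using B[OF that] by (auto simp: tri_inject)
  have Vinj: "inj V" by (auto simp: V_def inj_def doubleton_eq_iff tri_inject)
  have VU: "A - \<Union>(V ` X) = A - tri k ` X" "B - \<Union>(V ` X) = B - tri (k - 1) ` X" for X
  proof -
    have "tri (k - 1) c \<notin> A" "tri k c \<notin> B" for c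
      using inA[of "k - 1" c] inB[of k c] by auto
    then show "A - \<Union>(V ` X) = A - tri k ` X" "B - \<Union>(V ` X) = B - tri (k - 1) ` X"
      unfolding V_def by blast+
  qed
  have cr: "crossing A B = (\<lambda>X. V ` X) ` Pow D"
  proof (intro subset_antisym subsetI)
    fix X assume X: "X \<in> crossing A B"
    have "l \<in> V ` D" if "l \<in> X" for l
    proof -
      have l: "is_lozenge l" "l \<subseteq> A \<union> B" "\<not> l \<subseteq> A" "\<not> l \<subseteq> B" using X that by (auto simp: crossing_def)
      from l(1) show ?thesis
      proof (cases rule: lozenge_cases)
        case (1 k' c)
        then show ?thesis using l inA inB by (metis bot.extremum insert_subset leD Un_iff)
      next
        case (2 k' c)
        then have "tri k' c \<in> A \<and> tri (k' + 1) c \<in> B \<or> tri k' c \<in> B \<and> tri (k' + 1) c \<in> A"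
          using l by auto
        then have "tri k' c \<in> B" "tri (k' + 1) c \<in> A" using inA inB by fastforce+
        moreover from this have "k' = k - 1" using inA inB by fastforce
        ultimately show ?thesis using 2 by (auto simp: D V_def)
      qed
    qed
    then show "X \<in> (\<lambda>X. V ` X) ` Pow D"
      by (intro image_eqI[of _ _ "{c \<in> D. V c \<in> X}"]) auto
  next
    fix Y assume "Y \<in> (\<lambda>X. V ` X) ` Pow D"
    then obtain X where X: "X \<subseteq> D" "Y = V ` X" by blast
    have "is_lozenge (V c) \<and> V c \<subseteq> A \<union> B \<and> \<not> V c \<subseteq> A \<and> \<not> V c \<subseteq> B" if "c \<in> X" for c
    proof -
      have c: "odd (c - k)" "tri k c \<in> A" "tri (k - 1) c \<in> B" using that X D by auto
      then show ?thesis using lozenge_vertical[of c "k - 1"] disj by (auto simp: V_def)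
    qed
    moreover have "disjoint (V ` X)"
      by (auto simp: disjoint_def V_def tri_inject)
    ultimately show "Y \<in> crossing A B" unfolding X(2) crossing_def by blast
  qed
  have "tiling_sum w (A \<union> B) = (\<Sum>Y\<in>(\<lambda>X. V ` X) ` Pow D. (\<Prod>l\<in>Y. w l) * tiling_sum w (A - \<Union>Y) * tiling_sum w (B - \<Union>Y))"
    unfolding cr[symmetric] by (rule tiling_sum_split[OF fin disj])
  also have "\<dots> = (\<Sum>X\<in>Pow D. (\<Prod>l\<in>V ` X. w l) * tiling_sum w (A - \<Union>(V ` X)) * tiling_sum w (B - \<Union>(V ` X)))"
    by (subst sum.reindex) (use Vinj in \<open>auto simp: inj_on_def inj_image_eq_iff\<close>)
  also have "\<dots> = (\<Sum>X\<in>Pow D. (\<Prod>c\<in>X. w (V c)) * tiling_sum w (A - tri k ` X) * tiling_sum w (B - tri (k - 1) ` X))"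
    using Vinj by (simp add: VU prod.reindex inj_on_subset[OF Vinj])
  finally show ?thesis by (simp only: V_def)
qed

section \<open>Tilings of a strip\<close>

text \<open>The weight 1/2 sits on vertical lozenges only, so the lozenges inside one row are
  unweighted.\<close>

definition strip_unit :: "(lozenge \<Rightarrow> real) \<Rightarrow> bool" where
  "strip_unit w \<longleftrightarrow> (\<forall>k c. w {tri k c, tri k (c + 1)} = 1)"

lemma lozenge_in_strip: "is_lozenge {tri k c, tri k c'} \<longleftrightarrow> c' = c + 1 \<or> c' = c - 1"
  using lozenge_neighbours[of k c "tri k c'"] lozenge_strip[of k c] lozenge_strip[of k "c - 1"]
  by (auto simp: tri_inject insert_commute)

text \<open>Within one row the leftmost cell can only pair with its right neighbour. Hence the first
  run of cells is consumed from the left: it disappears if its length is even and blocks every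
  tiling if it is odd.\<close>

lemma strip_step:
  assumes "strip_unit w" "finite C" "m \<in> C" "\<forall>c\<in>C. m \<le> c" "m + 1 \<in> C"
  shows "tiling_sum w (tri k ` C) = tiling_sum w (tri k ` (C - {m, m + 1}))"
proof -
  have "tiling_sum w (tri k ` C) = w {tri k m, tri k (m + 1)} * tiling_sum w (tri k ` C - {tri k m, tri k (m + 1)})"
    by (rule tiling_sum_forced) (use assms in \<open>auto simp: lozenge_in_strip tri_inject\<close>)
  also have "tri k ` C - {tri k m, tri k (m + 1)} = tri k ` (C - {m, m + 1})"
    by (auto simp: tri_inject)
  finally show ?thesis using assms(1) by (simp add: strip_unit_def)
qed

lemma strip_stuck:
  assumes "m \<in> C" "\<forall>c\<in>C. m \<le> c" "m + 1 \<notin> C"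
  shows "tiling_sum w (tri k ` C) = 0"
  by (rule tiling_sum_no_neighbour[of "tri k m"]) (use assms in \<open>auto simp: lozenge_in_strip\<close>)

lemma strip_run:
  assumes "strip_unit w" "finite C" "{lo..<lo + 2 * int n} \<subseteq> C" "\<forall>c\<in>C. lo \<le> c"
  shows "tiling_sum w (tri k ` C) = tiling_sum w (tri k ` (C - {lo..<lo + 2 * int n}))"
  using assms(2-)
proof (induction n arbitrary: lo C)
  case (Suc n)
  have "tiling_sum w (tri k ` C) = tiling_sum w (tri k ` (C - {lo, lo + 1}))"
    by (rule strip_step) (use Suc.prems assms(1) in auto)
  also have "\<dots> = tiling_sum w (tri k ` (C - {lo, lo + 1} - {lo + 2..<lo + 2 + 2 * int n}))"
  proof (rule Suc.IH)
    show "\<forall>c\<in>C - {lo, lo + 1}. lo + 2 \<le> c" using Suc.prems by force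
  qed (use Suc.prems in auto)
  also have "C - {lo, lo + 1} - {lo + 2..<lo + 2 + 2 * int n} = C - {lo..<lo + 2 * int (Suc n)}"
    by auto
  finally show ?case .
qed simp

lemma strip_even_run:
  assumes "strip_unit w" "finite C" "\<And>x. lo \<le> x \<Longrightarrow> x < h \<Longrightarrow> x \<in> C" "\<And>c. c \<in> C \<Longrightarrow> lo \<le> c" "lo \<le> h" "even (h - lo)"
  shows "tiling_sum w (tri k ` C) = tiling_sum w (tri k ` (C - {lo..<h}))"
proof -
  define n where "n = nat ((h - lo) div 2)"
  have "h = lo + 2 * int n" using assms(5,6) unfolding n_def by auto
  moreover have "{lo..<h} \<subseteq> C" "\<forall>c\<in>C. lo \<le> c" using assms(3,4) by auto
  ultimately show ?thesis using strip_run[of w C lo n k] assms(1,2) by simp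
qed

lemma strip_odd_run:
  assumes "strip_unit w" "finite C" "\<And>x. lo \<le> x \<Longrightarrow> x < h \<Longrightarrow> x \<in> C" "\<And>c. c \<in> C \<Longrightarrow> lo \<le> c" "lo \<le> h" "odd (h - lo)" "h \<notin> C"
  shows "tiling_sum w (tri k ` C) = 0"
proof -
  have "lo \<noteq> h" using assms by auto
  then have "tiling_sum w (tri k ` C) = tiling_sum w (tri k ` (C - {lo..<h - 1}))"
    by (intro strip_even_run) (use assms in auto)
  also have "\<dots> = 0"
  proof (rule strip_stuck[of "h - 1"])
    show "\<forall>c\<in>C - {lo..<h - 1}. h - 1 \<le> c" using assms(4) by force
  qed (use assms \<open>lo \<noteq> h\<close> in auto)
  finally show ?thesis .
qed

text \<open>In a strip that starts at \<open>lo\<close> with a down-pointing triangle, the removed triangles must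
  alternate between down- and up-pointing; \<open>gaps lo cs\<close> lists where the down-pointing ones may lie
  if the removed up-pointing ones are \<open>cs\<close>.\<close>

fun gaps :: "int \<Rightarrow> int list \<Rightarrow> int set list" where
  "gaps lo [] = []"
| "gaps lo (c # cs) = {x. lo \<le> x \<and> x < c \<and> even (x - lo)} # gaps (c + 1) cs"

lemma length_gaps [simp]: "length (gaps lo cs) = length cs"
  by (induction cs arbitrary: lo) auto

lemma in_listset_gaps_Cons:
  "(\<exists>xs\<in>listset (gaps lo (c # cs)). X = set xs) \<longleftrightarrow>
   (\<exists>x. lo \<le> x \<and> x < c \<and> even (x - lo) \<and> (\<exists>xs\<in>listset (gaps (c + 1) cs). X = insert x (set xs)))"
  by (auto simp: set_Cons_def) (metis list.simps(15))+

lemma listset_gaps_bounds: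
  "xs \<in> listset (gaps lo cs) \<Longrightarrow> sorted_wrt (<) (lo # cs) \<or> sorted_wrt (<) ((lo - 1) # cs) \<Longrightarrow> x \<in> set xs \<Longrightarrow>
    lo \<le> x \<and> (\<exists>c\<in>set cs. x < c)"
proof (induction cs arbitrary: lo xs)
  case (Cons c cs)
  then obtain y ys where xs: "xs = y # ys" "lo \<le> y" "y < c" "ys \<in> listset (gaps (c + 1) cs)"
    by (auto simp: set_Cons_def)
  have "sorted_wrt (<) ((c + 1 - 1) # cs)" using Cons.prems(2) by auto
  then have "c + 1 \<le> x \<and> (\<exists>c\<in>set cs. x < c)" if "x \<in> set ys" using Cons.IH[OF xs(4)] that by simp
  then show ?case using Cons.prems xs by auto
qed simp

lemma listset_gaps_sorted:
  "xs \<in> listset (gaps lo cs) \<Longrightarrow> sorted_wrt (<) ((lo - 1) # cs) \<Longrightarrow> sorted_wrt (<) xs"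
proof (induction cs arbitrary: lo xs)
  case (Cons c cs)
  then obtain y ys where xs: "xs = y # ys" "lo \<le> y" "y < c" "ys \<in> listset (gaps (c + 1) cs)"
    by (auto simp: set_Cons_def)
  have s: "sorted_wrt (<) ((c + 1 - 1) # cs)" using Cons.prems(2) by auto
  have "c + 1 \<le> x" if "x \<in> set ys" for x using listset_gaps_bounds[OF xs(4) disjI2[OF s] that] by simp
  then show ?case using Cons.IH[OF xs(4) s] xs(1,3) by force
qed simp

lemma listset_gaps_parity:
  "xs \<in> listset (gaps lo cs) \<Longrightarrow> \<forall>c\<in>set cs. odd (c - lo) \<Longrightarrow> x \<in> set xs \<Longrightarrow> even (x - lo)"
proof (induction cs arbitrary: lo xs)
  case (Cons c cs)
  then obtain y ys where xs: "xs = y # ys" "even (y - lo)" "ys \<in> listset (gaps (c + 1) cs)"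
    by (auto simp: set_Cons_def)
  have "even (x - (c + 1))" if "x \<in> set ys" 
    by (rule Cons.IH[OF xs(3) _ that]) (use Cons.prems in auto)
  then show ?case using Cons.prems xs by auto
qed simp

text \<open>A strip has at most one tiling, and it has one only if all runs between removed cells
  are even. Counted from lo, down-pointing cells lie at even and up-pointing ones at odd distance,
  so parity makes the removed cells alternate, down before up. Thus X takes exactly one cell from
  every gap and none beyond the last c.\<close>

lemma strip_from_down:
  assumes w: "strip_unit w"
  shows "sorted_wrt (<) cs \<Longrightarrow> \<forall>c\<in>set cs. lo \<le> c \<and> c \<le> hi \<and> odd (c - lo) \<Longrightarrow>
    X \<subseteq> {x. lo \<le> x \<and> x \<le> hi \<and> even (x - lo)} \<Longrightarrow> odd (hi - lo) \<Longrightarrow> lo - 1 \<le> hi \<Longrightarrow>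
    tiling_sum w (tri k ` ({lo..hi} - set cs - X)) =
      (if \<exists>xs\<in>listset (gaps lo cs). X = set xs then 1 else 0)"
proof (induction cs arbitrary: lo X)
  case Nil
  have finX: "finite X" by (rule finite_subset[OF Nil.prems(3)]) (rule finite_subset[of _ "{lo..hi}"], auto)
  show ?case
  proof (cases "X = {}")
    case True
    have "tiling_sum w (tri k ` {lo..hi}) = tiling_sum w (tri k ` ({lo..hi} - {lo..<hi + 1}))"
      by (rule strip_even_run) (use w Nil.prems in auto)
    also have "{lo..hi} - {lo..<hi + 1} = {}" by auto
    finally show ?thesis using True by (simp add: tiling_sum_empty)
  next
    case False
    define x where "x = Min X"
    have x: "x \<in> X" "\<And>y. y \<in> X \<Longrightarrow> x \<le> y" using finX False by (auto simp: x_def)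
    let ?C = "{lo..hi} - X"
    have xlo: "lo \<le> x" "x \<le> hi" "even (x - lo)" using x(1) Nil.prems(3) by auto
    have notX: "y \<notin> X" if "y < x" for y using x(2) that by fastforce
    have "tiling_sum w (tri k ` ?C) = tiling_sum w (tri k ` (?C - {lo..<x}))"
      by (rule strip_even_run[OF w]) (use notX xlo in auto)
    also have "\<dots> = 0"
    proof -
      \<comment> \<open>The run after x ends at the next removed cell or past the right end of the
        strip. Both have the parity of x, so the run is odd.\<close>
      define h where "h = Min (insert (hi + 1) (X - {x}))"
      have "h \<in> insert (hi + 1) (X - {x})" unfolding h_def by (rule Min_in) (use finX in auto)
      moreover have "\<And>y. y \<in> X - {x} \<Longrightarrow> h \<le> y" "h \<le> hi + 1"
        unfolding h_def by (rule Min_le, use finX in auto)+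
      ultimately have h: "h \<in> insert (hi + 1) (X - {x})" "\<And>y. y \<in> X - {x} \<Longrightarrow> h \<le> y" "h \<le> hi + 1"
        by blast+
      have "h > x" using h(1) x xlo by force
      have "odd (h - (x + 1))" using h(1) xlo Nil.prems(3,4) by auto
      have notX': "y \<notin> X" if "x < y" "y < h" for y using h(2)[of y] that by auto
      show ?thesis
      proof (rule strip_odd_run[OF w, of _ "x + 1" h])
        show "x + 1 \<le> c" if "c \<in> ?C - {lo..<x}" for c
          using that x(1) by (cases "c = x") auto
      qed (use h(1,3) notX' xlo \<open>h > x\<close> \<open>odd (h - (x + 1))\<close> in auto)
    qed
    finally show ?thesis using False by simp
  qed
next
  case (Cons c cs)
  have finX: "finite X" by (rule finite_subset[OF Cons.prems(3)]) (rule finite_subset[of _ "{lo..hi}"], auto)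
  have c: "lo \<le> c" "c \<le> hi" "odd (c - lo)" "\<And>c'. c' \<in> set cs \<Longrightarrow> c < c'" using Cons.prems by auto
  have Xp: "lo \<le> x \<and> x \<le> hi \<and> even (x - lo)" if "x \<in> X" for x using Cons.prems(3) that by auto
  let ?C = "{lo..hi} - set (c # cs) - X"
  have cC: "c \<notin> X" using Xp c by auto
  have minC: "\<forall>c\<in>?C. lo \<le> c" by auto
  have rest: "lo' \<le> x \<and> x \<le> hi" if "xs \<in> listset (gaps lo' cs)" "lo' = c + 1" "x \<in> set xs" for xs x lo'
    using listset_gaps_bounds[OF that(1) _ that(3)] Cons.prems(1,2) that(2) by force
  show ?case
  proof (cases "\<exists>x\<in>X. x < c")
    case False
    then have nX: "y \<notin> X" if "y < c" for y using that by auto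
    have ncs: "y \<notin> set cs" if "y < c" for y using c(4)[of y] that by auto
    \<comment> \<open>Nothing is removed between lo and c, and this leading run is odd.\<close>
    have "tiling_sum w (tri k ` ?C) = 0"
      by (rule strip_odd_run[OF w, of _ lo c]) (use c(1-3) nX ncs in auto)
    moreover have "\<not> (\<exists>xs\<in>listset (gaps lo (c # cs)). X = set xs)"
      unfolding in_listset_gaps_Cons using False by auto
    ultimately show ?thesis by simp
  next
    case True
    define x where "x = Min X"
    have "X \<noteq> {}" using True by auto
    then have x: "x \<in> X" "\<And>y. y \<in> X \<Longrightarrow> x \<le> y" using finX by (auto simp: x_def)
    have "x < c" using True x(2) by fastforce
    then have xc: "x < c" "lo \<le> x" "even (x - lo)" using Xp[OF x(1)] by auto
    have notX: "y \<notin> X" if "y < x" for y using x(2)[of y] that by auto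
    have ncs: "y \<notin> set cs" if "y < c" for y using c(4)[of y] that by auto
    have 1: "tiling_sum w (tri k ` ?C) = tiling_sum w (tri k ` (?C - {lo..<x}))"
      by (rule strip_even_run[OF w]) (use notX ncs xc c(1,2) in auto)
    show ?thesis
    proof (cases "\<exists>y\<in>X - {x}. y < c")
      case True
      \<comment> \<open>Two cells of X before c enclose an odd run; on the other side, a gap admits
        only one choice.\<close>
      define h where "h = Min (X - {x})"
      have "h \<in> X - {x}" unfolding h_def by (rule Min_in) (use finX True in auto)
      moreover have "\<And>y. y \<in> X - {x} \<Longrightarrow> h \<le> y"
        unfolding h_def by (rule Min_le) (use finX in auto)
      ultimately have h: "h \<in> X - {x}" "\<And>y. y \<in> X - {x} \<Longrightarrow> h \<le> y" by blast+
      obtain y where "y \<in> X - {x}" "y < c" using True by blast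
      then have "h < c" using h(2)[of y] by simp
      moreover have "x < h" using h(1) x(2)[of h] by auto
      ultimately have hc: "h < c" "x < h" by auto
      have "odd (h - (x + 1))" using h(1) xc Xp by auto
      have "tiling_sum w (tri k ` (?C - {lo..<x})) = 0"
      proof (rule strip_odd_run[OF w, of _ "x + 1" h])
        show "x + 1 \<le> c" if "c \<in> ?C - {lo..<x}" for c
          using that x(1) by (cases "c = x") auto
        have "y \<notin> X" if "x < y" "y < h" for y using h(2)[of y] that by auto
        then show "y \<in> ?C - {lo..<x}" if "x + 1 \<le> y" "y < h" for y
          using that ncs[of y] hc xc c(1,2) by auto
      qed (use h(1) hc \<open>odd (h - (x + 1))\<close> in auto)
      moreover have "\<not> (\<exists>xs\<in>listset (gaps lo (c # cs)). X = set xs)"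
      proof
        assume "\<exists>xs\<in>listset (gaps lo (c # cs)). X = set xs"
        then obtain x' xs where "x' < c" "xs \<in> listset (gaps (c + 1) cs)" "X = insert x' (set xs)"
          unfolding in_listset_gaps_Cons by blast
        moreover have "c + 1 \<le> y" if "y \<in> set xs" for y using rest[OF calculation(2) refl that] by simp
        ultimately show False using x(1) h(1) hc xc by fastforce
      qed
      ultimately show ?thesis using 1 by simp
    next
      case False
      define Y where "Y = X - {x}"
      have "c < y" if "y \<in> Y" for y
        using False that cC unfolding Y_def by (cases "y = c") force+
      then have Y: "X = insert x Y" "x \<notin> Y" "\<And>y. y \<in> Y \<Longrightarrow> c < y" using x(1) unfolding Y_def by auto
      have "tiling_sum w (tri k ` (?C - {lo..<x})) = tiling_sum w (tri k ` (?C - {lo..<x} - {x + 1..<c}))"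
      proof (rule strip_even_run[OF w])
        show "x + 1 \<le> c" if "c \<in> ?C - {lo..<x}" for c
          using that x(1) by (cases "c = x") auto
        have "y \<notin> X" if "x < y" "y < c" for y using Y(1) Y(3)[of y] that by auto
        then show "y \<in> ?C - {lo..<x}" if "x + 1 \<le> y" "y < c" for y
          using that ncs[of y] xc c(1,2) by auto
      qed (use xc c(3) in auto)
      also have "?C - {lo..<x} - {x + 1..<c} = {c + 1..hi} - set cs - Y"
        using xc c Y by (auto; force)
      also have "tiling_sum w (tri k ` \<dots>) = (if \<exists>xs\<in>listset (gaps (c + 1) cs). Y = set xs then 1 else 0)"
      proof (rule Cons.IH)
        show "\<forall>c'\<in>set cs. c + 1 \<le> c' \<and> c' \<le> hi \<and> odd (c' - (c + 1))" using Cons.prems(1,2) by force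
        show "Y \<subseteq> {x. c + 1 \<le> x \<and> x \<le> hi \<and> even (x - (c + 1))}" using Y Xp c by force
      qed (use Cons.prems c in auto)
      also have "(\<exists>xs\<in>listset (gaps (c + 1) cs). Y = set xs) \<longleftrightarrow> (\<exists>xs\<in>listset (gaps lo (c # cs)). X = set xs)"
      proof
        assume "\<exists>xs\<in>listset (gaps (c + 1) cs). Y = set xs"
        then show "\<exists>xs\<in>listset (gaps lo (c # cs)). X = set xs"
          unfolding in_listset_gaps_Cons using xc Y(1) by blast
      next
        assume "\<exists>xs\<in>listset (gaps lo (c # cs)). X = set xs"
        then obtain x' xs where x': "x' < c" "xs \<in> listset (gaps (c + 1) cs)" "X = insert x' (set xs)"
          unfolding in_listset_gaps_Cons by blast
        have "c + 1 \<le> y" if "y \<in> set xs" for y using rest[OF x'(2) refl that] by simp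
        then have "x \<notin> set xs" "x' \<notin> set xs" using xc(1) x'(1) by force+
        then have "x = x'" "x' \<notin> set xs" using x'(3) x(1) by auto
        then show "\<exists>xs\<in>listset (gaps (c + 1) cs). Y = set xs" using x' Y_def by auto
      qed
      finally show ?thesis using 1 by simp
    qed
  qed
qed

text \<open>The cells at even distance from the left end now point up, so the first removed cell
  must be up-pointing in order to leave an even run. It is \<open>hd cs\<close>, and what follows it
  is the situation of \<open>strip_from_down\<close>.\<close>

lemma strip_from_up:
  assumes w: "strip_unit w"
    and cs: "sorted_wrt (<) cs" "\<forall>c\<in>set cs. lo \<le> c \<and> c \<le> hi \<and> even (c - lo)"
    and X: "X \<subseteq> {x. lo \<le> x \<and> x \<le> hi \<and> odd (x - lo)}" and hi: "even (hi - lo)" "lo \<le> hi"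
  shows "tiling_sum w (tri k ` ({lo..hi} - set cs - X)) =
      (if cs \<noteq> [] \<and> (\<exists>xs\<in>listset (gaps (hd cs + 1) (tl cs)). X = set xs) then 1 else 0)"
proof -
  have finX: "finite X" by (rule finite_subset[OF X]) (rule finite_subset[of _ "{lo..hi}"], auto)
  \<comment> \<open>The first removed cell, or the place past the right end if nothing is
    removed.\<close>
  define h where "h = Min (insert (hi + 1) (X \<union> set cs))"
  have "h \<in> insert (hi + 1) (X \<union> set cs)" unfolding h_def by (rule Min_in) (use finX in auto)
  moreover have "\<And>y. y \<in> X \<union> set cs \<Longrightarrow> h \<le> y" "h \<le> hi + 1"
    unfolding h_def by (rule Min_le, use finX in auto)+
  ultimately have h: "h \<in> insert (hi + 1) (X \<union> set cs)" "\<And>y. y \<in> X \<Longrightarrow> h \<le> y"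
    "\<And>y. y \<in> set cs \<Longrightarrow> h \<le> y" "h \<le> hi + 1"
    by blast+
  have lh: "lo \<le> h" using h(1) X cs hi by force
  let ?C = "{lo..hi} - set cs - X"
  show ?thesis
  proof (cases "h \<in> set cs")
    case False
    then have "odd (h - lo)" using h(1) X hi by auto
    then have 0: "tiling_sum w (tri k ` ?C) = 0"
    proof (intro strip_odd_run[OF w, of _ lo h])
      have "y \<notin> X \<and> y \<notin> set cs" if "y < h" for y using h(2,3)[of y] that by auto
      then show "y \<in> ?C" if "lo \<le> y" "y < h" for y using that h(4) by auto
    qed (use h(1) False lh in auto)
    have "\<not> (cs \<noteq> [] \<and> (\<exists>xs\<in>listset (gaps (hd cs + 1) (tl cs)). X = set xs))"
    proof
      assume a: "cs \<noteq> [] \<and> (\<exists>xs\<in>listset (gaps (hd cs + 1) (tl cs)). X = set xs)"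
      then obtain c cs' xs where "cs = c # cs'" "xs \<in> listset (gaps (c + 1) cs')" "X = set xs"
        by (cases cs) auto
      moreover from this have "c + 1 \<le> x" if "x \<in> X" for x
        using listset_gaps_bounds[of xs "c + 1" cs' x] cs(1) that by auto
      moreover have "h \<le> c" "c \<le> hi" using h(3)[of c] cs(2) calculation(1) by auto
      ultimately show False using h(1) False by force
    qed
    with 0 show ?thesis by simp
  next
    case True
    then obtain c cs' where cs': "cs = c # cs'" by (cases cs) auto
    have "h = c" using True h cs(1) cs' by (auto; force)
    then have hc: "h = c" "lo \<le> c" "even (c - lo)" "c \<notin> X" "c \<le> hi" using cs X cs' by auto
    have Y: "c < x" if "x \<in> X" for x using h(2)[OF that] hc(1,4) that by (cases "x = c") auto
    have "tiling_sum w (tri k ` ?C) = tiling_sum w (tri k ` (?C - {lo..<c}))"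
    proof (rule strip_even_run[OF w])
      have "y \<notin> X \<and> y \<notin> set cs" if "y < h" for y using h(2,3)[of y] that by auto
      then show "y \<in> ?C" if "lo \<le> y" "y < c" for y using that h(4) hc by auto
    qed (use hc in auto)
    also have "?C - {lo..<c} = {c + 1..hi} - set cs' - X"
      using hc cs cs' Y by (auto; force)
    also have "tiling_sum w (tri k ` \<dots>) = (if \<exists>xs\<in>listset (gaps (c + 1) cs'). X = set xs then 1 else 0)"
    proof (rule strip_from_down[OF w])
      show "\<forall>c'\<in>set cs'. c + 1 \<le> c' \<and> c' \<le> hi \<and> odd (c' - (c + 1))" using cs cs' hc by force
      show "X \<subseteq> {x. c + 1 \<le> x \<and> x \<le> hi \<and> even (x - (c + 1))}" using X Y hc by force
    qed (use cs cs' hc hi in auto)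
    finally show ?thesis by (simp add: cs')
  qed
qed

section \<open>Trapezoids with a zigzag side\<close>

lemma tri_in_image: "tri j c \<in> tri k ` S \<longleftrightarrow> j = k \<and> c \<in> S"
  by (auto simp: tri_inject)

lemma in_listset_iff: "xs \<in> listset As \<longleftrightarrow> length xs = length As \<and> (\<forall>i<length As. xs ! i \<in> As ! i)"
proof (induction As arbitrary: xs)
  case (Cons A As)
  show ?case
    by (cases xs) (auto simp: set_Cons_def Cons.IH All_less_Suc2)
qed auto

text \<open>Choosing one position per gap means choosing one summand per row, so the sum moves into
  the determinant by multilinearity.\<close>

lemma sum_listset_det:
  fixes g :: "nat \<Rightarrow> int \<Rightarrow> real" and \<omega> :: "int \<Rightarrow> real"
  assumes "\<And>i. i < length Js \<Longrightarrow> finite (Js ! i)" and n: "n = length Js"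
  shows "(\<Sum>xs\<in>listset Js. (\<Prod>i=0..<n. \<omega> (xs ! i)) * det (mat n n (\<lambda>(i, j). g j (xs ! i)))) =
    det (mat n n (\<lambda>(i, j). \<Sum>x\<in>Js ! i. \<omega> x * g j x))"
proof -
  have "det (mat n n (\<lambda>(i, j). \<Sum>x\<in>Js ! i. \<omega> x * g j x)) =
      (\<Sum>f\<in>PiE {0..<n} (\<lambda>i. Js ! i). det (mat n n (\<lambda>(i, j). \<omega> (f i) * g j (f i))))"
    by (rule det_row_sums) (use assms in auto)
  also have "\<dots> = (\<Sum>f\<in>PiE {0..<n} (\<lambda>i. Js ! i). (\<Prod>i=0..<n. \<omega> (f i)) * det (mat n n (\<lambda>(i, j). g j (f i))))"
    by (simp only: det_row_factors)
  also have "\<dots> = (\<Sum>xs\<in>listset Js. (\<Prod>i=0..<n. \<omega> (xs ! i)) * det (mat n n (\<lambda>(i, j). g j (xs ! i))))"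
  proof (rule sum.reindex_bij_witness[where i = "\<lambda>xs. restrict (nth xs) {0..<n}" and j = "\<lambda>f. map f [0..<n]"])
    fix f assume f: "f \<in> PiE {0..<n} (\<lambda>i. Js ! i)"
    show "restrict ((!) (map f [0..<n])) {0..<n} = f"
    proof
      show "restrict ((!) (map f [0..<n])) {0..<n} i = f i" for i
        using f by (cases "i < n") (auto simp: PiE_def extensional_def)
    qed
    show "map f [0..<n] \<in> listset Js" using f n by (auto simp: in_listset_iff)
    have "mat n n (\<lambda>(i, j). g j (map f [0..<n] ! i)) = mat n n (\<lambda>(i, j). g j (f i))"
      by (rule cong_mat) auto
    then show "(\<Prod>i=0..<n. \<omega> (map f [0..<n] ! i)) * det (mat n n (\<lambda>(i, j). g j (map f [0..<n] ! i))) =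
        (\<Prod>i=0..<n. \<omega> (f i)) * det (mat n n (\<lambda>(i, j). g j (f i)))" by simp
  next
    fix xs assume xs: "xs \<in> listset Js"
    then show "map (restrict ((!) xs) {0..<n}) [0..<n] = xs"
      by (auto simp: in_listset_iff n intro: nth_equalityI)
    show "restrict ((!) xs) {0..<n} \<in> PiE {0..<n} (\<lambda>i. Js ! i)"
      using xs n by (auto simp: in_listset_iff)
  qed
  finally show ?thesis by simp
qed

lemma sum_Pow_listset:
  fixes F :: "'a set \<Rightarrow> real"
  assumes "finite D" "\<And>xs. xs \<in> listset Js \<Longrightarrow> set xs \<subseteq> D" "inj_on set (listset Js)"
  shows "(\<Sum>X\<in>Pow D. F X * (if \<exists>xs\<in>listset Js. X = set xs then 1 else 0)) = (\<Sum>xs\<in>listset Js. F (set xs))"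
proof -
  have "(\<Sum>X\<in>Pow D. F X * (if \<exists>xs\<in>listset Js. X = set xs then 1 else 0)) = (\<Sum>X\<in>set ` listset Js. F X)"
    by (rule sum.mono_neutral_cong_right) (use assms in auto)
  also have "\<dots> = (\<Sum>xs\<in>listset Js. F (set xs))"
    by (simp add: sum.reindex[OF assms(3)])
  finally show ?thesis .
qed

text \<open>The admissible positions in a gap are two apart, as are the arguments of the central
  difference, so the sum telescopes.\<close>

lemma sum_gap:
  fixes g G :: "int \<Rightarrow> real"
  assumes "\<And>x. G (x + 1) - G (x - 1) = g x" "lo \<le> c" "odd (c - lo)"
  shows "(\<Sum>x | lo \<le> x \<and> x < c \<and> even (x - lo). g x) = G c - G (lo - 1)"
proof -
  have *: "(\<Sum>x | lo \<le> x \<and> x < lo + 1 + 2 * int n \<and> even (x - lo). g x) = G (lo + 1 + 2 * int n) - G (lo - 1)" for n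
  proof (induction n)
    case 0
    have "{x. lo \<le> x \<and> x < lo + 1 + 2 * int 0 \<and> even (x - lo)} = {lo}" by auto
    then show ?case using assms(1)[of lo] by simp
  next
    case (Suc n)
    have "{x. lo \<le> x \<and> x < lo + 1 + 2 * int (Suc n) \<and> even (x - lo)} =
        insert (lo + 2 + 2 * int n) {x. lo \<le> x \<and> x < lo + 1 + 2 * int n \<and> even (x - lo)}"
    proof (intro equalityI subsetI)
      fix x assume x: "x \<in> {x. lo \<le> x \<and> x < lo + 1 + 2 * int (Suc n) \<and> even (x - lo)}"
      then have "x \<noteq> lo + 1 + 2 * int n" by auto
      with x show "x \<in> insert (lo + 2 + 2 * int n) {x. lo \<le> x \<and> x < lo + 1 + 2 * int n \<and> even (x - lo)}"
        by auto
    qed auto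
    moreover have "finite {x. lo \<le> x \<and> x < lo + 1 + 2 * int n \<and> even (x - lo)}"
      by (rule finite_subset[of _ "{lo..lo + 1 + 2 * int n}"]) auto
    ultimately show ?case using Suc assms(1)[of "lo + 2 + 2 * int n"] by (simp add: algebra_simps)
  qed
  define n where "n = nat ((c - lo - 1) div 2)"
  have "c = lo + 1 + 2 * int n" using assms(2,3) unfolding n_def by (auto elim!: oddE)
  then show ?thesis using *[of n] by simp
qed

lemma gaps_nth:
  "i < length cs \<Longrightarrow> gaps lo cs ! i =
    (let l = if i = 0 then lo else cs ! (i - 1) + 1 in {x. l \<le> x \<and> x < cs ! i \<and> even (x - l)})"
proof (induction cs arbitrary: lo i)
  case (Cons c cs)
  show ?case
  proof (cases i)
    case (Suc i')
    then show ?thesis using Cons.IH[of i' "c + 1"] Cons.prems by (cases i') (auto simp: Let_def)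
  qed (auto simp: Let_def)
qed simp

lemma finite_gaps: "i < length cs \<Longrightarrow> finite (gaps lo cs ! i)"
  by (auto simp: gaps_nth Let_def intro: finite_subset[of _ "{lo..cs ! i}"] finite_subset[of _ "{cs ! (i - 1)..cs ! i}"])

lemma inj_on_set_gaps:
  assumes "sorted_wrt (<) ((lo - 1) # cs)"
  shows "inj_on set (listset (gaps lo cs))"
proof (rule inj_onI)
  fix xs ys assume "xs \<in> listset (gaps lo cs)" "ys \<in> listset (gaps lo cs)" "set xs = set ys"
  then show "xs = ys" using listset_gaps_sorted[OF _ assms] by (metis strict_sorted_equal)
qed

lemma prod_set_nth:
  "distinct xs \<Longrightarrow> (\<Prod>x\<in>set xs. f x) = (\<Prod>i=0..<length xs. f (xs ! i))"
  by (rule prod.reindex_bij_betw[symmetric, OF bij_betw_nth]) auto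

lemma sorted_wrt_nth_Suc: "sorted_wrt (<) cs \<Longrightarrow> Suc i < length cs \<Longrightarrow> cs ! i < (cs ! Suc i :: int)"
  by (simp add: sorted_wrt_nth_less)

text \<open>The zigzag is indented at the top row \<open>k1\<close> in such a way that the strip above row \<open>k\<close> starts
  with an up-pointing triangle iff \<open>k1 - k\<close> is odd. Summation over a gap raises the index of the
  functions \<open>g m\<close> by one.\<close>

locale zigzag_rows =
  fixes w :: "lozenge \<Rightarrow> real" and g :: "nat \<Rightarrow> int \<Rightarrow> real" and zg :: "int \<Rightarrow> int" and k1 R :: int
  assumes strip: "strip_unit w"
    and R_even: "even R"
    and zg_parity: "even (zg k - k)"
    and zg_step: "zg (k + 1) = zg k + (if odd (k1 - k) then 1 else - 1)"
    and R_ge: "0 \<le> k \<Longrightarrow> k \<le> k1 \<Longrightarrow> zg k \<le> R - k"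
    and g_0: "g 0 x = 1"
    and g_diff: "g (Suc m) (x + 1) - g (Suc m) (x - 1) = g m x"
    and w_inner: "0 \<le> k \<Longrightarrow> k < k1 \<Longrightarrow> even (x - k) \<Longrightarrow> odd (k1 - k) \<or> x \<noteq> zg k \<Longrightarrow>
      w {tri k x, tri (k + 1) x} = 1"
    and w_zigzag: "0 \<le> k \<Longrightarrow> k < k1 \<Longrightarrow> even (k1 - k) \<Longrightarrow>
      w {tri k (zg k), tri (k + 1) (zg k)} * g (2 * j) (zg k) = g (2 * j + 1) (zg k + 1)"
begin

text \<open>Axis of the leftmost triangle between rows k and k + 1. It points up, with axis one to
  the right of \<open>zg k\<close>, if the zigzag moves right there; otherwise it points down with
  its lower vertex on the zigzag.\<close>

definition lft :: "int \<Rightarrow> int" where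
  "lft k = zg k + (if odd (k1 - k) then 1 else 0)"

definition trap :: "int \<Rightarrow> region" where
  "trap k = triangles_in (\<lambda>p j. k \<le> j \<and> j \<le> k1 \<and> zg j \<le> p \<and> p \<le> R - j)"

lemma tri_in_trap: "tri j c \<in> trap k \<longleftrightarrow> k \<le> j \<and> j < k1 \<and> lft j \<le> c \<and> c \<le> R - j - 1"
proof (cases "odd (c - j)")
  case True
  have "c \<noteq> zg j" using zg_parity[of j] True by auto
  have "tri j c \<in> trap k \<longleftrightarrow> k \<le> j \<and> j + 1 \<le> k1 \<and> zg j \<le> c - 1 \<and> c + 1 \<le> R - j \<and> zg (j + 1) \<le> c \<and> c \<le> R - (j + 1)"
    unfolding trap_def triangles_in_def mem_Collect_eq tri_up[OF True]
    using tri_up[OF True] unit_triangle_iff by auto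
  then show ?thesis using \<open>c \<noteq> zg j\<close> zg_step[of j] by (auto simp: lft_def)
next
  case False
  have 1: "c \<noteq> zg j + 1" "c \<noteq> R - j - 1" using zg_parity[of j] False R_even by auto
  have e: "even (c - j)" using False by simp
  have "tri j c \<in> trap k \<longleftrightarrow> k \<le> j \<and> j + 1 \<le> k1 \<and> zg (j + 1) \<le> c - 1 \<and> c + 1 \<le> R - (j + 1) \<and> zg j \<le> c \<and> c \<le> R - j"
    unfolding trap_def triangles_in_def mem_Collect_eq tri_down[OF e]
    using tri_down[OF e] unit_triangle_iff by auto
  then show ?thesis using 1 zg_step[of j] by (auto simp: lft_def)
qed

lemma trap_tri: "t \<in> trap k \<Longrightarrow> \<exists>j c. t = tri j c"
  by (auto simp: trap_def triangles_in_def unit_triangle_iff)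

lemma trap_split:
  assumes "k < k1"
  shows "trap k = trap (k + 1) \<union> tri k ` {lft k..R - k - 1}"
proof (rule Set.set_eqI)
  fix t
  show "t \<in> trap k \<longleftrightarrow> t \<in> trap (k + 1) \<union> tri k ` {lft k..R - k - 1}"
  proof (cases "\<exists>j c. t = tri j c")
    case True
    then obtain j c where t: "t = tri j c" by blast
    show ?thesis unfolding t Un_iff tri_in_trap tri_in_image using assms by (cases "j = k") auto
  next
    case False
    then have "t \<notin> trap k" "t \<notin> trap (k + 1)" "t \<notin> tri k ` {lft k..R - k - 1}"
      using trap_tri by blast+
    then show ?thesis by simp
  qed
qed

lemma trap_empty: "k1 \<le> k \<Longrightarrow> trap k = {}"
  using trap_tri tri_in_trap by fastforce

lemma finite_trap: "finite (trap k)"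
proof -
  have "finite (trap (k1 - int n))" for n
  proof (induction n)
    case (Suc n)
    have "k1 - int (Suc n) + 1 = k1 - int n" by simp
    then show ?case using trap_split[of "k1 - int (Suc n)"] Suc by simp
  qed (simp add: trap_empty)
  from this[of "nat (k1 - k)"] show ?thesis by (cases "k \<le> k1") (auto simp: trap_empty)
qed

text \<open>The bottom row is split off as the lower part. The dents point up, so they never collide
  with the down-pointing cells that the vertical lozenges in X occupy.\<close>

lemma trap_row_sum:
  assumes k: "0 \<le> k" "k < k1"
    and cs: "sorted_wrt (<) cs" "\<forall>c\<in>set cs. odd (c - k) \<and> lft k \<le> c \<and> c \<le> R - k - 1"
    and D: "D = {c. odd (c - (k + 1)) \<and> lft k \<le> c \<and> c \<le> R - k - 1 \<and> tri (k + 1) c \<in> trap (k + 1)}"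
  shows "tiling_sum w (trap k - tri k ` set cs) = (\<Sum>X\<in>Pow D.
    (\<Prod>c\<in>X. w {tri k c, tri (k + 1) c}) * tiling_sum w (trap (k + 1) - tri (k + 1) ` X) *
    tiling_sum w (tri k ` ({lft k..R - k - 1} - set cs - X)))"
proof -
  let ?B = "tri k ` ({lft k..R - k - 1} - set cs)"
  have eq: "trap k - tri k ` set cs = trap (k + 1) \<union> ?B"
  proof -
    have "tri k c \<notin> trap (k + 1)" for c by (simp add: tri_in_trap)
    then show ?thesis unfolding trap_split[OF k(2)] by (auto simp: tri_inject)
  qed
  have D': "D = {c. odd (c - (k + 1)) \<and> tri (k + 1) c \<in> trap (k + 1) \<and> tri (k + 1 - 1) c \<in> ?B}"
    unfolding D using cs(2) by (auto simp: tri_in_image)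
  have B: "?B - tri (k + 1 - 1) ` X = tri k ` ({lft k..R - k - 1} - set cs - X)" for X
    by (auto simp: tri_inject)
  have "tiling_sum w (trap (k + 1) \<union> ?B) = (\<Sum>X\<in>Pow D. (\<Prod>c\<in>X. w {tri (k + 1 - 1) c, tri (k + 1) c}) *
    tiling_sum w (trap (k + 1) - tri (k + 1) ` X) * tiling_sum w (?B - tri (k + 1 - 1) ` X))"
  proof (rule tiling_sum_rows[OF finite_trap _ _ _ D'])
    show "\<exists>k' c. k + 1 \<le> k' \<and> t = tri k' c" if "t \<in> trap (k + 1)" for t
      using trap_tri[OF that] that by (auto simp: tri_in_trap)
  qed auto
  then show ?thesis unfolding eq B by simp
qed

text \<open>Induction on the number r of rows. Summing a determinant over one position per gap
  raises the index of every function by one and produces differences of consecutive rows. On passing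
  to the next row the number of dents stays or drops by one, depending on the parity of r, which
  gives the count \<open>(r + 1) div 2\<close>.\<close>

theorem trap_tiling_sum:
  assumes "0 \<le> k" "k1 - k = int r" "1 \<le> r" "sorted_wrt (<) cs"
    "\<forall>c\<in>set cs. odd (c - k) \<and> lft k \<le> c \<and> c \<le> R - k - 1"
  shows "tiling_sum w (trap k - tri k ` set cs) = (if length cs = (r + 1) div 2 then
    det (mat (length cs) (length cs) (\<lambda>(i, j). g (2 * j + (if even r then 1 else 0)) (cs ! i))) else 0)"
  using assms
proof (induction r arbitrary: k cs)
  case (Suc r)
  note k = Suc.prems(1,2) and cs = Suc.prems(4,5)
  have kk1: "k < k1" using k by simp
  have par: "odd (k1 - k) \<longleftrightarrow> even r" using k(2) by simp
  define D where "D = {c. odd (c - (k + 1)) \<and> lft k \<le> c \<and> c \<le> R - k - 1 \<and> tri (k + 1) c \<in> trap (k + 1)}"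
  define W where "W X = (\<Prod>c\<in>X. w {tri k c, tri (k + 1) c})" for X
  define F where "F X = tiling_sum w (trap (k + 1) - tri (k + 1) ` X)" for X
  have finD: "finite D" by (rule finite_subset[of _ "{lft k..R - k - 1}"]) (auto simp: D_def)
  have main: "tiling_sum w (trap k - tri k ` set cs) = (\<Sum>X\<in>Pow D. W X * F X *
      tiling_sum w (tri k ` ({lft k..R - k - 1} - set cs - X)))"
    unfolding W_def F_def by (rule trap_row_sum[OF k(1) kk1 cs D_def])
  have k': "0 \<le> k + 1" "k1 - (k + 1) = int r" using k by auto
  define \<omega> where "\<omega> x = w {tri k x, tri (k + 1) x}" for x
  have zgk: "even (zg k - k)" by (rule zg_parity)
  have Wnth: "W (set xs) = (\<Prod>i=0..<length xs. \<omega> (xs ! i))" if "sorted_wrt (<) xs" for xs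
  proof -
    have "distinct xs" using that by (simp add: strict_sorted_iff)
    then show ?thesis unfolding W_def \<omega>_def by (rule prod_set_nth)
  qed
  have diff: "g (Suc m) (x + 1) - g (Suc m) (x - 1) = g m x" for m x by (rule g_diff)
  have \<omega>_gap: "(\<Sum>x | l \<le> x \<and> x < c \<and> even (x - l). \<omega> x * g m x) = g (Suc m) c - g (Suc m) (l - 1)"
    if "l \<le> c" "odd (c - l)" "even (l - k)" "odd (k1 - k) \<or> zg k < l" for l c m
  proof -
    have "(\<Sum>x | l \<le> x \<and> x < c \<and> even (x - l). \<omega> x * g m x) = (\<Sum>x | l \<le> x \<and> x < c \<and> even (x - l). g m x)"
    proof (rule sum.cong[OF refl])
      fix x assume "x \<in> {x. l \<le> x \<and> x < c \<and> even (x - l)}"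
      then have "even (x - k)" "odd (k1 - k) \<or> x \<noteq> zg k" using that by auto
      then have "\<omega> x = 1" unfolding \<omega>_def by (intro w_inner[OF k(1) kk1])
      then show "\<omega> x * g m x = g m x" by simp
    qed
    also have "\<dots> = g (Suc m) c - g (Suc m) (l - 1)"
      by (rule sum_gap[OF diff that(1,2)])
    finally show ?thesis .
  qed
  have nth_less: "cs ! i < cs ! Suc i" if "Suc i < length cs" for i
    using cs(1) that by (rule sorted_wrt_nth_Suc)
  have nth_par: "odd (cs ! i - k)" "lft k \<le> cs ! i" "cs ! i \<le> R - k - 1" if "i < length cs" for i
    using cs(2) that by auto
  show ?case
  proof (cases "even r")
    case False
    \<comment> \<open>The strip starts with a down-pointing triangle, so every dent has a gap before
      it and the number of dents is preserved.\<close>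
    then have lk: "lft k = zg k" "lft (k + 1) = zg k"
      using par zg_step[of k] k'(2) by (auto simp: lft_def)
    have r1: "1 \<le> r" using False by (cases r) auto
    let ?Js = "gaps (lft k) cs" and ?n = "length cs"
    have sorted1: "sorted_wrt (<) ((lft k - 1) # cs)" using cs by auto
    have xsD: "set xs \<subseteq> D" and
      xsF: "F (set xs) = (if ?n = (r + 1) div 2 then det (mat ?n ?n (\<lambda>(i, j). g (2 * j) (xs ! i))) else 0)" and
      xsW: "W (set xs) = (\<Prod>i=0..<?n. \<omega> (xs ! i))"
      if xs: "xs \<in> listset ?Js" for xs
    proof -
      have len: "length xs = ?n" using xs by (simp add: in_listset_iff)
      have srt: "sorted_wrt (<) xs" by (rule listset_gaps_sorted[OF xs sorted1])
      have b: "lft k \<le> x" "x \<le> R - k - 2" "odd (x - (k + 1))" if xin: "x \<in> set xs" for x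
      proof -
        obtain c where "c \<in> set cs" "x < c" "lft k \<le> x"
          using listset_gaps_bounds[OF xs disjI2[OF sorted1] xin] by blast
        then show "lft k \<le> x" "x \<le> R - k - 2" using cs(2) by force+
        have "even (x - lft k)"
          by (rule listset_gaps_parity[OF xs _ xin]) (use cs(2) lk zgk in auto)
        then have "even (x - k)" using lk zgk by auto
        then show "odd (x - (k + 1))" by simp
      qed
      show "set xs \<subseteq> D" using b k' r1 lk by (force simp: D_def tri_in_trap)
      show "W (set xs) = (\<Prod>i=0..<?n. \<omega> (xs ! i))" using Wnth[OF srt] len by simp
      have "F (set xs) = (if length xs = (r + 1) div 2 then
          det (mat (length xs) (length xs) (\<lambda>(i, j). g (2 * j + (if even r then 1 else 0)) (xs ! i))) else 0)"
        unfolding F_def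
      proof (rule Suc.IH[OF k' r1 srt])
        show "\<forall>c\<in>set xs. odd (c - (k + 1)) \<and> lft (k + 1) \<le> c \<and> c \<le> R - (k + 1) - 1"
          using b lk by force
      qed
      then show "F (set xs) = (if ?n = (r + 1) div 2 then det (mat ?n ?n (\<lambda>(i, j). g (2 * j) (xs ! i))) else 0)"
        using False len by simp
    qed
    have tile: "tiling_sum w (tri k ` ({lft k..R - k - 1} - set cs - X)) =
        (if \<exists>xs\<in>listset ?Js. X = set xs then 1 else 0)" if "X \<in> Pow D" for X
    proof (rule strip_from_down[OF strip cs(1)])
      show "\<forall>c\<in>set cs. lft k \<le> c \<and> c \<le> R - k - 1 \<and> odd (c - lft k)" using cs(2) lk zgk by auto
      show "X \<subseteq> {x. lft k \<le> x \<and> x \<le> R - k - 1 \<and> even (x - lft k)}"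
        using that lk zgk by (auto simp: D_def)
      show "odd (R - k - 1 - lft k)" using lk zgk R_even by auto
      show "lft k - 1 \<le> R - k - 1" using R_ge[of k] k(1) kk1 lk by simp
    qed
    have "tiling_sum w (trap k - tri k ` set cs) =
        (\<Sum>X\<in>Pow D. W X * F X * (if \<exists>xs\<in>listset ?Js. X = set xs then 1 else 0))"
      unfolding main by (rule sum.cong[OF refl]) (simp only: tile)
    also have "\<dots> = (\<Sum>xs\<in>listset ?Js. W (set xs) * F (set xs))"
      by (rule sum_Pow_listset[OF finD xsD inj_on_set_gaps[OF sorted1]])
    also have "\<dots> = (if ?n = (r + 1) div 2 then
        (\<Sum>xs\<in>listset ?Js. (\<Prod>i=0..<?n. \<omega> (xs ! i)) * det (mat ?n ?n (\<lambda>(i, j). g (2 * j) (xs ! i)))) else 0)"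
      by (simp add: xsF xsW)
    also have "(\<Sum>xs\<in>listset ?Js. (\<Prod>i=0..<?n. \<omega> (xs ! i)) * det (mat ?n ?n (\<lambda>(i, j). g (2 * j) (xs ! i)))) =
        det (mat ?n ?n (\<lambda>(i, j). \<Sum>x\<in>?Js ! i. \<omega> x * g (2 * j) x))"
      by (rule sum_listset_det) (auto simp: finite_gaps)
    also have "mat ?n ?n (\<lambda>(i, j). \<Sum>x\<in>?Js ! i. \<omega> x * g (2 * j) x) =
        mat ?n ?n (\<lambda>(i, j). g (2 * j + 1) (cs ! i) - (if i = 0 then 0 else g (2 * j + 1) (cs ! (i - 1))))"
    proof (rule cong_mat[OF refl refl], unfold case_prod_conv)
      fix i j assume i: "i < ?n"
      show "(\<Sum>x\<in>?Js ! i. \<omega> x * g (2 * j) x) =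
          g (2 * j + 1) (cs ! i) - (if i = 0 then 0 else g (2 * j + 1) (cs ! (i - 1)))"
      proof (cases i)
        case 0
        \<comment> \<open>The first gap starts at the zigzag, and only its first term can be
          weighted. By \<open>w_zigzag\<close> this term equals the value that telescoping subtracts
          at the lower end, so the top row of the matrix carries no difference.\<close>
        let ?z = "zg k" and ?c = "cs ! 0"
        have c: "odd (?c - ?z)" "?z < ?c" using nth_par[of 0] i 0 lk zgk by (auto simp: order_le_less)
        let ?S = "{x. ?z + 2 \<le> x \<and> x < ?c \<and> even (x - (?z + 2))}"
        have S: "{x. ?z \<le> x \<and> x < ?c \<and> even (x - ?z)} = insert ?z ?S"
        proof (intro equalityI subsetI)
          fix x assume x: "x \<in> {x. ?z \<le> x \<and> x < ?c \<and> even (x - ?z)}"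
          then have "x \<noteq> ?z + 1" by auto
          with x show "x \<in> insert ?z ?S" by auto
        qed (use c in auto)
        have "finite ?S" by (rule finite_subset[of _ "{?z..?c}"]) auto
        then have "(\<Sum>x\<in>insert ?z ?S. \<omega> x * g (2 * j) x) = \<omega> ?z * g (2 * j) ?z + (\<Sum>x\<in>?S. \<omega> x * g (2 * j) x)"
          by (subst sum.insert) auto
        also have "\<omega> ?z * g (2 * j) ?z = g (2 * j + 1) (?z + 1)"
          unfolding \<omega>_def by (rule w_zigzag[OF k(1) kk1]) (use par False in simp)
        also have "(\<Sum>x\<in>?S. \<omega> x * g (2 * j) x) = g (2 * j + 1) ?c - g (2 * j + 1) (?z + 1)"
        proof (cases "?z + 2 \<le> ?c")
          case True
          then show ?thesis using \<omega>_gap[of "?z + 2" ?c "2 * j"] c zgk by (simp add: add.commute)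
        next
          case False
          then have "?c = ?z + 1" using c by simp
          moreover from this have "?S = {}" by auto
          ultimately show ?thesis by (simp only: sum.empty diff_self)
        qed
        finally show ?thesis unfolding S[symmetric] using 0 i by (simp add: gaps_nth Let_def lk)
      next
        case (Suc i')
        have "(\<Sum>x | cs ! i' + 1 \<le> x \<and> x < cs ! i \<and> even (x - (cs ! i' + 1)). \<omega> x * g (2 * j) x) =
            g (Suc (2 * j)) (cs ! i) - g (Suc (2 * j)) (cs ! i' + 1 - 1)"
        proof (rule \<omega>_gap)
          have p: "odd (cs ! i' - k)" "odd (cs ! i - k)" "lft k \<le> cs ! i'" "cs ! i' < cs ! i"
            using nth_par[of i'] nth_par[of i] nth_less[of i'] i Suc by auto
          then show "cs ! i' + 1 \<le> cs ! i" "odd (cs ! i - (cs ! i' + 1))" "even (cs ! i' + 1 - k)"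
            "odd (k1 - k) \<or> zg k < cs ! i' + 1" using lk by auto
        qed
        then show ?thesis using i Suc by (simp add: gaps_nth Let_def)
      qed
    qed
    also have "det \<dots> = det (mat ?n ?n (\<lambda>(i, j). g (2 * j + 1) (cs ! i)))"
      by (rule det_row_differences)
    finally show ?thesis using False by simp
  next
    case True
    \<comment> \<open>The strip starts with an up-pointing triangle. No gap precedes the first dent,
      so one dent fewer is passed on.\<close>
    then have lk: "lft k = zg k + 1" "lft (k + 1) = zg k + 1"
      using par zg_step[of k] k'(2) by (auto simp: lft_def)
    let ?Js = "gaps (hd cs + 1) (tl cs)"
    have tile: "tiling_sum w (tri k ` ({lft k..R - k - 1} - set cs - X)) =
        (if cs \<noteq> [] \<and> (\<exists>xs\<in>listset ?Js. X = set xs) then 1 else 0)" if "X \<in> Pow D" for X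
    proof (rule strip_from_up[OF strip cs(1)])
      show "\<forall>c\<in>set cs. lft k \<le> c \<and> c \<le> R - k - 1 \<and> even (c - lft k)" using cs(2) lk zgk by auto
      show "X \<subseteq> {x. lft k \<le> x \<and> x \<le> R - k - 1 \<and> odd (x - lft k)}"
        using that lk zgk by (auto simp: D_def)
      show "even (R - k - 1 - lft k)" using lk zgk R_even by auto
      have "zg (k + 1) = zg k + 1" using zg_step[of k] par True by simp
      then show "lft k \<le> R - k - 1" using R_ge[of "k + 1"] k(1) kk1 lk by simp
    qed
    have main': "tiling_sum w (trap k - tri k ` set cs) =
        (\<Sum>X\<in>Pow D. W X * F X * (if cs \<noteq> [] \<and> (\<exists>xs\<in>listset ?Js. X = set xs) then 1 else 0))"
      unfolding main by (rule sum.cong[OF refl]) (simp only: tile)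
    show ?thesis
    proof (cases cs)
      case Nil
      have "0 \<noteq> (Suc r + 1) div 2" by simp
      then show ?thesis unfolding main' using Nil by simp
    next
      case (Cons c0 cs')
      let ?n = "length cs'"
      have Js: "?Js = gaps (c0 + 1) cs'" by (simp add: Cons)
      have sorted1: "sorted_wrt (<) ((c0 + 1 - 1) # cs')" using cs Cons by simp
      have c0: "odd (c0 - k)" "lft k \<le> c0" using cs(2) Cons by auto
      show ?thesis
      proof (cases "r = 0")
        case True
        \<comment> \<open>From the topmost row nothing can be passed on. Hence exactly one dent is
          possible, and the 1 x 1 determinant is g 0 = 1.\<close>
        then have "trap (k + 1) = {}" using k' by (intro trap_empty) simp
        then have "D = {}" "F {} = 1" by (simp_all add: D_def F_def tiling_sum_empty)
        then have "tiling_sum w (trap k - tri k ` set cs) = (if \<exists>xs\<in>listset (gaps (c0 + 1) cs'). {} = set xs then 1 else 0)"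
          unfolding main' by (simp add: Cons W_def)
        also have "(\<exists>xs\<in>listset (gaps (c0 + 1) cs'). {} = set xs) \<longleftrightarrow> cs' = []"
          by (cases cs') (auto simp: set_Cons_def)
        finally show ?thesis using True Cons by (auto simp: det_single g_0)
      next
        case r0: False
        have r1: "1 \<le> r" using r0 by simp
        have xsD: "set xs \<subseteq> D" and
          xsF: "F (set xs) = (if ?n = (r + 1) div 2 then det (mat ?n ?n (\<lambda>(i, j). g (2 * j + 1) (xs ! i))) else 0)" and
          xsW: "W (set xs) = (\<Prod>i=0..<?n. \<omega> (xs ! i))"
          if xs: "xs \<in> listset (gaps (c0 + 1) cs')" for xs
        proof -
          have len: "length xs = ?n" using xs by (simp add: in_listset_iff)
          have srt: "sorted_wrt (<) xs" by (rule listset_gaps_sorted[OF xs sorted1])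
          have b: "lft k \<le> x" "x \<le> R - k - 2" "odd (x - (k + 1))" if xin: "x \<in> set xs" for x
          proof -
            obtain c where "c \<in> set cs'" "x < c" "c0 + 1 \<le> x"
              using listset_gaps_bounds[OF xs disjI2[OF sorted1] xin] by blast
            then show "lft k \<le> x" "x \<le> R - k - 2" using cs(2) Cons c0 by force+
            have "even (x - (c0 + 1))"
              by (rule listset_gaps_parity[OF xs _ xin]) (use cs(2) Cons c0 in auto)
            then show "odd (x - (k + 1))" using c0 by auto
          qed
          show "set xs \<subseteq> D" using b k' r1 lk by (force simp: D_def tri_in_trap)
          show "W (set xs) = (\<Prod>i=0..<?n. \<omega> (xs ! i))" using Wnth[OF srt] len by simp
          have "F (set xs) = (if length xs = (r + 1) div 2 then
              det (mat (length xs) (length xs) (\<lambda>(i, j). g (2 * j + (if even r then 1 else 0)) (xs ! i))) else 0)"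
            unfolding F_def
          proof (rule Suc.IH[OF k' r1 srt])
            show "\<forall>c\<in>set xs. odd (c - (k + 1)) \<and> lft (k + 1) \<le> c \<and> c \<le> R - (k + 1) - 1"
              using b lk by force
          qed
          then show "F (set xs) = (if ?n = (r + 1) div 2 then det (mat ?n ?n (\<lambda>(i, j). g (2 * j + 1) (xs ! i))) else 0)"
            using True len by simp
        qed
        have "tiling_sum w (trap k - tri k ` set cs) =
            (\<Sum>X\<in>Pow D. W X * F X * (if \<exists>xs\<in>listset (gaps (c0 + 1) cs'). X = set xs then 1 else 0))"
          unfolding main' Js by (simp add: Cons)
        also have "\<dots> = (\<Sum>xs\<in>listset (gaps (c0 + 1) cs'). W (set xs) * F (set xs))"
          by (rule sum_Pow_listset[OF finD xsD inj_on_set_gaps[OF sorted1]])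
        also have "\<dots> = (if ?n = (r + 1) div 2 then
            (\<Sum>xs\<in>listset (gaps (c0 + 1) cs'). (\<Prod>i=0..<?n. \<omega> (xs ! i)) * det (mat ?n ?n (\<lambda>(i, j). g (2 * j + 1) (xs ! i)))) else 0)"
          by (simp add: xsF xsW)
        also have "(\<Sum>xs\<in>listset (gaps (c0 + 1) cs'). (\<Prod>i=0..<?n. \<omega> (xs ! i)) * det (mat ?n ?n (\<lambda>(i, j). g (2 * j + 1) (xs ! i)))) =
            det (mat ?n ?n (\<lambda>(i, j). \<Sum>x\<in>gaps (c0 + 1) cs' ! i. \<omega> x * g (2 * j + 1) x))"
          by (rule sum_listset_det) (auto simp: finite_gaps)
        also have "mat ?n ?n (\<lambda>(i, j). \<Sum>x\<in>gaps (c0 + 1) cs' ! i. \<omega> x * g (2 * j + 1) x) =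
            mat ?n ?n (\<lambda>(i, j). g (2 * Suc j) (cs ! Suc i) - g (2 * Suc j) (cs ! i))"
        proof (rule cong_mat[OF refl refl], unfold case_prod_conv)
          fix i j assume i: "i < ?n"
          have "(\<Sum>x | cs ! i + 1 \<le> x \<and> x < cs ! Suc i \<and> even (x - (cs ! i + 1)). \<omega> x * g (2 * j + 1) x) =
              g (Suc (2 * j + 1)) (cs ! Suc i) - g (Suc (2 * j + 1)) (cs ! i + 1 - 1)"
          proof (rule \<omega>_gap)
            have p: "odd (cs ! i - k)" "odd (cs ! Suc i - k)" "cs ! i < cs ! Suc i"
              using nth_par[of i] nth_par[of "Suc i"] nth_less[of i] i Cons by auto
            then show "cs ! i + 1 \<le> cs ! Suc i" "odd (cs ! Suc i - (cs ! i + 1))" "even (cs ! i + 1 - k)" by auto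
            show "odd (k1 - k) \<or> zg k < cs ! i + 1" using par True by simp
          qed
          moreover have "gaps (c0 + 1) cs' ! i = {x. cs ! i + 1 \<le> x \<and> x < cs ! Suc i \<and> even (x - (cs ! i + 1))}"
            using i Cons by (cases i) (auto simp: gaps_nth Let_def)
          ultimately show "(\<Sum>x\<in>gaps (c0 + 1) cs' ! i. \<omega> x * g (2 * j + 1) x) = g (2 * Suc j) (cs ! Suc i) - g (2 * Suc j) (cs ! i)"
            by simp
        qed
        \<comment> \<open>The constant column g 0 = 1 lets the differences of consecutive rows be
          read as a determinant that is larger by one.\<close>
        also have "det \<dots> = det (mat (Suc ?n) (Suc ?n) (\<lambda>(i, j). g (2 * j) (cs ! i)))"
          by (rule det_first_column_one[symmetric]) (simp add: g_0)
        finally show ?thesis using True Cons by auto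
      qed
    qed
  qed
qed simp

end

text \<open>Central factorial polynomials, even or odd in \<open>c\<close> according to the parity of \<open>m\<close>.\<close>

definition cfac :: "nat \<Rightarrow> int \<Rightarrow> real" where
  "cfac m c = ((of_int c + real m - 1) / 2) gchoose m"

lemma cfac_0: "cfac 0 c = 1"
  by (simp add: cfac_def)

lemma cfac_diff: "cfac (Suc m) (c + 1) - cfac (Suc m) (c - 1) = cfac m c"
proof -
  define a where "a = (of_int c + real m - 1) / 2"
  have "(of_int (c + 1) + real (Suc m) - 1) / 2 = a + 1" "(of_int (c - 1) + real (Suc m) - 1) / 2 = a"
    by (simp_all add: a_def field_simps)
  then show ?thesis unfolding cfac_def by (simp only: a_def[symmetric] gbinomial_Suc_Suc)
qed

text \<open>The zeros of the left side in X are half-odd numbers symmetric about 0, and opposite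
  zeros pair up.\<close>

lemma falling_symmetric_prod:
  fixes X :: real
  shows "(\<Prod>i<2 * j. X + real j - 1 / 2 - real i) = (\<Prod>t<j. X\<^sup>2 - (real t + 1 / 2)\<^sup>2)"
proof (induction j)
  case (Suc j)
  have "(\<Prod>i<2 * Suc j. X + real (Suc j) - 1 / 2 - real i) =
      (\<Prod>i<Suc (Suc (2 * j)). X + real (Suc j) - 1 / 2 - real i)" by simp
  also have "\<dots> = (X + real j + 1 / 2) * (\<Prod>i<Suc (2 * j). X + real j - 1 / 2 - real i)"
    unfolding prod.lessThan_Suc_shift
    by (intro arg_cong2[where f = "(*)"] prod.cong) (auto simp: algebra_simps)
  also have "\<dots> = (\<Prod>i<2 * j. X + real j - 1 / 2 - real i) * ((X + real j + 1 / 2) * (X - real j - 1 / 2))"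
    by simp
  also have "(X + real j + 1 / 2) * (X - real j - 1 / 2) = X\<^sup>2 - (real j + 1 / 2)\<^sup>2"
    by (simp add: power2_eq_square algebra_simps)
  finally show ?case using Suc by simp
qed simp

lemma cfac_even: "cfac (2 * j) c = (\<Prod>t<j. (of_int c / 2)\<^sup>2 - (real t + 1 / 2)\<^sup>2) / fact (2 * j)"
proof -
  have "(of_int c + real (2 * j) - 1) / 2 = of_int c / 2 + real j - 1 / 2" by (simp add: field_simps)
  then show ?thesis
    by (simp only: cfac_def gbinomial_prod_rev atLeast0LessThan falling_symmetric_prod)
qed

lemma cfac_odd_0: "cfac (2 * j + 1) 0 = 0"
proof -
  have "(of_int 0 + real (2 * j + 1) - 1) / 2 = real j" by simp
  then have "cfac (2 * j + 1) 0 = real j gchoose (2 * j + 1)" by (simp only: cfac_def)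
  also have "\<dots> = real (j choose (2 * j + 1))" by (rule binomial_gbinomial[symmetric])
  finally show ?thesis by simp
qed

text \<open>Averaging two neighbours preserves the difference equation and the initial value 1. The
  members of odd index become multiples of c times the even central factorials, so the Newton nodes
  are the same as for \<open>cfac\<close>.\<close>

definition cfac_mean :: "nat \<Rightarrow> int \<Rightarrow> real" where
  "cfac_mean m c = (cfac m (c + 1) + cfac m (c - 1)) / 2"

lemma cfac_mean_0: "cfac_mean 0 c = 1"
  by (simp add: cfac_mean_def cfac_0)

lemma cfac_mean_diff: "cfac_mean (Suc m) (c + 1) - cfac_mean (Suc m) (c - 1) = cfac_mean m c"
  using cfac_diff[of m "c + 1"] cfac_diff[of m "c - 1"] by (simp add: cfac_mean_def field_simps)

text \<open>Both neighbours are binomial coefficients, with upper arguments a + 1 and a. Pascal's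
  rule and absorption reduce them to \<open>a gchoose (2 * j)\<close>, and the linear factors add up
  to c.\<close>

lemma cfac_mean_odd: "cfac_mean (2 * j + 1) c = of_int c / 2 * cfac (2 * j) c / (2 * real j + 1)"
proof -
  define a where "a = (of_int c + real (2 * j) - 1) / 2"
  have 1: "(of_int (c + 1) + real (2 * j + 1) - 1) / 2 = a + 1" "(of_int (c - 1) + real (2 * j + 1) - 1) / 2 = a"
    by (simp_all add: a_def field_simps)
  have "(2 * real j + 1) * (a gchoose (2 * j + 1)) = (a - real (2 * j)) * (a gchoose (2 * j))"
    using gbinomial_absorb_comp[of a "2 * j"] gbinomial_absorption[of "2 * j" a]
    by (simp add: algebra_simps gbinomial_mult_1)
  moreover have "a + 1 gchoose (2 * j + 1) = (a gchoose (2 * j)) + (a gchoose (2 * j + 1))"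
    using gbinomial_Suc_Suc[of a "2 * j"] by simp
  ultimately have "(2 * real j + 1) * ((a + 1 gchoose (2 * j + 1)) + (a gchoose (2 * j + 1))) =
      (2 * real j + 1 + 2 * (a - real (2 * j))) * (a gchoose (2 * j))"
    by (simp add: algebra_simps)
  also have "2 * real j + 1 + 2 * (a - real (2 * j)) = of_int c"
    by (simp add: a_def field_simps)
  finally have *: "(2 * real j + 1) * ((a + 1 gchoose (2 * j + 1)) + (a gchoose (2 * j + 1))) = of_int c * (a gchoose (2 * j))" .
  have "cfac_mean (2 * j + 1) c = ((a + 1 gchoose (2 * j + 1)) + (a gchoose (2 * j + 1))) / 2"
    unfolding cfac_mean_def cfac_def 1 ..
  moreover have "cfac (2 * j) c = a gchoose (2 * j)" unfolding cfac_def a_def ..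
  moreover have "(a + 1 gchoose (2 * j + 1)) + (a gchoose (2 * j + 1)) = of_int c * (a gchoose (2 * j)) / (2 * real j + 1)"
    using * by (subst eq_divide_eq) (simp add: mult.commute)
  ultimately have "cfac_mean (2 * j + 1) c = of_int c * cfac (2 * j) c / (2 * real j + 1) / 2"
    by (simp only:)
  then show ?thesis by simp
qed

section \<open>The zigzag weight in terms of rows and axes\<close>

lemma zig_out_edge_up:
  "{(p, k), (p + 1, k + 1)} \<in> zig_out_edges h \<longleftrightarrow> 0 \<le> k \<and> k < h \<and> odd k \<and> p = - 1"
proof
  assume "{(p, k), (p + 1, k + 1)} \<in> zig_out_edges h"
  then obtain j where j: "0 \<le> j" "j < h"
    and eq: "{(p, k), (p + 1, k + 1)} = {(zig_out j, j), (zig_out (j + 1), j + 1)}"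
    unfolding zig_out_edges_def by blast
  have "k = j" "p = zig_out j" "p + 1 = zig_out (j + 1)"
    using eq unfolding doubleton_eq_iff prod.inject by linarith+
  with j show "0 \<le> k \<and> k < h \<and> odd k \<and> p = - 1" by (simp add: zig_out_def split: if_splits)
next
  assume k: "0 \<le> k \<and> k < h \<and> odd k \<and> p = - 1"
  then have "{(p, k), (p + 1, k + 1)} = {(zig_out k, k), (zig_out (k + 1), k + 1)}"
    by (simp add: zig_out_def)
  with k show "{(p, k), (p + 1, k + 1)} \<in> zig_out_edges h" unfolding zig_out_edges_def by blast
qed

lemma zig_out_edge_down:
  "{(p, k), (p + 1, k - 1)} \<in> zig_out_edges h \<longleftrightarrow> 1 \<le> k \<and> k \<le> h \<and> odd k \<and> p = - 1"
proof
  assume "{(p, k), (p + 1, k - 1)} \<in> zig_out_edges h"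
  then obtain j where j: "0 \<le> j" "j < h"
    and eq: "{(p, k), (p + 1, k - 1)} = {(zig_out j, j), (zig_out (j + 1), j + 1)}"
    unfolding zig_out_edges_def by blast
  have "k = j + 1" "p + 1 = zig_out j" "p = zig_out (j + 1)"
    using eq unfolding doubleton_eq_iff prod.inject by linarith+
  with j show "1 \<le> k \<and> k \<le> h \<and> odd k \<and> p = - 1" by (simp add: zig_out_def split: if_splits)
next
  assume k: "1 \<le> k \<and> k \<le> h \<and> odd k \<and> p = - 1"
  then have "{(p, k), (p + 1, k - 1)} = {(zig_out (k - 1), k - 1), (zig_out (k - 1 + 1), k - 1 + 1)}"
    by (simp add: zig_out_def insert_commute)
  moreover have "0 \<le> k - 1" "k - 1 < h" using k by auto
  ultimately show "{(p, k), (p + 1, k - 1)} \<in> zig_out_edges h" unfolding zig_out_edges_def by blast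
qed

text \<open>Both western sides lie on the zigzag only if the western corner is one of its outward
  vertices, at doubled abscissa -1 and odd height. The vertical axis of such a lozenge is 0.\<close>

lemma zigzag_weight_tri:
  "zigzag_weight h l = (if \<exists>k. odd k \<and> 0 < k \<and> k < h \<and> l = {tri k 0, tri (k - 1) 0} then 1 / 2 else 1)"
proof -
  have "(\<exists>p k. l = {up_tri p k, down_tri p k} \<and> {(p, k), (p + 1, k + 1)} \<in> zig_out_edges h \<and>
      {(p, k), (p + 1, k - 1)} \<in> zig_out_edges h) \<longleftrightarrow>
    (\<exists>k. odd k \<and> 0 < k \<and> k < h \<and> l = {tri k 0, tri (k - 1) 0})" (is "?L \<longleftrightarrow> ?R")
  proof
    assume ?L
    then obtain p k where "l = {up_tri p k, down_tri p k}" "1 \<le> k" "k < h" "odd k" "p = - 1"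
      unfolding zig_out_edge_up zig_out_edge_down by blast
    then show ?R by (intro exI[of _ k]) (simp add: up_tri_conv down_tri_conv)
  next
    assume ?R
    then obtain k where "odd k" "0 < k" "k < h" "l = {tri k 0, tri (k - 1) 0}" by blast
    then show ?L unfolding zig_out_edge_up zig_out_edge_down
      by (intro exI[of _ "- 1"] exI[of _ k]) (simp add: up_tri_conv down_tri_conv)
  qed
  then show ?thesis by (simp add: zigzag_weight_def)
qed

lemma strip_unit_zigzag_weight: "strip_unit (zigzag_weight h)"
proof -
  have "{tri k c, tri k (c + 1)} \<noteq> {tri j 0, tri (j - 1) 0}" for k c j
    by (simp add: doubleton_eq_iff tri_inject)
  then show ?thesis by (simp add: strip_unit_def zigzag_weight_tri)
qed

lemma zigzag_weight_vertical:
  "zigzag_weight h {tri k x, tri (k + 1) x} = (if x = 0 \<and> even k \<and> 0 \<le> k \<and> k + 1 < h then 1 / 2 else 1)"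
proof -
  have "{tri k x, tri (k + 1) x} = {tri j 0, tri (j - 1) 0} \<longleftrightarrow> j = k + 1 \<and> x = 0" for j
    unfolding doubleton_eq_iff tri_inject by auto
  moreover have "(\<exists>j. odd j \<and> 0 < j \<and> j < h \<and> j = k + 1 \<and> x = 0) \<longleftrightarrow> x = 0 \<and> even k \<and> 0 \<le> k \<and> k + 1 < h"
    by (rule iffI, clarsimp, intro exI[of _ "k + 1"], simp)
  ultimately show ?thesis by (simp only: zigzag_weight_tri)
qed

section \<open>Product formulas for trapezoids with unit dents\<close>

lemma prod_sorted_pairs:
  assumes "sorted_wrt (<) ps"
  shows "(\<Prod>i<length ps. \<Prod>k<i. sqh (ps ! i) - sqh (ps ! k)) = vdm (set ps)" (is "?L = _")
proof -
  have "distinct ps" using assms by (simp add: strict_sorted_iff)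
  then have inj: "inj_on ((!) ps) {0..<length ps}" by (auto simp: inj_on_def nth_eq_iff_index_eq)
  have im: "(!) ps ` {0..<length ps} = set ps" by (auto simp: set_conv_nth)
  have "?L\<^sup>2 = (vdm (set ps))\<^sup>2" using vdm_square_image[OF inj] by (simp only: im)
  moreover have "?L \<ge> 0"
    by (intro prod_nonneg) (auto simp: less_imp_le sqh_strict_mono sorted_wrt_nth_less[OF assms])
  moreover have "vdm (set ps) \<ge> 0" using vdm_pos[of "set ps"] by simp
  ultimately show ?thesis by (rule power2_eq_imp_eq)
qed

text \<open>Doubled abscissa of the axis of the unit triangles on the base segment from p to p +
  1.\<close>

definition ctr :: "nat \<Rightarrow> int" where
  "ctr p = 2 * int p + 1"

lemma ctr_half_square: "(of_int (ctr p) / 2)\<^sup>2 = sqh p"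
  by (simp add: ctr_def sqh_def add_divide_distrib)

definition zz_trapezoid :: "(int \<Rightarrow> int) \<Rightarrow> int \<Rightarrow> int \<Rightarrow> region" where
  "zz_trapezoid zg R h = triangles_in (\<lambda>p k. 0 \<le> k \<and> k \<le> h \<and> zg k \<le> p \<and> p \<le> R - k)"

definition K_prod :: "nat set \<Rightarrow> real" where
  "K_prod P = vdm P / (\<Prod>j<card P. fact (2 * j))"

definition Q_prod :: "nat set \<Rightarrow> real" where
  "Q_prod P = (\<Prod>p\<in>P. real p + 1 / 2) * vdm P / (\<Prod>j<card P. fact (2 * j + 1))"

lemma K_prod_pos: "finite P \<Longrightarrow> K_prod P > 0"
  by (auto simp: K_prod_def intro!: divide_pos_pos vdm_pos prod_pos)

lemma Q_prod_pos: "finite P \<Longrightarrow> Q_prod P > 0"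
  by (auto simp: Q_prod_def intro!: divide_pos_pos mult_pos_pos vdm_pos prod_pos)

context
  fixes P :: "nat set" and N h :: nat
  assumes P: "P \<subseteq> {..<N}" and h: "1 \<le> h" "h \<le> N"
begin

definition "ps = sorted_list_of_set P"

lemma finite_P: "finite P"
  using P finite_subset by blast

lemma ps_props: "sorted_wrt (<) ps" "set ps = P" "length ps = card P" "distinct ps"
  using finite_P by (auto simp: ps_def)

lemma sorted_ctr_ps: "sorted_wrt (<) (map ctr ps)"
  using ps_props(1) unfolding sorted_wrt_map
  by (rule sorted_wrt_mono_rel[rotated]) (simp add: ctr_def)

text \<open>The boundary condition \<open>cfac (2 * j) 1 = cfac (2 * j + 1) 2\<close> is the
  difference equation together with the zero of \<open>cfac (2 * j + 1)\<close> at 0. The height is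
  odd, so the final determinant contains the even functions \<open>cfac (2 * j)\<close>, which up to
  factorials form a Newton basis in the squares.\<close>

lemma K_trapezoid_tiling_sum:
  "tiling_sum (\<lambda>_. 1) (zz_trapezoid zig_in (2 * int N) (2 * int h - 1) - tri 0 ` ctr ` P) =
    (if card P = h then K_prod P else 0)"
proof -
  interpret zigzag_rows "\<lambda>_. 1" cfac zig_in "2 * int h - 1" "2 * int N"
  proof
    show "strip_unit (\<lambda>_. 1)" by (simp add: strip_unit_def)
    show "zig_in k \<le> 2 * int N - k" if "0 \<le> k" "k \<le> 2 * int h - 1" for k
      using that h by (auto simp: zig_in_def)
    show "1 * cfac (2 * j) (zig_in k) = cfac (2 * j + 1) (zig_in k + 1)"
      if "even (2 * int h - 1 - k)" for k j
    proof -
      have "zig_in k = 1" using that by (simp add: zig_in_def)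
      then show ?thesis using cfac_diff[of "2 * j" 1] cfac_odd_0[of j] by simp
    qed
  qed (auto simp: zig_in_def cfac_0 cfac_diff)
  have "trap 0 = zz_trapezoid zig_in (2 * int N) (2 * int h - 1)"
    by (simp add: trap_def zz_trapezoid_def)
  moreover have "tiling_sum (\<lambda>_. 1) (trap 0 - tri 0 ` set (map ctr ps)) =
    (if length (map ctr ps) = (2 * h - 1 + 1) div 2 then
    det (mat (length (map ctr ps)) (length (map ctr ps))
      (\<lambda>(i, j). cfac (2 * j + (if even (2 * h - 1) then 1 else 0)) (map ctr ps ! i))) else 0)"
  proof (rule trap_tiling_sum[OF _ _ _ sorted_ctr_ps])
    show "\<forall>c\<in>set (map ctr ps). odd (c - 0) \<and> lft 0 \<le> c \<and> c \<le> 2 * int N - 0 - 1"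
      using P by (force simp: lft_def zig_in_def ctr_def ps_props)
  qed (use h in auto)
  moreover have "det (mat (card P) (card P)
      (\<lambda>(i, j). cfac (2 * j + (if even (2 * h - 1) then 1 else 0)) (map ctr ps ! i))) = K_prod P"
  proof -
    have "mat (card P) (card P) (\<lambda>(i, j). cfac (2 * j + (if even (2 * h - 1) then 1 else 0)) (map ctr ps ! i)) =
        mat (card P) (card P) (\<lambda>(i, j). 1 / fact (2 * j) * (\<Prod>t<j. sqh (ps ! i) - (real t + 1 / 2)\<^sup>2))"
    proof (intro cong_mat refl)
      fix i j assume "i < card P" "j < card P"
      then have "map ctr ps ! i = ctr (ps ! i)" by (simp add: ps_props)
      moreover have "cfac (2 * j) (ctr (ps ! i)) = 1 / fact (2 * j) * (\<Prod>t<j. sqh (ps ! i) - (real t + 1 / 2)\<^sup>2)"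
        unfolding cfac_even ctr_half_square by simp
      ultimately show "(case (i, j) of (i, j) \<Rightarrow> cfac (2 * j + (if even (2 * h - 1) then 1 else 0)) (map ctr ps ! i)) =
        (case (i, j) of (i, j) \<Rightarrow> 1 / fact (2 * j) * (\<Prod>t<j. sqh (ps ! i) - (real t + 1 / 2)\<^sup>2))"
        using h by simp
    qed
    then have "det (mat (card P) (card P) (\<lambda>(i, j). cfac (2 * j + (if even (2 * h - 1) then 1 else 0)) (map ctr ps ! i))) =
       (\<Prod>j=0..<card P. 1 / fact (2 * j)) * (\<Prod>i<card P. \<Prod>k<i. sqh (ps ! i) - sqh (ps ! k))"
      by (simp only: det_col_factors newton_vandermonde)
    also have "(\<Prod>i<card P. \<Prod>k<i. sqh (ps ! i) - sqh (ps ! k)) = vdm P"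
      using prod_sorted_pairs[OF ps_props(1)] by (simp add: ps_props)
    also have "(\<Prod>j=0..<card P. 1 / fact (2 * j)) = 1 / (\<Prod>j<card P. fact (2 * j) :: real)"
      by (simp add: prod_dividef lessThan_atLeast0)
    finally show ?thesis by (simp add: K_prod_def)
  qed
  moreover have "(2 * h - 1 + 1) div 2 = h" using h by simp
  ultimately show ?thesis by (simp only: length_map set_map ps_props)
qed

text \<open>\<open>cfac_mean (2 * j + 1)\<close> is odd, so its difference across 0 is twice its
  value at 1; the weight 1/2 turns exactly this into the boundary condition. The height is even, so
  the odd functions appear, and every row of the determinant yields an additional factor p +
  1/2.\<close>

lemma Q_trapezoid_tiling_sum:
  "tiling_sum (zigzag_weight (2 * int h)) (zz_trapezoid zig_out (2 * int N) (2 * int h) - tri 0 ` ctr ` P) =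
    (if card P = h then Q_prod P else 0)"
proof -
  interpret zigzag_rows "zigzag_weight (2 * int h)" cfac_mean zig_out "2 * int h" "2 * int N"
  proof
    show "strip_unit (zigzag_weight (2 * int h))" by (rule strip_unit_zigzag_weight)
    show "zig_out k \<le> 2 * int N - k" if "0 \<le> k" "k \<le> 2 * int h" for k
      using that h by (auto simp: zig_out_def)
    show "zigzag_weight (2 * int h) {tri k x, tri (k + 1) x} = 1"
      if "0 \<le> k" "k < 2 * int h" "even (x - k)" "odd (2 * int h - k) \<or> x \<noteq> zig_out k" for k x
      using that by (auto simp: zigzag_weight_vertical zig_out_def)
    show "zigzag_weight (2 * int h) {tri k (zig_out k), tri (k + 1) (zig_out k)} * cfac_mean (2 * j) (zig_out k) =
        cfac_mean (2 * j + 1) (zig_out k + 1)"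
      if "0 \<le> k" "k < 2 * int h" "even (2 * int h - k)" for k j
    proof -
      have k: "zig_out k = 0" "even k" using that by (simp_all add: zig_out_def)
      \<comment> \<open>k and the height are both even, so both western sides of the lozenge lie on
        the zigzag.\<close>
      then have "k + 1 < 2 * int h" using that(2) by presburger
      then have wt: "zigzag_weight (2 * int h) {tri k 0, tri (k + 1) 0} = 1 / 2"
        using k that by (simp add: zigzag_weight_vertical)
      have "cfac_mean (2 * j + 1) (- 1) = - cfac_mean (2 * j + 1) 1"
        by (simp only: cfac_mean_odd cfac_even) simp
      then have "cfac_mean (2 * j) 0 = 2 * cfac_mean (2 * j + 1) (0 + 1)"
        using cfac_mean_diff[of "2 * j" 0] by simp
      then show ?thesis unfolding k(1) wt by simp
    qed
  qed (auto simp: zig_out_def cfac_mean_0 cfac_mean_diff)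
  have "trap 0 = zz_trapezoid zig_out (2 * int N) (2 * int h)"
    by (simp add: trap_def zz_trapezoid_def)
  moreover have "tiling_sum (zigzag_weight (2 * int h)) (trap 0 - tri 0 ` set (map ctr ps)) =
    (if length (map ctr ps) = (2 * h + 1) div 2 then
    det (mat (length (map ctr ps)) (length (map ctr ps))
      (\<lambda>(i, j). cfac_mean (2 * j + (if even (2 * h) then 1 else 0)) (map ctr ps ! i))) else 0)"
  proof (rule trap_tiling_sum[OF _ _ _ sorted_ctr_ps])
    show "\<forall>c\<in>set (map ctr ps). odd (c - 0) \<and> lft 0 \<le> c \<and> c \<le> 2 * int N - 0 - 1"
      using P by (force simp: lft_def zig_out_def ctr_def ps_props)
  qed (use h in auto)
  moreover have "det (mat (card P) (card P)
      (\<lambda>(i, j). cfac_mean (2 * j + (if even (2 * h) then 1 else 0)) (map ctr ps ! i))) = Q_prod P"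
  proof -
    have f: "fact (2 * j + 1) = (2 * real j + 1) * fact (2 * j)" for j by simp
    have "mat (card P) (card P) (\<lambda>(i, j). cfac_mean (2 * j + (if even (2 * h) then 1 else 0)) (map ctr ps ! i)) =
        mat (card P) (card P) (\<lambda>(i, j). (real (ps ! i) + 1 / 2) *
          (1 / fact (2 * j + 1) * (\<Prod>t<j. sqh (ps ! i) - (real t + 1 / 2)\<^sup>2)))"
    proof (intro cong_mat refl)
      fix i j assume "i < card P" "j < card P"
      then have "map ctr ps ! i = ctr (ps ! i)" by (simp add: ps_props)
      moreover have "of_int (ctr (ps ! i)) / 2 = real (ps ! i) + 1 / 2" by (simp add: ctr_def add_divide_distrib)
      moreover have "cfac_mean (2 * j + 1) (ctr (ps ! i)) = of_int (ctr (ps ! i)) / 2 *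
          (1 / fact (2 * j + 1) * (\<Prod>t<j. sqh (ps ! i) - (real t + 1 / 2)\<^sup>2))"
        unfolding cfac_mean_odd cfac_even ctr_half_square f by (simp add: mult_ac)
      ultimately have "cfac_mean (2 * j + 1) (map ctr ps ! i) = (real (ps ! i) + 1 / 2) *
          (1 / fact (2 * j + 1) * (\<Prod>t<j. sqh (ps ! i) - (real t + 1 / 2)\<^sup>2))"
        by (simp only:)
      then show "(case (i, j) of (i, j) \<Rightarrow> cfac_mean (2 * j + (if even (2 * h) then 1 else 0)) (map ctr ps ! i)) =
        (case (i, j) of (i, j) \<Rightarrow> (real (ps ! i) + 1 / 2) *
          (1 / fact (2 * j + 1) * (\<Prod>t<j. sqh (ps ! i) - (real t + 1 / 2)\<^sup>2)))"
        by simp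
    qed
    then have "det (mat (card P) (card P) (\<lambda>(i, j). cfac_mean (2 * j + (if even (2 * h) then 1 else 0)) (map ctr ps ! i))) =
       (\<Prod>i=0..<card P. real (ps ! i) + 1 / 2) * ((\<Prod>j=0..<card P. 1 / fact (2 * j + 1)) *
         (\<Prod>i<card P. \<Prod>k<i. sqh (ps ! i) - sqh (ps ! k)))"
      by (simp only: det_row_factors det_col_factors newton_vandermonde)
    also have "(\<Prod>i=0..<card P. real (ps ! i) + 1 / 2) = (\<Prod>p\<in>P. real p + 1 / 2)"
      using prod_set_nth[OF ps_props(4), of "\<lambda>p. real p + 1 / 2"] by (simp add: ps_props)
    also have "(\<Prod>i<card P. \<Prod>k<i. sqh (ps ! i) - sqh (ps ! k)) = vdm P"
      using prod_sorted_pairs[OF ps_props(1)] by (simp add: ps_props)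
    also have "(\<Prod>j=0..<card P. 1 / fact (2 * j + 1)) = 1 / (\<Prod>j<card P. fact (2 * j + 1) :: real)"
      by (simp add: prod_dividef lessThan_atLeast0)
    finally show ?thesis by (simp add: Q_prod_def)
  qed
  moreover have "(2 * h + 1) div 2 = h" by simp
  ultimately show ?thesis by (simp only: length_map set_map ps_props)
qed

end

section \<open>Forced lozenges\<close>

text \<open>A down-pointing cell without neighbours in its own row can only pair with the cell above
  it.\<close>

lemma forced_up:
  assumes "finite C" "finite R"
    and "\<And>c. c \<in> C \<Longrightarrow> even (c - k) \<and> tri k c \<in> R \<and> tri (k + 1) c \<in> R \<and> tri k (c + 1) \<notin> R \<and>
      tri k (c - 1) \<notin> R \<and> w {tri k c, tri (k + 1) c} = 1"
  shows "tiling_sum w R = tiling_sum w (R - tri k ` C - tri (k + 1) ` C)"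
  using assms
proof (induction C arbitrary: R rule: finite_induct)
  case (insert c C)
  let ?R = "R - {tri k c, tri (k + 1) c}"
  have c: "even (c - k)" "tri k c \<in> R" "tri (k + 1) c \<in> R" "tri k (c + 1) \<notin> R"
      "tri k (c - 1) \<notin> R" "w {tri k c, tri (k + 1) c} = 1"
    using insert.prems(2)[of c] by auto
  have "tiling_sum w R = w {tri k c, tri (k + 1) c} * tiling_sum w ?R"
  proof (rule tiling_sum_forced[OF c(2,3) lozenge_vertical[OF c(1)] insert.prems(1)])
    fix t' assume "t' \<in> R" "is_lozenge {tri k c, t'}"
    then show "t' = tri (k + 1) c" using lozenge_neighbours[of k c t'] c by auto
  qed
  also have "\<dots> = tiling_sum w ?R" using c by simp
  also have "\<dots> = tiling_sum w (?R - tri k ` C - tri (k + 1) ` C)"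
  proof (rule insert.IH)
    fix c' assume "c' \<in> C"
    then have "c' \<noteq> c" using insert.hyps by auto
    then show "even (c' - k) \<and> tri k c' \<in> ?R \<and> tri (k + 1) c' \<in> ?R \<and> tri k (c' + 1) \<notin> ?R \<and>
      tri k (c' - 1) \<notin> ?R \<and> w {tri k c', tri (k + 1) c'} = 1"
      using insert.prems(2)[of c'] \<open>c' \<in> C\<close> by (simp add: tri_inject)
  qed (use insert.prems in simp)
  also have "?R - tri k ` C - tri (k + 1) ` C = R - tri k ` insert c C - tri (k + 1) ` insert c C" by auto
  finally show ?case .
qed simp

text \<open>Weighted lozenges have axis 0, whereas lozenges forced by dents have axis at least 1; so
  the trade of dents costs no weight.\<close>

definition vertical_unit :: "(lozenge \<Rightarrow> real) \<Rightarrow> bool" where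
  "vertical_unit w \<longleftrightarrow> (\<forall>k c. 1 \<le> c \<longrightarrow> w {tri k c, tri (k + 1) c} = 1)"

definition tri_cells :: "(int \<Rightarrow> int \<Rightarrow> bool) \<Rightarrow> region" where
  "tri_cells P = {t. \<exists>k c. P k c \<and> t = tri k c}"

lemma tri_in_cells [simp]: "tri k c \<in> tri_cells P \<longleftrightarrow> P k c"
  by (auto simp: tri_cells_def tri_inject)

definition has_cells :: "region \<Rightarrow> bool" where
  "has_cells R \<longleftrightarrow> (\<forall>t\<in>R. \<exists>k c. t = tri k c)"

lemma region_eqI:
  assumes "has_cells R" "has_cells R'" "\<And>k c. tri k c \<in> R \<longleftrightarrow> tri k c \<in> R'"
  shows "R = R'"
proof (rule equalityI; rule subsetI)
  fix t assume "t \<in> R"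
  with assms(1,3) show "t \<in> R'" by (auto simp: has_cells_def)
next
  fix t assume "t \<in> R'"
  with assms(2,3) show "t \<in> R" by (auto simp: has_cells_def)
qed

lemma has_cells_cells [intro!, simp]: "has_cells (tri_cells P)"
  by (auto simp: has_cells_def tri_cells_def)

lemma has_cells_image [intro!, simp]: "has_cells (tri k ` S)"
  by (auto simp: has_cells_def)

lemma has_cells_triangles_in [intro!, simp]: "has_cells (triangles_in P)"
  by (auto simp: has_cells_def triangles_in_def unit_triangle_iff)

lemma has_cells_Diff [intro, simp]: "has_cells R \<Longrightarrow> has_cells (R - R')"
  by (auto simp: has_cells_def)

lemma has_cells_Un [simp]: "has_cells (R \<union> R') \<longleftrightarrow> has_cells R \<and> has_cells R'"
  by (auto simp: has_cells_def)

lemma has_cells_UN [simp]: "has_cells (\<Union>i\<in>I. R i) \<longleftrightarrow> (\<forall>i\<in>I. has_cells (R i))"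
  by (auto simp: has_cells_def)

definition base_cells :: "int \<Rightarrow> nat \<Rightarrow> int set" where
  "base_cells c0 n = {c. c0 \<le> c \<and> c \<le> c0 + 2 * int n - 2 \<and> even (c - c0)}"

text \<open>n adjacent up-pointing dents isolate the n - 1 down-pointing cells between them. These
  pair upwards and act as n - 1 adjacent dents in the next row.\<close>

lemma remove_triangle:
  assumes "vertical_unit w"
  shows "finite R \<Longrightarrow> odd (c0 - k) \<Longrightarrow> 1 \<le> c0 \<Longrightarrow>
    tri_cells (\<lambda>j c. k \<le> j \<and> c0 + (j - k) \<le> c \<and> c \<le> c0 + 2 * int n - 2 - (j - k)) \<subseteq> R \<Longrightarrow>
    tiling_sum w (R - tri k ` base_cells c0 n) =
    tiling_sum w (R - tri_cells (\<lambda>j c. k \<le> j \<and> c0 + (j - k) \<le> c \<and> c \<le> c0 + 2 * int n - 2 - (j - k)))"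
proof (induction n arbitrary: R k c0)
  case 0
  have "base_cells c0 0 = {}" by (auto simp: base_cells_def)
  moreover have "tri_cells (\<lambda>j c. k \<le> j \<and> c0 + (j - k) \<le> c \<and> c \<le> c0 + 2 * int 0 - 2 - (j - k)) = {}"
    by (auto simp: tri_cells_def)
  ultimately show ?case by simp
next
  case (Suc n)
  let ?G = "\<lambda>j c. k \<le> j \<and> c0 + (j - k) \<le> c \<and> c \<le> c0 + 2 * int (Suc n) - 2 - (j - k)"
  let ?G' = "\<lambda>j c. k + 1 \<le> j \<and> (c0 + 1) + (j - (k + 1)) \<le> c \<and> c \<le> (c0 + 1) + 2 * int n - 2 - (j - (k + 1))"
  let ?B = "base_cells c0 (Suc n)" and ?C = "base_cells (c0 + 1) n"
  have G: "tri j c \<in> R" if "?G j c" for j c using Suc.prems(4) that by (auto simp: tri_cells_def)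
  have finC: "finite ?C" by (rule finite_subset[of _ "{c0..c0 + 1 + 2 * int n}"]) (auto simp: base_cells_def)
  have "tiling_sum w (R - tri k ` ?B) = tiling_sum w (R - tri k ` ?B - tri k ` ?C - tri (k + 1) ` ?C)"
  proof (rule forced_up[OF finC])
    fix c assume c: "c \<in> ?C"
    have b: "c0 + 1 \<le> c" "c \<le> c0 + 2 * int n - 1" "odd (c - c0)"
      using c by (auto simp: base_cells_def)
    have "c \<notin> ?B" "c + 1 \<in> ?B" "c - 1 \<in> ?B" using b by (auto simp: base_cells_def)
    moreover have "tri k c \<in> R" "tri (k + 1) c \<in> R" using b by (auto intro!: G)
    moreover have "even (c - k)" using b(3) Suc.prems(2) by auto
    moreover have "w {tri k c, tri (k + 1) c} = 1"
      using assms b(1) Suc.prems(3) by (auto simp: vertical_unit_def)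
    ultimately show "even (c - k) \<and> tri k c \<in> R - tri k ` ?B \<and> tri (k + 1) c \<in> R - tri k ` ?B \<and>
        tri k (c + 1) \<notin> R - tri k ` ?B \<and> tri k (c - 1) \<notin> R - tri k ` ?B \<and> w {tri k c, tri (k + 1) c} = 1"
      by (simp add: tri_in_image)
  qed (use Suc.prems in simp)
  also have "\<dots> = tiling_sum w (R - tri k ` ?B - tri k ` ?C - tri_cells ?G')"
  proof (rule Suc.IH)
    show "tri_cells ?G' \<subseteq> R - tri k ` ?B - tri k ` ?C"
    proof
      fix t assume "t \<in> tri_cells ?G'"
      then obtain j c where "t = tri j c" "?G' j c" by (auto simp: tri_cells_def)
      then show "t \<in> R - tri k ` ?B - tri k ` ?C" using G[of j c] by (simp add: tri_in_image)
    qed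
  qed (use Suc.prems in auto)
  also have "R - tri k ` ?B - tri k ` ?C - tri_cells ?G' = R - tri_cells ?G"
  proof -
    have "tri k ` ?B \<union> tri k ` ?C \<union> tri_cells ?G' = tri_cells ?G"
    proof (rule region_eqI)
      fix j c
      show "tri j c \<in> tri k ` ?B \<union> tri k ` ?C \<union> tri_cells ?G' \<longleftrightarrow> tri j c \<in> tri_cells ?G"
      proof (cases "j = k")
        case True
        have "c \<in> ?B \<or> c \<in> ?C \<longleftrightarrow> c0 \<le> c \<and> c \<le> c0 + 2 * int n"
        proof (cases "even (c - c0)")
          case True
          then show ?thesis by (auto simp: base_cells_def)
        next
          case False
          then have "c \<noteq> c0" "c \<noteq> c0 + 2 * int n" by auto
          with False show ?thesis by (auto simp: base_cells_def)
        qed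
        with True show ?thesis by (simp add: tri_in_image)
      next
        case False
        then show ?thesis by (auto simp: tri_in_image)
      qed
    qed auto
    then show ?thesis by blast
  qed
  finally show ?case .
qed

text \<open>Along the zigzag a run of \<open>n\<close> dents at the left end forces the same lozenges in two rows and
  leaves \<open>n - 1\<close> dents.\<close>

lemma remove_half_triangle:
  assumes "vertical_unit w"
  shows "finite R \<Longrightarrow> even k \<Longrightarrow> (\<And>j. tri j 0 \<notin> R) \<Longrightarrow>
    tri_cells (\<lambda>j c. k \<le> j \<and> 1 \<le> c \<and> c \<le> 2 * int n - 1 - (j - k)) \<subseteq> R \<Longrightarrow>
    tiling_sum w (R - tri k ` base_cells 1 n) =
    tiling_sum w (R - tri_cells (\<lambda>j c. k \<le> j \<and> 1 \<le> c \<and> c \<le> 2 * int n - 1 - (j - k)))"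
proof (induction n arbitrary: R k)
  case 0
  have "base_cells 1 0 = {}" by (auto simp: base_cells_def)
  moreover have "tri_cells (\<lambda>j c. k \<le> j \<and> 1 \<le> c \<and> c \<le> 2 * int 0 - 1 - (j - k)) = {}"
    by (auto simp: tri_cells_def)
  ultimately show ?case by simp
next
  case (Suc n)
  let ?G = "\<lambda>j c. k \<le> j \<and> 1 \<le> c \<and> c \<le> 2 * int (Suc n) - 1 - (j - k)"
  let ?G' = "\<lambda>j c. k + 2 \<le> j \<and> 1 \<le> c \<and> c \<le> 2 * int n - 1 - (j - (k + 2))"
  let ?B = "base_cells 1 (Suc n)" and ?C = "base_cells 2 n" and ?E = "base_cells 1 n"
  have G: "tri j c \<in> R" if "?G j c" for j c using Suc.prems(4) that by (auto simp: tri_cells_def)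
  have fin: "finite (base_cells c0 m)" for c0 m
    by (rule finite_subset[of _ "{c0..c0 + 2 * int m}"]) (auto simp: base_cells_def)
  have w: "w {tri j c, tri (j + 1) c} = 1" if "1 \<le> c" for j c
    using assms that by (auto simp: vertical_unit_def)
  let ?R1 = "R - tri k ` ?B" and ?R2 = "R - tri k ` ?B - tri k ` ?C"
  have "tiling_sum w ?R1 = tiling_sum w (?R1 - tri k ` ?C - tri (k + 1) ` ?C)"
  proof (rule forced_up[OF fin])
    fix c assume c: "c \<in> ?C"
    have b: "2 \<le> c" "c \<le> 2 * int n" "even c" using c by (auto simp: base_cells_def)
    have "c \<notin> ?B" "c + 1 \<in> ?B" "c - 1 \<in> ?B" using b by (auto simp: base_cells_def)
    moreover have "tri k c \<in> R" "tri (k + 1) c \<in> R" using b by (auto intro!: G)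
    moreover have "even (c - k)" using b(3) Suc.prems(2) by auto
    ultimately show "even (c - k) \<and> tri k c \<in> ?R1 \<and> tri (k + 1) c \<in> ?R1 \<and>
        tri k (c + 1) \<notin> ?R1 \<and> tri k (c - 1) \<notin> ?R1 \<and> w {tri k c, tri (k + 1) c} = 1"
      using b(1) by (simp add: tri_in_image w)
  qed (use Suc.prems in simp)
  also have "\<dots> = tiling_sum w (?R2 - tri (k + 1) ` ?C - tri (k + 1) ` ?E - tri (k + 1 + 1) ` ?E)"
  proof (rule forced_up[OF fin])
    fix c assume c: "c \<in> ?E"
    have b: "1 \<le> c" "c \<le> 2 * int n - 1" "odd c" using c by (auto simp: base_cells_def)
    have "c \<notin> ?C" "c + 1 \<in> ?C" using b by (auto simp: base_cells_def)
    \<comment> \<open>The left neighbour of c = 1 would have axis 0, which the region does not meet;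
      the left neighbours of the other cells have just been removed.\<close>
    moreover have "c \<noteq> 2" using b(3) by auto
    then have "c - 1 \<in> ?C \<or> c - 1 = 0" using b by (auto simp: base_cells_def)
    moreover have "tri (k + 1) c \<in> R" "tri (k + 1 + 1) c \<in> R" using b by (auto intro!: G)
    moreover have "even (c - (k + 1))" using b(3) Suc.prems(2) by auto
    moreover have "w {tri (k + 1) c, tri (k + 1 + 1) c} = 1" by (rule w[OF b(1)])
    ultimately show "even (c - (k + 1)) \<and> tri (k + 1) c \<in> ?R2 - tri (k + 1) ` ?C \<and>
        tri (k + 1 + 1) c \<in> ?R2 - tri (k + 1) ` ?C \<and> tri (k + 1) (c + 1) \<notin> ?R2 - tri (k + 1) ` ?C \<and>
        tri (k + 1) (c - 1) \<notin> ?R2 - tri (k + 1) ` ?C \<and> w {tri (k + 1) c, tri (k + 1 + 1) c} = 1"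
      using Suc.prems(3) by (auto simp: tri_in_image)
  qed (use Suc.prems in simp)
  also have "k + 1 + 1 = k + 2" by simp
  also have "tiling_sum w (?R2 - tri (k + 1) ` ?C - tri (k + 1) ` ?E - tri (k + 2) ` ?E) =
      tiling_sum w (?R2 - tri (k + 1) ` ?C - tri (k + 1) ` ?E - tri_cells ?G')"
  proof (rule Suc.IH)
    show "tri_cells ?G' \<subseteq> ?R2 - tri (k + 1) ` ?C - tri (k + 1) ` ?E"
    proof
      fix t assume "t \<in> tri_cells ?G'"
      then obtain j c where "t = tri j c" "?G' j c" by (auto simp: tri_cells_def)
      then show "t \<in> ?R2 - tri (k + 1) ` ?C - tri (k + 1) ` ?E" using G[of j c] by (simp add: tri_in_image)
    qed
  qed (use Suc.prems in auto)
  also have "?R2 - tri (k + 1) ` ?C - tri (k + 1) ` ?E - tri_cells ?G' = R - tri_cells ?G"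
  proof -
    have "tri k ` ?B \<union> tri k ` ?C \<union> tri (k + 1) ` ?C \<union> tri (k + 1) ` ?E \<union> tri_cells ?G' = tri_cells ?G"
      (is "?L = _")
    proof (rule region_eqI)
      fix j c
      consider "j = k" | "j = k + 1" | "j \<noteq> k" "j \<noteq> k + 1" by blast
      then show "tri j c \<in> ?L \<longleftrightarrow> tri j c \<in> tri_cells ?G"
      proof cases
        case 1
        have "c \<in> ?B \<or> c \<in> ?C \<longleftrightarrow> 1 \<le> c \<and> c \<le> 2 * int n + 1"
        proof (cases "even c")
          case True
          then have "c \<noteq> 1" "c \<noteq> 2 * int n + 1" by auto
          with True show ?thesis by (auto simp: base_cells_def)
        qed (auto simp: base_cells_def)
        with 1 show ?thesis by (simp add: tri_in_image add.commute)
      next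
        case 2
        have "c \<in> ?C \<or> c \<in> ?E \<longleftrightarrow> 1 \<le> c \<and> c \<le> 2 * int n"
        proof (cases "even c")
          case True
          then have "c \<noteq> 1" by auto
          with True show ?thesis by (auto simp: base_cells_def)
        next
          case False
          then have "c \<noteq> 2 * int n" by auto
          with False show ?thesis by (auto simp: base_cells_def)
        qed
        with 2 show ?thesis by (simp add: tri_in_image add.commute)
      qed (auto simp: tri_in_image)
    qed auto
    then show ?thesis by blast
  qed
  finally show ?case .
qed

text \<open>The vertex conditions differ for the two orientations, but the parity of c - j excludes
  the boundary values where this would matter, so one pair of inequalities serves both. The later
  membership lemmas follow the same pattern.\<close>

lemma tri_in_big_up: "tri j c \<in> big_up s s' \<longleftrightarrow> 0 \<le> j \<and> 2 * s + j + 1 \<le> c \<and> c \<le> 2 * s' - j - 1"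
proof (cases "odd (c - j)")
  case True
  have "tri j c \<in> big_up s s' \<longleftrightarrow> 0 \<le> j \<and> 2 * s + j \<le> c - 1 \<and> c + 1 \<le> 2 * s' - j"
    unfolding big_up_def triangles_in_def mem_Collect_eq tri_up[OF True]
    using tri_up[OF True] unit_triangle_iff by auto
  then show ?thesis by auto
next
  case False
  then have e: "even (c - j)" by simp
  have "c \<noteq> 2 * s + j + 1" "c \<noteq> 2 * s' - j - 1" using e by auto
  moreover have "tri j c \<in> big_up s s' \<longleftrightarrow> 0 \<le> j \<and> 2 * s + j + 1 \<le> c - 1 \<and> c + 1 \<le> 2 * s' - j - 1"
    unfolding big_up_def triangles_in_def mem_Collect_eq tri_down[OF e]
    using tri_down[OF e] unit_triangle_iff by auto
  ultimately show ?thesis by auto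
qed

lemma has_cells_big_up [simp]: "has_cells (big_up s s')"
  by (simp add: big_up_def)

lemma remove_big_up:
  assumes "vertical_unit w" "finite R" "s \<le> s'" "big_up (int s) (int s') \<subseteq> R"
  shows "tiling_sum w (R - tri 0 ` ctr ` {s..<s'}) = tiling_sum w (R - big_up (int s) (int s'))"
proof -
  have base: "ctr ` {s..<s'} = base_cells (ctr s) (s' - s)"
  proof (rule equalityI; rule subsetI)
    fix c assume "c \<in> ctr ` {s..<s'}"
    then show "c \<in> base_cells (ctr s) (s' - s)" using assms(3) by (auto simp: ctr_def base_cells_def of_nat_diff)
  next
    fix c assume c: "c \<in> base_cells (ctr s) (s' - s)"
    then have "even (c - ctr s)" by (simp add: base_cells_def)
    then obtain i where "c - ctr s = 2 * i" by (rule evenE)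
    then have i: "c = ctr s + 2 * i" by simp
    then have "0 \<le> i" "i < int s' - int s" using c assms(3) by (auto simp: base_cells_def of_nat_diff)
    then show "c \<in> ctr ` {s..<s'}" using i by (intro image_eqI[of _ _ "s + nat i"]) (auto simp: ctr_def)
  qed
  let ?G = "\<lambda>j c. 0 \<le> j \<and> ctr s + (j - 0) \<le> c \<and> c \<le> ctr s + 2 * int (s' - s) - 2 - (j - 0)"
  have big: "big_up (int s) (int s') = tri_cells ?G"
    by (rule region_eqI) (use assms(3) in \<open>auto simp: tri_in_big_up ctr_def of_nat_diff\<close>)
  show ?thesis unfolding base big
    by (rule remove_triangle[OF assms(1,2)]) (use assms(4) big in \<open>auto simp: ctr_def\<close>)
qed

text \<open>Blocks that are disjoint on the base carry disjoint triangles, so the runs can be traded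
  one after the other.\<close>

lemma remove_big_ups:
  assumes w: "vertical_unit w"
  shows "finite I \<Longrightarrow> finite R \<Longrightarrow> (\<And>i. i \<in> I \<Longrightarrow> s i \<le> s' i \<and> big_up (int (s i)) (int (s' i)) \<subseteq> R) \<Longrightarrow>
    (\<And>i j. i \<in> I \<Longrightarrow> j \<in> I \<Longrightarrow> i \<noteq> j \<Longrightarrow> s' i \<le> s j \<or> s' j \<le> s i) \<Longrightarrow>
    tiling_sum w (R - tri 0 ` ctr ` (\<Union>i\<in>I. {s i..<s' i})) = tiling_sum w (R - (\<Union>i\<in>I. big_up (int (s i)) (int (s' i))))"
proof (induction I arbitrary: R rule: finite_induct)
  case (insert i I)
  let ?T = "\<lambda>i. big_up (int (s i)) (int (s' i))" and ?B = "\<lambda>i. tri 0 ` ctr ` {s i..<s' i}"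
  have disj: "?T j \<inter> ?T i = {}" if "j \<in> I" for j
  proof -
    have "j \<noteq> i" using that insert.hyps by auto
    then have "s' i \<le> s j \<or> s' j \<le> s i" using insert.prems(3)[of i j] that by auto
    then have "\<not> (tri k c \<in> ?T j \<and> tri k c \<in> ?T i)" for k c by (auto simp: tri_in_big_up)
    then show ?thesis using has_cells_big_up[of "int (s i)" "int (s' i)"] by (auto simp: has_cells_def)
  qed
  have BT: "?B j \<subseteq> ?T j" for j by (auto simp: tri_in_big_up ctr_def)
  have "R - tri 0 ` ctr ` (\<Union>i\<in>insert i I. {s i..<s' i}) = (R - (\<Union>j\<in>I. ?B j)) - ?B i" by auto
  also have "tiling_sum w \<dots> = tiling_sum w ((R - (\<Union>j\<in>I. ?B j)) - ?T i)"
  proof (rule remove_big_up[OF w])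
    show "?T i \<subseteq> R - (\<Union>j\<in>I. ?B j)" using insert.prems(2)[of i] disj BT by blast
  qed (use insert.prems in auto)
  also have "(R - (\<Union>j\<in>I. ?B j)) - ?T i = (R - ?T i) - tri 0 ` ctr ` (\<Union>i\<in>I. {s i..<s' i})" by auto
  also have "tiling_sum w \<dots> = tiling_sum w ((R - ?T i) - (\<Union>j\<in>I. ?T j))"
  proof (rule insert.IH)
    fix j assume "j \<in> I"
    then show "s j \<le> s' j \<and> ?T j \<subseteq> R - ?T i" using insert.prems(2)[of j] disj[of j] by auto
  qed (use insert.prems in auto)
  also have "(R - ?T i) - (\<Union>j\<in>I. ?T j) = R - (\<Union>j\<in>insert i I. ?T j)" by auto
  finally show ?case .
qed simp

section \<open>Dents of quartered hexagons\<close>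

lemma psum_0 [simp]: "psum t 0 = 0"
  by (simp add: psum_def)

lemma psum_Suc: "psum t (Suc k) = psum t k + entry t (Suc k)"
  by (simp add: psum_def)

lemma psum_mono: "i \<le> j \<Longrightarrow> psum t i \<le> psum t j"
  by (induction rule: dec_induct) (auto simp: psum_Suc)

lemma psum_take: "psum t k = sum_list (take k t)"
proof (induction k)
  case (Suc k)
  show ?case
  proof (cases "k < length t")
    case True
    then show ?thesis using Suc by (simp add: psum_Suc entry_def take_Suc_conv_app_nth)
  next
    case False
    then show ?thesis using Suc by (simp add: psum_Suc entry_def)
  qed
qed simp

lemma psum_le_sum_list: "psum t k \<le> sum_list t"
  unfolding psum_take by (metis append_take_drop_id le_add1 sum_list_append)

lemma psum_length: "length t \<le> k \<Longrightarrow> psum t k = sum_list t"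
  by (simp add: psum_take)

lemma sum_list_map_entry: "sum_list (map (entry a) [1..<Suc k]) = psum a k"
  by (induction k) (auto simp: psum_Suc)

lemma psum_block: "p < psum t k \<Longrightarrow> \<exists>i\<in>{1..k}. psum t (i - 1) \<le> p \<and> p < psum t i"
proof (induction k)
  case (Suc k)
  show ?case
  proof (cases "p < psum t k")
    case True
    then show ?thesis using Suc.IH by auto
  next
    case False
    then show ?thesis using Suc.prems by (intro bexI[of _ "Suc k"]) auto
  qed
qed simp

lemma entry_Cons: "entry (u # t) (Suc i) = (if i = 0 then u else entry t i)"
  by (auto simp: entry_def nth_Cons split: nat.splits)

lemma osum_Cons: "osum (u # t) = u + esum t"
proof -
  have "{i \<in> {1..length (u # t)}. odd i} = insert 1 (Suc ` {i \<in> {1..length t}. even i})"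
  proof (rule equalityI; rule subsetI)
    fix i assume i: "i \<in> {i \<in> {1..length (u # t)}. odd i}"
    then show "i \<in> insert 1 (Suc ` {i \<in> {1..length t}. even i})"
      by (cases i) (auto simp: image_iff elim: oddE)
  qed auto
  then have "osum (u # t) = (\<Sum>i\<in>insert 1 (Suc ` {i \<in> {1..length t}. even i}). entry (u # t) i)"
    by (simp add: osum_def)
  also have "\<dots> = u + (\<Sum>i\<in>{i \<in> {1..length t}. even i}. entry (u # t) (Suc i))"
    by (subst sum.insert) (auto simp: sum.reindex entry_def)
  also have "\<dots> = u + esum t"
    unfolding esum_def by (intro arg_cong2[where f = "(+)"] sum.cong) (auto simp: entry_Cons)
  finally show ?thesis .
qed

lemma esum_Cons: "esum (u # t) = osum t"
proof -
  have "{i \<in> {1..length (u # t)}. even i} = Suc ` {i \<in> {1..length t}. odd i}"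
  proof (rule equalityI; rule subsetI)
    fix i assume i: "i \<in> {i \<in> {1..length (u # t)}. even i}"
    then show "i \<in> Suc ` {i \<in> {1..length t}. odd i}"
      by (cases i) (auto simp: image_iff elim: oddE)
  qed auto
  then have "esum (u # t) = (\<Sum>i\<in>Suc ` {i \<in> {1..length t}. odd i}. entry (u # t) i)"
    by (simp add: esum_def)
  also have "\<dots> = (\<Sum>i\<in>{i \<in> {1..length t}. odd i}. entry (u # t) (Suc i))"
    by (subst sum.reindex) auto
  also have "\<dots> = osum t"
    unfolding osum_def by (intro sum.cong) (auto simp: entry_Cons)
  finally show ?thesis .
qed

lemma osum_Nil [simp]: "osum [] = 0" and esum_Nil [simp]: "esum [] = 0"
  by (simp_all add: osum_def esum_def)

lemma osum_esum_append:
  "osum (s @ t) = osum s + (if even (length s) then osum t else esum t)"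
  "esum (s @ t) = esum s + (if even (length s) then esum t else osum t)"
  by (induction s) (auto simp: osum_Cons esum_Cons)

lemma osum_esum_rev:
  "osum (rev t) = (if odd (length t) then osum t else esum t)"
  "esum (rev t) = (if odd (length t) then esum t else osum t)"
  by (induction t) (auto simp: osum_Cons esum_Cons osum_esum_append)

lemma osum_plus_esum: "osum t + esum t = sum_list t"
  by (induction t) (auto simp: osum_Cons esum_Cons)

lemma entry_map_entry: "1 \<le> i \<Longrightarrow> i \<le> k \<Longrightarrow> entry (map (entry a) [1..<Suc k]) i = entry a i"
  by (simp add: entry_def del: upt_Suc)

lemma esum_map_entry:
  assumes "k = 2 * (terms a div 2)"
  shows "esum (map (entry a) [1..<Suc k]) = esum a"
proof -
  have "esum (map (entry a) [1..<Suc k]) = (\<Sum>i\<in>{i \<in> {1..k}. even i}. entry a i)"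
    unfolding esum_def by (intro sum.cong) (auto simp: entry_map_entry[unfolded One_nat_def] simp del: upt_Suc)
  also have "{i \<in> {1..k}. even i} = {i \<in> {1..length a}. even i}"
    using assms by (auto simp: terms_def elim!: evenE split: if_splits)
  finally show ?thesis by (simp add: esum_def)
qed

text \<open>The list stops at an odd index, so at most an entry of even index is cut off. For empty
  \<open>a\<close> the single entry is the padding value 0.\<close>

lemma osum_map_entry:
  assumes "Suc k = 2 * ((terms a + 1) div 2)"
  shows "osum (map (entry a) [1..<Suc k]) = osum a"
proof -
  have "osum (map (entry a) [1..<Suc k]) = (\<Sum>i\<in>{i \<in> {1..k}. odd i}. entry a i)"
    unfolding osum_def by (intro sum.cong) (auto simp: entry_map_entry[unfolded One_nat_def] simp del: upt_Suc)
  also have "\<dots> = (\<Sum>i\<in>{i \<in> {1..length a}. odd i}. entry a i)"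
  proof (cases "a = []")
    case True
    then show ?thesis by (auto simp: entry_def intro!: sum.neutral)
  next
    case False
    then have "Suc k = 2 * ((length a + 1) div 2)" using assms by (simp add: terms_def)
    then have "i \<le> k \<longleftrightarrow> i \<le> length a" if "odd i" for i using that by presburger
    then have "{i \<in> {1..k}. odd i} = {i \<in> {1..length a}. odd i}" by auto
    then show ?thesis by simp
  qed
  finally show ?thesis by (simp add: osum_def)
qed

text \<open>Each removed triangle is replaced by a run of unit dents along its base, which forces
  the rest of the triangle.\<close>

definition dents :: "nat list \<Rightarrow> nat set" where
  "dents t = (\<Union>i\<in>{1..length t div 2}. {psum t (2 * i - 1)..<psum t (2 * i)})"

lemma dents_subset: "dents t \<subseteq> {..<sum_list t}"
proof
  fix p assume "p \<in> dents t"
  then obtain i where "p < psum t (2 * i)" by (auto simp: dents_def)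
  then show "p \<in> {..<sum_list t}" using psum_le_sum_list[of t "2 * i"] by simp
qed

lemma finite_dents: "finite (dents t)"
  by (simp add: dents_def)

lemma blocks_ordered: "i < j \<Longrightarrow> psum t (2 * i) \<le> psum t (2 * j - 1)"
  by (rule psum_mono) simp

lemma card_dents: "card (dents t) = esum t"
proof -
  have "card (dents t) = (\<Sum>i\<in>{1..length t div 2}. card {psum t (2 * i - 1)..<psum t (2 * i)})"
    unfolding dents_def
  proof (rule card_UN_disjoint)
    show "\<forall>i\<in>{1..length t div 2}. \<forall>j\<in>{1..length t div 2}. i \<noteq> j \<longrightarrow>
      {psum t (2 * i - 1)..<psum t (2 * i)} \<inter> {psum t (2 * j - 1)..<psum t (2 * j)} = {}"
    proof (intro ballI impI)
      fix i j :: nat assume "i \<noteq> j"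
      then show "{psum t (2 * i - 1)..<psum t (2 * i)} \<inter> {psum t (2 * j - 1)..<psum t (2 * j)} = {}"
        using blocks_ordered[of i j t] blocks_ordered[of j i t] by (cases i j rule: linorder_cases) auto
    qed
  qed auto
  also have "\<dots> = (\<Sum>i\<in>{1..length t div 2}. entry t (2 * i))"
  proof (rule sum.cong[OF refl])
    fix i assume "i \<in> {1..length t div 2}"
    then have "2 * i = Suc (2 * i - 1)" by auto
    then have "psum t (2 * i) = psum t (2 * i - 1) + entry t (2 * i)" by (metis psum_Suc)
    then show "card {psum t (2 * i - 1)..<psum t (2 * i)} = entry t (2 * i)" by simp
  qed
  also have "\<dots> = (\<Sum>i\<in>(\<lambda>i. 2 * i) ` {1..length t div 2}. entry t i)"
    by (subst sum.reindex) (auto simp: inj_on_def)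
  also have "(\<lambda>i. 2 * i) ` {1..length t div 2} = {i \<in> {1..length t}. even i}"
    by (auto simp: image_iff elim!: evenE)
  finally show ?thesis by (simp add: esum_def)
qed

lemma finite_region:
  assumes "has_cells R" "finite A" "finite B" "\<And>k c. tri k c \<in> R \<Longrightarrow> k \<in> A \<and> c \<in> B"
  shows "finite R"
proof (rule finite_subset)
  show "R \<subseteq> (\<lambda>(k, c). tri k c) ` (A \<times> B)"
  proof
    fix t assume t: "t \<in> R"
    then obtain k c where "t = tri k c" using assms(1) by (auto simp: has_cells_def)
    with t assms(4)[of k c] show "t \<in> (\<lambda>(k, c). tri k c) ` (A \<times> B)" by auto
  qed
qed (use assms in auto)

lemma tri_in_trapezoid_out:
  "tri j c \<in> zz_trapezoid zig_out (2 * N) h \<longleftrightarrow> 0 \<le> j \<and> j < h \<and> 0 \<le> c \<and> c \<le> 2 * N - j - 1"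
proof (cases "odd (c - j)")
  case True
  have "c \<noteq> 0 \<or> odd j" using True by auto
  moreover have "tri j c \<in> zz_trapezoid zig_out (2 * N) h \<longleftrightarrow> 0 \<le> j \<and> j + 1 \<le> h \<and>
      zig_out j \<le> c - 1 \<and> zig_out (j + 1) \<le> c \<and> c + 1 \<le> 2 * N - j"
    unfolding zz_trapezoid_def triangles_in_def mem_Collect_eq tri_up[OF True]
    using tri_up[OF True] unit_triangle_iff by auto
  ultimately show ?thesis by (cases "even j") (auto simp: zig_out_def)
next
  case False
  then have e: "even (c - j)" by simp
  have "c \<noteq> 0 \<or> even j" "c \<noteq> 2 * N - j - 1" using e by auto
  moreover have "tri j c \<in> zz_trapezoid zig_out (2 * N) h \<longleftrightarrow> 0 \<le> j \<and> j + 1 \<le> h \<and>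
      zig_out j \<le> c \<and> zig_out (j + 1) \<le> c - 1 \<and> c + 1 \<le> 2 * N - (j + 1)"
    unfolding zz_trapezoid_def triangles_in_def mem_Collect_eq tri_down[OF e]
    using tri_down[OF e] unit_triangle_iff by auto
  ultimately show ?thesis by (cases "even j") (auto simp: zig_out_def)
qed

lemma tri_in_trapezoid_in:
  "tri j c \<in> zz_trapezoid zig_in (2 * N) h \<longleftrightarrow> 0 \<le> j \<and> j < h \<and> 1 \<le> c \<and> c \<le> 2 * N - j - 1"
proof (cases "odd (c - j)")
  case True
  have "c \<noteq> 1 \<or> even j" using True by auto
  moreover have "tri j c \<in> zz_trapezoid zig_in (2 * N) h \<longleftrightarrow> 0 \<le> j \<and> j + 1 \<le> h \<and>
      zig_in j \<le> c - 1 \<and> zig_in (j + 1) \<le> c \<and> c + 1 \<le> 2 * N - j"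
    unfolding zz_trapezoid_def triangles_in_def mem_Collect_eq tri_up[OF True]
    using tri_up[OF True] unit_triangle_iff by auto
  ultimately show ?thesis by (cases "even j") (auto simp: zig_in_def)
next
  case False
  then have e: "even (c - j)" by simp
  have "c \<noteq> 1 \<or> odd j" "c \<noteq> 2 * N - j - 1" using e by auto
  moreover have "tri j c \<in> zz_trapezoid zig_in (2 * N) h \<longleftrightarrow> 0 \<le> j \<and> j + 1 \<le> h \<and>
      zig_in j \<le> c \<and> zig_in (j + 1) \<le> c - 1 \<and> c + 1 \<le> 2 * N - (j + 1)"
    unfolding zz_trapezoid_def triangles_in_def mem_Collect_eq tri_down[OF e]
    using tri_down[OF e] unit_triangle_iff by auto
  ultimately show ?thesis by (cases "even j") (auto simp: zig_in_def)
qed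

lemma has_cells_trapezoid [simp]: "has_cells (zz_trapezoid zg R h)"
  by (simp add: zz_trapezoid_def)

lemma finite_trapezoid: "finite (zz_trapezoid zig_out (2 * N) h)" "finite (zz_trapezoid zig_in (2 * N) h)"
  by (rule finite_region[of _ "{0..h}" "{0..2 * N}"]; auto simp: tri_in_trapezoid_out tri_in_trapezoid_in)+

lemma vertical_unit_zigzag_weight: "vertical_unit (zigzag_weight h)"
  by (auto simp: vertical_unit_def zigzag_weight_vertical)

lemma vertical_unit_one: "vertical_unit (\<lambda>_. 1)"
  by (simp add: vertical_unit_def)

lemma tri_in_quartered_dents:
  "tri j c \<in> quartered_dents t \<longleftrightarrow> 0 \<le> j \<and> (\<exists>i\<in>{1..length t div 2}.
     2 * int (psum t (2 * i - 1)) + j + 1 \<le> c \<and> c \<le> 2 * int (psum t (2 * i)) - j - 1)"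
  by (auto simp: quartered_dents_def tri_in_big_up)

lemma has_cells_quartered_dents [simp]: "has_cells (quartered_dents t)"
  by (simp add: quartered_dents_def)

lemma remove_quartered_dents:
  assumes "vertical_unit w" "finite R" "quartered_dents t \<subseteq> R"
  shows "tiling_sum w (R - tri 0 ` ctr ` dents t) = tiling_sum w (R - quartered_dents t)"
  unfolding dents_def quartered_dents_def
proof (rule remove_big_ups[OF assms(1) _ assms(2)])
  fix i assume i: "i \<in> {1..length t div 2}"
  have "big_up (int (psum t (2 * i - 1))) (int (psum t (2 * i))) \<subseteq> R"
    using assms(3) i unfolding quartered_dents_def by blast
  then show "psum t (2 * i - 1) \<le> psum t (2 * i) \<and> big_up (int (psum t (2 * i - 1))) (int (psum t (2 * i))) \<subseteq> R"
    by (simp add: psum_mono)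
next
  fix i j :: nat assume "i \<noteq> j"
  then show "psum t (2 * i) \<le> psum t (2 * j - 1) \<or> psum t (2 * j) \<le> psum t (2 * i - 1)"
    using blocks_ordered[of i j t] blocks_ordered[of j i t] by (cases i j rule: linorder_cases) auto
qed simp

text \<open>A triangle is no taller than its side, and its side is at most the number of all unit
  dents. This is why the triangles fit below half the height.\<close>

lemma quartered_dents_bounds:
  assumes "tri j c \<in> quartered_dents t"
  shows "0 \<le> j" "j < int (esum t)" "1 \<le> c" "c \<le> 2 * int (sum_list t) - j - 1"
proof -
  obtain i where i: "0 \<le> j" "i \<in> {1..length t div 2}" "2 * int (psum t (2 * i - 1)) + j + 1 \<le> c"
    "c \<le> 2 * int (psum t (2 * i)) - j - 1"
    using assms by (auto simp: tri_in_quartered_dents)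
  show "0 \<le> j" "1 \<le> c" using i by auto
  show "c \<le> 2 * int (sum_list t) - j - 1" using i psum_le_sum_list[of t "2 * i"] by linarith
  have "{psum t (2 * i - 1)..<psum t (2 * i)} \<subseteq> dents t" using i(2) by (auto simp: dents_def)
  then have "psum t (2 * i) - psum t (2 * i - 1) \<le> esum t"
    using card_mono[OF finite_dents, of "{psum t (2 * i - 1)..<psum t (2 * i)}" t] by (simp add: card_dents)
  then show "j < int (esum t)" using i by linarith
qed

text \<open>Trading the triangles for unit dents gives \<open>esum t\<close> dents, exactly the
  count for which the trapezoid formula does not vanish. That formula requires positive height, so
  the empty region is treated apart.\<close>

lemma Q'_eq: "Q' t = Q_prod (dents t)"
proof -
  let ?Z = "zz_trapezoid zig_out (2 * int (sum_list t)) (2 * int (esum t))"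
  let ?w = "zigzag_weight (2 * int (esum t))"
  have reg: "Q_region t = ?Z - quartered_dents t"
    unfolding Q_region_def zz_trapezoid_def osum_plus_esum ..
  show ?thesis
  proof (cases "esum t = 0")
    case True
    have "?Z = {}"
    proof (rule region_eqI)
      show "has_cells {}" by (simp add: has_cells_def)
    qed (auto simp: True tri_in_trapezoid_out)
    moreover have "dents t = {}" using True card_dents[of t] finite_dents[of t] by simp
    ultimately show ?thesis unfolding Q'_def reg by (simp add: tiling_sum_empty Q_prod_def vdm_def)
  next
    case False
    have "quartered_dents t \<subseteq> ?Z"
    proof
      fix u assume u: "u \<in> quartered_dents t"
      then obtain j c where "u = tri j c" using has_cells_quartered_dents unfolding has_cells_def by blast
      with u quartered_dents_bounds[of j c t] show "u \<in> ?Z" by (auto simp: tri_in_trapezoid_out)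
    qed
    then have "Q' t = tiling_sum ?w (?Z - tri 0 ` ctr ` dents t)"
      unfolding Q'_def reg
      by (rule remove_quartered_dents[OF vertical_unit_zigzag_weight finite_trapezoid(1), symmetric])
    also have "\<dots> = Q_prod (dents t)"
      using Q_trapezoid_tiling_sum[OF dents_subset[of t], of "esum t"] False osum_plus_esum[of t]
      by (simp add: card_dents)
    finally show ?thesis .
  qed
qed

lemma K_eq: "K t = K_prod (dents t)"
proof (cases "esum t = 0")
  case True
  then have "dents t = {}" using card_dents[of t] finite_dents[of t] by simp
  \<comment> \<open>The default value 1 of \<open>K\<close> agrees with the empty products.\<close>
  then show ?thesis using True by (simp add: K_def K_prod_def vdm_def)
next
  case False
  let ?Z = "zz_trapezoid zig_in (2 * int (sum_list t)) (2 * int (esum t) - 1)"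
  have reg: "K_region t = ?Z - quartered_dents t"
    unfolding K_region_def zz_trapezoid_def osum_plus_esum ..
  have "quartered_dents t \<subseteq> ?Z"
  proof
    fix u assume u: "u \<in> quartered_dents t"
    then obtain j c where "u = tri j c" using has_cells_quartered_dents unfolding has_cells_def by blast
    with u quartered_dents_bounds[of j c t] show "u \<in> ?Z" by (auto simp: tri_in_trapezoid_in)
  qed
  have "K t = tiling_sum (\<lambda>_. 1) (?Z - quartered_dents t)"
    using False by (simp add: K_def tiling_sum_def reg)
  also have "\<dots> = tiling_sum (\<lambda>_. 1) (?Z - tri 0 ` ctr ` dents t)"
    by (rule remove_quartered_dents[OF vertical_unit_one finite_trapezoid(2), symmetric]) fact
  also have "\<dots> = K_prod (dents t)"
    using K_trapezoid_tiling_sum[OF dents_subset[of t], of "esum t"] False osum_plus_esum[of t]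
    by (simp add: card_dents)
  finally show ?thesis .
qed

text \<open>Requiring s < s' discards zero entries, so entries that merely pad a sequence create no
  block.\<close>

definition is_block :: "nat list \<Rightarrow> nat \<Rightarrow> nat \<Rightarrow> bool" where
  "is_block t s s' \<longleftrightarrow> s < s' \<and> (\<exists>i\<in>{1..length t div 2}. s = psum t (2 * i - 1) \<and> s' = psum t (2 * i))"

lemma in_dents_iff: "p \<in> dents t \<longleftrightarrow> (\<exists>s s'. is_block t s s' \<and> s \<le> p \<and> p < s')"
proof
  assume "p \<in> dents t"
  then obtain i where "i \<in> {1..length t div 2}" "psum t (2 * i - 1) \<le> p" "p < psum t (2 * i)"
    by (auto simp: dents_def)
  then show "\<exists>s s'. is_block t s s' \<and> s \<le> p \<and> p < s'"
    unfolding is_block_def by (intro exI[of _ "psum t (2 * i - 1)"] exI[of _ "psum t (2 * i)"]) auto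
next
  assume "\<exists>s s'. is_block t s s' \<and> s \<le> p \<and> p < s'"
  then show "p \<in> dents t" by (auto simp: dents_def is_block_def)
qed

lemma tri_in_quartered_dents_block:
  "tri j c \<in> quartered_dents t \<longleftrightarrow> 0 \<le> j \<and> (\<exists>s s'. is_block t s s' \<and> 2 * int s + j + 1 \<le> c \<and> c \<le> 2 * int s' - j - 1)"
  unfolding tri_in_quartered_dents is_block_def
proof (intro conj_cong refl iffI)
  assume j: "0 \<le> j" and "\<exists>i\<in>{1..length t div 2}. 2 * int (psum t (2 * i - 1)) + j + 1 \<le> c \<and> c \<le> 2 * int (psum t (2 * i)) - j - 1"
  then obtain i where i: "i \<in> {1..length t div 2}" "2 * int (psum t (2 * i - 1)) + j + 1 \<le> c" "c \<le> 2 * int (psum t (2 * i)) - j - 1"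
    by blast
  moreover have "psum t (2 * i - 1) < psum t (2 * i)" using i j by linarith
  ultimately show "\<exists>s s'. (s < s' \<and> (\<exists>i\<in>{1..length t div 2}. s = psum t (2 * i - 1) \<and> s' = psum t (2 * i))) \<and>
      2 * int s + j + 1 \<le> c \<and> c \<le> 2 * int s' - j - 1" by blast
qed blast

section \<open>The sequences t^+ and t^-\<close>

definition joined :: "nat list \<Rightarrow> nat \<Rightarrow> nat \<Rightarrow> nat list \<Rightarrow> nat \<Rightarrow> nat list" where
  "joined a p q b r = map (entry a) [1..<Suc p] @ [q] @ rev (map (entry b) [1..<Suc r])"

lemma length_joined: "length (joined a p q b r) = p + r + 1"
  by (simp add: joined_def)

lemma psum_joined_left: "k \<le> p \<Longrightarrow> psum (joined a p q b r) k = psum a k"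
  by (simp add: psum_take joined_def take_map take_upt del: upt_Suc)
    (simp add: sum_list_map_entry[unfolded One_nat_def] psum_take[symmetric] del: upt_Suc)

lemma sum_list_joined: "sum_list (joined a p q b r) = psum a p + q + psum b r"
  unfolding joined_def sum_list_append sum_list_rev sum_list_map_entry by simp

text \<open>The dents of \<open>b\<close> are placed from the east end, so partial sums in the
  reversed part are measured from there. The additive form avoids truncated subtraction.\<close>

lemma psum_joined_right:
  assumes "j \<le> r"
  shows "psum (joined a p q b r) (p + 1 + (r - j)) + psum b j = sum_list (joined a p q b r)"
proof -
  let ?t = "joined a p q b r"
  have "drop (p + 1 + (r - j)) ?t = rev (map (entry b) [1..<Suc j])"
    using assms by (simp add: joined_def Suc_diff_le drop_rev take_map take_upt del: upt_Suc)
  moreover have "sum_list ?t = sum_list (take (p + 1 + (r - j)) ?t) + sum_list (drop (p + 1 + (r - j)) ?t)"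
    by (metis append_take_drop_id sum_list_append)
  ultimately show ?thesis unfolding psum_take[of ?t] sum_list_map_entry[of b j, symmetric]
    by (simp only: sum_list_rev)
qed

text \<open>p and r are the indices \<mu>' and \<nu>, with floor and ceiling rewritten by
  \<open>div\<close>. The parameter u is the length x + y of the window.\<close>

definition plus_seq :: "nat \<Rightarrow> nat list \<Rightarrow> nat list \<Rightarrow> nat list" where
  "plus_seq u a b = (let p = 2 * (terms a div 2); r = 2 * ((terms b + 1) div 2) in
     joined a p (entry a (p + 1) + u + entry b r) b (r - 1))"

text \<open>p and r are \<mu> and \<nu>'. The leading 0 shifts all indices by one, so that the
  entries of \<open>a\<close> with odd index become dents; z closes the sequence as the triangle at
  the east end.\<close>

definition minus_seq :: "nat \<Rightarrow> nat \<Rightarrow> nat list \<Rightarrow> nat list \<Rightarrow> nat list" where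
  "minus_seq u z a b = (let p = 2 * ((terms a + 1) div 2); r = 2 * (terms b div 2) in
     0 # joined a (p - 1) (entry a p + u + entry b (r + 1)) b r @ [z])"

lemma length_le_terms: "length a \<le> terms a" "1 \<le> terms a"
  by (auto simp: terms_def Suc_le_eq)

lemma sum_list_plus_seq: "sum_list (plus_seq u a b) = u + sum_list a + sum_list b"
proof -
  define p r where "p = 2 * (terms a div 2)" and "r = 2 * ((terms b + 1) div 2)"
  have "length a \<le> Suc p" "length b \<le> r" "r = Suc (r - 1)"
    using length_le_terms[of a] length_le_terms[of b] unfolding p_def r_def by linarith+
  then have "psum a (Suc p) = sum_list a" "psum b r = sum_list b"
    by (simp_all only: psum_length)
  moreover have "psum b r = psum b (r - 1) + entry b r"
    using psum_Suc[of b "r - 1"] \<open>r = Suc (r - 1)\<close> by simp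
  moreover note psum_Suc[of a p]
  ultimately show ?thesis
    unfolding plus_seq_def Let_def p_def[symmetric] r_def[symmetric] sum_list_joined
    by simp
qed

lemma esum_plus_seq: "esum (plus_seq u a b) = esum a + osum b"
proof -
  define p r where "p = 2 * (terms a div 2)" and "r = 2 * ((terms b + 1) div 2)"
  have r: "Suc (r - 1) = r" using length_le_terms[of b] unfolding r_def by linarith
  have "odd (r - 1)" unfolding r_def using length_le_terms[of b] by presburger
  then have "osum (rev (map (entry b) [1..<Suc (r - 1)])) = osum b"
    using osum_map_entry[of "r - 1" b] r unfolding r_def[symmetric] by (simp add: osum_esum_rev del: upt_Suc)
  moreover have "esum (map (entry a) [1..<Suc p]) = esum a"
    by (rule esum_map_entry) (simp add: p_def)
  moreover have "even p" by (simp add: p_def)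
  ultimately show ?thesis
    unfolding plus_seq_def Let_def p_def[symmetric] r_def[symmetric] joined_def
    by (simp add: osum_esum_append esum_Cons del: upt_Suc)
qed

lemma esum_minus_seq: "esum (minus_seq u z a b) = osum a + esum b + z"
proof -
  define p r where "p = 2 * ((terms a + 1) div 2)" and "r = 2 * (terms b div 2)"
  have p: "Suc (p - 1) = p" using length_le_terms[of a] unfolding p_def by linarith
  have "odd (p - 1)" unfolding p_def using length_le_terms[of a] by presburger
  moreover have "osum (map (entry a) [1..<Suc (p - 1)]) = osum a"
    by (rule osum_map_entry) (use p in \<open>simp add: p_def\<close>)
  moreover have "osum (rev (map (entry b) [1..<Suc r])) = esum b"
    using esum_map_entry[of r b] unfolding r_def[symmetric] by (simp add: osum_esum_rev r_def del: upt_Suc)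
  moreover have "even r" by (simp add: r_def)
  ultimately show ?thesis
    unfolding minus_seq_def Let_def p_def[symmetric] r_def[symmetric] joined_def
    by (simp add: osum_esum_append esum_Cons osum_Cons del: upt_Suc)
qed

text \<open>Dents are the entries of even index. Since p is even and r odd, these are the a_i with i
  even and, counted from the east, the b_j with j odd; the merged middle entry has the odd index p +
  1 and is never a dent.\<close>

lemma is_block_plus_seq:
  assumes L: "L = u + sum_list a + sum_list b"
  shows "is_block (plus_seq u a b) s s' \<longleftrightarrow> s < s' \<and>
    ((\<exists>i\<in>{2..length a}. even i \<and> s = psum a (i - 1) \<and> s' = psum a i) \<or>
     (\<exists>j\<in>{1..length b}. odd j \<and> s + psum b j = L \<and> s' + psum b (j - 1) = L))"
proof -
  define p r where "p = 2 * (terms a div 2)" and "r = 2 * ((terms b + 1) div 2) - 1"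
  have pr: "even p" "odd r" "p \<le> terms a" "terms a \<le> p + 1" "r \<le> terms b" "terms b \<le> r + 1" "1 \<le> r"
    using length_le_terms[of b] unfolding p_def r_def by presburger+
  define t where "t = plus_seq u a b"
  obtain q where t: "t = joined a p q b r"
    unfolding t_def plus_seq_def Let_def p_def r_def by blast
  have tL: "sum_list t = L" unfolding t_def L by (rule sum_list_plus_seq)
  have len: "length t = p + r + 1" unfolding t by (rule length_joined)
  have left: "psum t k = psum a k" if "k \<le> p" for k unfolding t using that by (rule psum_joined_left)
  have right: "psum t (p + 1 + (r - j)) + psum b j = L" if "j \<le> r" for j
    using psum_joined_right[OF that, of a p q b] unfolding t[symmetric] tL .
  have "(\<exists>i\<in>{1..length t div 2}. s = psum t (2 * i - 1) \<and> s' = psum t (2 * i)) \<longleftrightarrow>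
    (\<exists>i\<in>{2..length a}. even i \<and> s = psum a (i - 1) \<and> s' = psum a i) \<or>
     (\<exists>j\<in>{1..length b}. odd j \<and> s + psum b j = L \<and> s' + psum b (j - 1) = L)" (is "?L \<longleftrightarrow> ?R1 \<or> ?R2")
    if ss: "s < s'"
  proof
    assume ?L
    then obtain i where i0: "i \<in> {1..length t div 2}" and i1: "s = psum t (2 * i - 1)" "s' = psum t (2 * i)"
      by blast
    have "2 * i \<le> 2 * (length t div 2)" "1 \<le> i" using i0 by auto
    then have i: "1 \<le> i" "2 * i \<le> p + r + 1" "s = psum t (2 * i - 1)" "s' = psum t (2 * i)"
      using i1 len by linarith+
    show "?R1 \<or> ?R2"
    proof (cases "2 * i \<le> p")
      case True
      then have "a \<noteq> []" using i(1) p_def by (auto simp: terms_def)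
      then have "2 * i \<le> length a" using True pr by (simp add: terms_def)
      then have ?R1 using i left[of "2 * i"] left[of "2 * i - 1"] True by (intro bexI[of _ "2 * i"]) auto
      then show ?thesis ..
    next
      case False
      then have "p + 2 \<le> 2 * i" using pr(1) by presburger
      \<comment> \<open>The sequence has p + r + 1 entries, so its entry 2i is the b_j with this
        j.\<close>
      define j where "j = p + r + 2 - 2 * i"
      have j: "1 \<le> j" "j \<le> r" "odd j" "2 * i - 1 = p + 1 + (r - j)" "2 * i = p + 1 + (r - (j - 1))"
        using \<open>p + 2 \<le> 2 * i\<close> i(2) pr unfolding j_def by auto
      have s: "s + psum b j = L" "s' + psum b (j - 1) = L"
        using right[of j] right[of "j - 1"] j i(3,4) by auto
      \<comment> \<open>r can exceed the length only for empty \<open>b\<close>, whose single term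
        is 0; such a block would be empty, against s < s'.\<close>
      have "j \<le> length b"
      proof (rule ccontr)
        assume "\<not> j \<le> length b"
        then have "b = []" "j = 1" using j pr by (auto simp: terms_def split: if_splits)
        then have "psum b j = psum b (j - 1)" using psum_Suc[of b 0] by (simp add: entry_def)
        then show False using s ss by simp
      qed
      then have ?R2 using s j by (intro bexI[of _ j]) auto
      then show ?thesis ..
    qed
  next
    assume "?R1 \<or> ?R2"
    then show ?L
    proof
      assume ?R1
      then obtain i where i: "2 \<le> i" "i \<le> length a" "even i" "s = psum a (i - 1)" "s' = psum a i" by auto
      obtain k where k: "i = 2 * k" using i(3) by (rule evenE)
      have "i \<le> p" using i length_le_terms(1)[of a] pr by presburger
      then show ?L using i k left[of i] left[of "i - 1"] by (intro bexI[of _ k]) (auto simp: len)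
    next
      assume ?R2
      then obtain j where j: "1 \<le> j" "j \<le> length b" "odd j" "s + psum b j = L" "s' + psum b (j - 1) = L" by auto
      have jr: "j \<le> r" using j length_le_terms(1)[of b] pr by presburger
      have "even (p + r + 2 - j)" using j(3) pr jr by auto
      then obtain i where i: "p + r + 2 - j = 2 * i" by (rule evenE)
      have i': "2 * i - 1 = p + 1 + (r - j)" "2 * i = p + 1 + (r - (j - 1))" "1 \<le> i" "2 * i \<le> p + r + 1"
        using i j(1) jr by auto
      have "j - 1 \<le> r" using jr by simp
      have "s = psum t (2 * i - 1)" unfolding i'(1) using right[OF jr] j(4) by linarith
      moreover have "s' = psum t (2 * i)" unfolding i'(2) using right[OF \<open>j - 1 \<le> r\<close>] j(5) by linarith
      moreover have "i \<in> {1..length t div 2}" using i'(3,4) unfolding len by simp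
      ultimately show ?L by blast
    qed
  qed
  then show ?thesis unfolding is_block_def t_def[symmetric] by blast
qed

lemma psum_Cons_joined:
  "psum (0 # t @ [z]) (Suc k) = (if k \<le> length t then psum t k else sum_list t + z)"
  by (auto simp: psum_take)

lemma sum_list_minus_seq: "sum_list (minus_seq u z a b) = u + sum_list a + sum_list b + z"
proof -
  define p r where "p = 2 * ((terms a + 1) div 2)" and "r = 2 * (terms b div 2)"
  have "length a \<le> p" "length b \<le> Suc r" "p = Suc (p - 1)"
    using length_le_terms[of a] length_le_terms[of b] unfolding p_def r_def by linarith+
  then have "psum a p = sum_list a" "psum b (Suc r) = sum_list b"
    by (simp_all only: psum_length)
  moreover have "psum a p = psum a (p - 1) + entry a p"
    using psum_Suc[of a "p - 1"] \<open>p = Suc (p - 1)\<close> by simp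
  moreover note psum_Suc[of b r]
  ultimately show ?thesis
    unfolding minus_seq_def Let_def p_def[symmetric] r_def[symmetric]
    by (simp add: sum_list_joined)
qed

text \<open>Now p is odd and r even, and the leading 0 shifts the indices: the entries of even index
  are the a_i with i odd, the b_j with j even, and the final z.\<close>

lemma is_block_minus_seq:
  assumes L: "L = u + sum_list a + sum_list b"
  shows "is_block (minus_seq u z a b) s s' \<longleftrightarrow> s < s' \<and>
    ((\<exists>i\<in>{1..length a}. odd i \<and> s = psum a (i - 1) \<and> s' = psum a i) \<or>
     (\<exists>j\<in>{1..length b}. even j \<and> s + psum b j = L \<and> s' + psum b (j - 1) = L) \<or>
     s = L \<and> s' = L + z)"
proof -
  define p r where "p = 2 * ((terms a + 1) div 2) - 1" and "r = 2 * (terms b div 2)"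
  have pr: "odd p" "even r" "p \<le> terms a" "terms a \<le> p + 1" "r \<le> terms b" "terms b \<le> r + 1" "1 \<le> p"
    using length_le_terms[of a] unfolding p_def r_def by presburger+
  define t where "t = minus_seq u z a b"
  obtain q where "t = 0 # joined a p q b r @ [z]"
    unfolding t_def minus_seq_def Let_def p_def r_def by blast
  moreover define t' where "t' = joined a p q b r"
  ultimately have t: "t = 0 # t' @ [z]" by simp
  have "sum_list t = L + z" unfolding t_def L by (rule sum_list_minus_seq)
  then have tL: "sum_list t' = L" unfolding t by simp
  have len': "length t' = p + r + 1" unfolding t'_def by (rule length_joined)
  have len: "length t = p + r + 3" by (simp add: t len')
  have left: "psum t (Suc k) = psum a k" if "k \<le> p" for k
    using psum_joined_left[OF that, of a q b r] that unfolding t psum_Cons_joined t'_def[symmetric] len' by simp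
  have right: "psum t (Suc (p + 1 + (r - j))) + psum b j = L" if "j \<le> r" for j
    using psum_joined_right[OF that, of a p q b] unfolding t psum_Cons_joined t'_def[symmetric] len' tL by simp
  have last: "psum t (p + r + 3) = L + z"
    using psum_Cons_joined[of t' z "p + r + 2"] unfolding t[symmetric] len' tL by (simp add: eval_nat_numeral)
  have lastL: "psum t (p + r + 2) = L"
    using right[of 0] by simp
  have "(\<exists>i\<in>{1..length t div 2}. s = psum t (2 * i - 1) \<and> s' = psum t (2 * i)) \<longleftrightarrow>
    (\<exists>i\<in>{1..length a}. odd i \<and> s = psum a (i - 1) \<and> s' = psum a i) \<or>
     (\<exists>j\<in>{1..length b}. even j \<and> s + psum b j = L \<and> s' + psum b (j - 1) = L) \<or>
     s = L \<and> s' = L + z" (is "?L \<longleftrightarrow> ?R1 \<or> ?R2 \<or> ?R3")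
    if ss: "s < s'"
  proof
    assume ?L
    then obtain i where i0: "i \<in> {1..length t div 2}" and i1: "s = psum t (2 * i - 1)" "s' = psum t (2 * i)"
      by blast
    have "2 * i \<le> 2 * (length t div 2)" "1 \<le> i" using i0 by auto
    then have i: "1 \<le> i" "2 * i \<le> p + r + 3" "s = psum t (2 * i - 1)" "s' = psum t (2 * i)"
      using i1 len by linarith+
    \<comment> \<open>In the shifted sequence the entries of \<open>a\<close> end at index p + 1,
      the merged entry has the odd index p + 2, the entries of \<open>b\<close> follow up to p + r +
      2, and z has index p + r + 3.\<close>
    have "2 * i \<le> p + 1 \<or> p + 3 \<le> 2 * i \<and> 2 * i \<le> p + r + 1 \<or> 2 * i = p + r + 3"
      using i(2) pr(1,2) by presburger
    then
    consider "2 * i \<le> p + 1" | "p + 3 \<le> 2 * i" "2 * i \<le> p + r + 1" | "2 * i = p + r + 3"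
      by blast
    then show "?R1 \<or> ?R2 \<or> ?R3"
    proof cases
      case 1
      have e: "2 * i - 1 = Suc (2 * i - 2)" "2 * i = Suc (2 * i - 1)" using i(1) by auto
      have s: "s = psum a (2 * i - 2)" "s' = psum a (2 * i - 1)"
        using left[of "2 * i - 2"] left[of "2 * i - 1"] e i 1 by auto
      have "2 * i - 1 \<le> length a"
      proof (rule ccontr)
        assume "\<not> 2 * i - 1 \<le> length a"
        then have "a = []" "i = 1" using 1 i(1) pr by (auto simp: terms_def split: if_splits)
        then show False using s ss psum_Suc[of a 0] by (simp add: entry_def)
      qed
      then have "2 * i - 1 \<in> {1..length a}" using i(1) by simp
      moreover have "odd (2 * i - 1)" using i(1) by simp
      moreover have "2 * i - 1 - 1 = 2 * i - 2" by simp
      ultimately have ?R1 using s by (intro bexI[of _ "2 * i - 1"]) (simp_all only: simp_thms)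
      then show ?thesis ..
    next
      case 2
      define j where "j = p + r + 3 - 2 * i"
      have j: "2 \<le> j" "j \<le> r" "even j" "2 * i - 1 = Suc (p + 1 + (r - j))" "2 * i = Suc (p + 1 + (r - (j - 1)))"
        using 2 pr unfolding j_def by auto
      have s: "s + psum b j = L" "s' + psum b (j - 1) = L"
        using right[of j] right[of "j - 1"] j i(3,4) by auto
      have "j \<le> length b" using j pr by (auto simp: terms_def split: if_splits)
      then have ?R2 using s j by (intro bexI[of _ j]) auto
      then show ?thesis by blast
    next
      case 3
      then have "2 * i - 1 = p + r + 2" by simp
      then have ?R3 using i(3,4) 3 last lastL by simp
      then show ?thesis by blast
    qed
  next
    assume "?R1 \<or> ?R2 \<or> ?R3"
    then show ?L
    proof (elim disjE)
      assume ?R1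
      then obtain i where i: "1 \<le> i" "i \<le> length a" "odd i" "s = psum a (i - 1)" "s' = psum a i" by auto
      obtain k where k: "i = 2 * k + 1" using i(3) by (rule oddE)
      have "i \<le> p" using i length_le_terms(1)[of a] pr by presburger
      then show ?L using i k left[of i] left[of "i - 1"] by (intro bexI[of _ "Suc k"]) (auto simp: len)
    next
      assume ?R2
      then obtain j where j: "1 \<le> j" "j \<le> length b" "even j" "s + psum b j = L" "s' + psum b (j - 1) = L" by auto
      have jr: "j \<le> r" using j length_le_terms(1)[of b] pr by presburger
      have "even (p + r + 3 - j)" using j(3) pr jr by auto
      then obtain i where i: "p + r + 3 - j = 2 * i" by (rule evenE)
      have i': "2 * i - 1 = Suc (p + 1 + (r - j))" "2 * i = Suc (p + 1 + (r - (j - 1)))" "1 \<le> i" "2 * i \<le> p + r + 3"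
        using i j(1) jr by auto
      have "j - 1 \<le> r" using jr by simp
      have "s = psum t (2 * i - 1)" unfolding i'(1) using right[OF jr] j(4) by linarith
      moreover have "s' = psum t (2 * i)" unfolding i'(2) using right[OF \<open>j - 1 \<le> r\<close>] j(5) by linarith
      moreover have "i \<in> {1..length t div 2}" using i'(3,4) unfolding len by simp
      ultimately show ?L by blast
    next
      assume ?R3
      have "even (p + r + 3)" using pr by auto
      then obtain i where i: "p + r + 3 = 2 * i" by (rule evenE)
      then have "2 * i - 1 = p + r + 2" by simp
      then show ?L using i last lastL \<open>?R3\<close> by (intro bexI[of _ i]) (auto simp: len)
    qed
  qed
  then show ?thesis unfolding is_block_def t_def[symmetric] by blast
qed

section \<open>The region cut along the line\<close>

lemma tri_in_big_down: "tri j c \<in> big_down s s' \<longleftrightarrow> tri (- j - 1) c \<in> big_up s s'"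
proof (cases "odd (c - j)")
  case True
  have "c \<noteq> 2 * s - j" "c \<noteq> 2 * s' + j" using True by auto
  moreover have "tri j c \<in> big_down s s' \<longleftrightarrow> j + 1 \<le> 0 \<and> 2 * s - j \<le> c - 1 \<and> c + 1 \<le> 2 * s' + j"
    unfolding big_down_def triangles_in_def mem_Collect_eq tri_up[OF True]
    using tri_up[OF True] unit_triangle_iff by auto
  ultimately show ?thesis unfolding tri_in_big_up by auto
next
  case False
  then have e: "even (c - j)" by simp
  have "tri j c \<in> big_down s s' \<longleftrightarrow> j + 1 \<le> 0 \<and> 2 * s - (j + 1) \<le> c - 1 \<and> c + 1 \<le> 2 * s' + (j + 1)"
    unfolding big_down_def triangles_in_def mem_Collect_eq tri_down[OF e]
    using tri_down[OF e] unit_triangle_iff by auto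
  then show ?thesis unfolding tri_in_big_up by auto
qed

lemma tri_in_NR_half_dent:
  assumes "j < 0"
  shows "tri j c \<in> NR_half_dent a \<longleftrightarrow> c \<le> 2 * int (entry a 1) + j"
proof (cases "odd (c - j)")
  case True
  have "c \<noteq> 2 * int (entry a 1) + j" using True by auto
  moreover have "tri j c \<in> NR_half_dent a \<longleftrightarrow> j + 1 \<le> 0 \<and> c + 1 \<le> 2 * int (entry a 1) + j"
    unfolding NR_half_dent_def triangles_in_def mem_Collect_eq tri_up[OF True]
    using tri_up[OF True] unit_triangle_iff by auto
  ultimately show ?thesis using assms by auto
next
  case False
  then have e: "even (c - j)" by simp
  have "tri j c \<in> NR_half_dent a \<longleftrightarrow> j + 1 \<le> 0 \<and> c + 1 \<le> 2 * int (entry a 1) + (j + 1)"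
    unfolding NR_half_dent_def triangles_in_def mem_Collect_eq tri_down[OF e]
    using tri_down[OF e] unit_triangle_iff by auto
  then show ?thesis using assms by auto
qed

text \<open>The east border first moves outwards for z rows and then inwards. Extending the inward
  line back to the cutting line gives a trapezoid over L + z, from which the second condition cuts
  off a triangle of side z.\<close>

lemma tri_in_NR_lower:
  fixes x y z :: nat and a b :: "nat list"
  defines "L \<equiv> NR_L x y a b" and "B \<equiv> NR_B y z a b"
  shows "tri j c \<in> NR_lower x y z a b \<longleftrightarrow> tri (- j - 1) c \<in> zz_trapezoid zig_in (2 * (L + int z)) B \<and> c \<le> 2 * L - j - 1"
proof -
  define i where "i = - j - 1"
  have j: "j = - i - 1" by (simp add: i_def)
  have low: "NR_lower x y z a b = triangles_in (\<lambda>p k. 0 \<le> - k \<and> - k \<le> B \<and> zig_in (- k) \<le> p \<and>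
      p \<le> (if - k \<le> int z then 2 * L - k else 2 * (L + int z) + k))"
    unfolding NR_lower_def L_def B_def Let_def by simp
  show ?thesis
  proof (cases "odd (c - j)")
    case True
    have p: "c \<noteq> 1 \<or> odd i" "c \<noteq> 2 * (L + int z) - i - 1" using True unfolding j by auto
    have "tri j c \<in> NR_lower x y z a b \<longleftrightarrow> 0 \<le> i \<and> i + 1 \<le> B \<and> zig_in (i + 1) \<le> c - 1 \<and> zig_in i \<le> c \<and>
        c + 1 \<le> (if i + 1 \<le> int z then 2 * L + (i + 1) else 2 * (L + int z) - (i + 1)) \<and>
        c \<le> (if i \<le> int z then 2 * L + i else 2 * (L + int z) - i)"
      unfolding low triangles_in_def mem_Collect_eq tri_up[OF True]
      using tri_up[OF True] unit_triangle_iff[of "tri j c"] by (auto simp: j add.commute)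
    then show ?thesis unfolding tri_in_trapezoid_in i_def[symmetric] using p
      by (cases "even i"; cases "i + 1 \<le> int z"; cases "i \<le> int z") (auto simp: zig_in_def j)
  next
    case False
    then have e: "even (c - j)" by simp
    have p: "c \<noteq> 1 \<or> even i" "c \<noteq> 2 * L + i" using False unfolding j by auto
    have "tri j c \<in> NR_lower x y z a b \<longleftrightarrow> 0 \<le> i \<and> i + 1 \<le> B \<and> zig_in i \<le> c - 1 \<and> zig_in (i + 1) \<le> c \<and>
        c + 1 \<le> (if i \<le> int z then 2 * L + i else 2 * (L + int z) - i) \<and>
        c \<le> (if i + 1 \<le> int z then 2 * L + (i + 1) else 2 * (L + int z) - (i + 1))"
      unfolding low triangles_in_def mem_Collect_eq tri_down[OF e]
      using tri_down[OF e] unit_triangle_iff[of "tri j c"] by (auto simp: j add.commute)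
    then show ?thesis unfolding tri_in_trapezoid_in i_def[symmetric] using p
      by (cases "even i"; cases "i + 1 \<le> int z"; cases "i \<le> int z") (auto simp: zig_in_def j)
  qed
qed

text \<open>Reflection in the cutting line; it brings the lower part into the position of a
  trapezoid above its base.\<close>

definition flip :: "triangle \<Rightarrow> triangle" where
  "flip t = (\<lambda>(p, k). (p, - k)) ` t"

lemma flip_flip: "flip (flip t) = t"
  by (force simp: flip_def image_iff)

lemma flip_tri: "flip (tri k c) = tri (- k - 1) c"
proof (cases "odd (c - k)")
  case True
  then have "even (c - (- k - 1))" by auto
  then show ?thesis by (auto simp: flip_def tri_up[OF True] tri_down)
next
  case False
  then have e: "even (c - k)" "odd (c - (- k - 1))" by auto
  show ?thesis by (auto simp: flip_def tri_down[OF e(1)] tri_up[OF e(2)])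
qed

lemma flip_lozenge: "is_lozenge l \<Longrightarrow> is_lozenge (flip ` l)"
proof (erule lozenge_cases)
  fix k c assume "l = {tri k c, tri k (c + 1)}"
  then show "is_lozenge (flip ` l)" using lozenge_strip[of "- k - 1" c] by (simp add: flip_tri)
next
  fix k c :: int assume *: "even (c - k)" "l = {tri k c, tri (k + 1) c}"
  have "is_lozenge {tri (- (k + 1) - 1) c, tri (- (k + 1) - 1 + 1) c}"
    by (rule lozenge_vertical) (use * in auto)
  moreover have "- (k + 1) - 1 + 1 = - k - 1" by simp
  moreover have "flip ` l = {tri (- (k + 1) - 1) c, tri (- k - 1) c}"
    using * by (simp only: image_insert image_empty flip_tri insert_commute)
  ultimately show "is_lozenge (flip ` l)" by (simp only:)
qed

lemma tiling_sum_flip: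
  assumes "has_cells R" "has_cells R'" "\<And>k c. tri k c \<in> R' \<longleftrightarrow> tri (- k - 1) c \<in> R"
  shows "tiling_sum (\<lambda>_. 1) R = tiling_sum (\<lambda>_. 1) R'"
proof -
  have "R' = flip ` R"
  proof (rule region_eqI[OF assms(2)])
    show "has_cells (flip ` R)" using assms(1) flip_tri by (fastforce simp: has_cells_def)
    fix k c
    have "tri k c \<in> flip ` R \<longleftrightarrow> flip (tri k c) \<in> R" using flip_flip by (metis image_iff)
    then show "tri k c \<in> R' \<longleftrightarrow> tri k c \<in> flip ` R" by (simp add: assms(3) flip_tri)
  qed
  then show ?thesis using tiling_sum_involution[OF flip_flip flip_lozenge, of "\<lambda>_. 1" R] by simp
qed

lemma zigzag_weight_below:
  assumes "l \<subseteq> R" "\<And>k c. tri k c \<in> R \<Longrightarrow> k < 0"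
  shows "zigzag_weight h l = 1"
proof -
  have "l \<noteq> {tri k 0, tri (k - 1) 0}" if "0 < k" for k
    using assms(1) assms(2)[of k 0] that by auto
  then show ?thesis by (auto simp: zigzag_weight_tri)
qed

lemma tri_in_a_dents:
  "tri j c \<in> NR_a_dents a \<longleftrightarrow> (\<exists>i\<in>{2..length a}.
     tri (if even i then j else - j - 1) c \<in> big_up (int (psum a (i - 1))) (int (psum a i)))"
  by (auto simp: NR_a_dents_def tri_in_big_down)

lemma tri_in_b_dents:
  "tri j c \<in> NR_b_dents x y a b \<longleftrightarrow> (\<exists>i\<in>{1..length b}.
     tri (if odd i then j else - j - 1) c \<in> big_up (NR_L x y a b - int (psum b i)) (NR_L x y a b - int (psum b (i - 1))))"
  by (auto simp: NR_b_dents_def tri_in_big_down)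

lemma int_interval_less: "2 * u + j + 1 \<le> c \<Longrightarrow> c \<le> 2 * v - j - 1 \<Longrightarrow> 0 \<le> j \<Longrightarrow> u < (v :: int)"
  by linarith

locale NR_region =
  fixes x y z :: nat and a b :: "nat list"
begin

definition "L = x + y + sum_list a + sum_list b"
definition "tp = plus_seq (x + y) a b"
definition "tm = minus_seq (x + y) z a b"
text \<open>The window: the base positions that no dent touches from either side.\<close>

definition "W = {sum_list a..<sum_list a + (x + y)}"
text \<open>\<open>hp\<close> and \<open>hm\<close> are the numbers of unit dents required by the
  heights of the upper and the lower part.\<close>

definition "hp = y + esum a + osum b"
definition "hm = y + z + osum a + esum b"

lemma NR_params: "NR_L x y a b = int L" "NR_A y a b = 2 * int hp" "NR_B y z a b = 2 * int hm - 1"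
  by (simp_all add: NR_L_def NR_A_def NR_B_def L_def hp_def hm_def)

lemma psum_b_le: "psum b i \<le> L"
  using psum_le_sum_list[of b i] by (simp add: L_def)

lemma block_plus: "is_block tp s s' \<longleftrightarrow> s < s' \<and>
    ((\<exists>i\<in>{2..length a}. even i \<and> s = psum a (i - 1) \<and> s' = psum a i) \<or>
     (\<exists>j\<in>{1..length b}. odd j \<and> s = L - psum b j \<and> s' = L - psum b (j - 1)))"
proof -
  have "s + psum b i = L \<longleftrightarrow> s = L - psum b i" for s i using psum_b_le[of i] by auto
  then show ?thesis unfolding tp_def by (subst is_block_plus_seq[of L]) (auto simp: L_def)
qed

lemma block_minus: "is_block tm s s' \<longleftrightarrow> s < s' \<and>
    ((\<exists>i\<in>{1..length a}. odd i \<and> s = psum a (i - 1) \<and> s' = psum a i) \<or>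
     (\<exists>j\<in>{1..length b}. even j \<and> s = L - psum b j \<and> s' = L - psum b (j - 1)) \<or>
     s = L \<and> s' = L + z)"
proof -
  have "s + psum b i = L \<longleftrightarrow> s = L - psum b i" for s i using psum_b_le[of i] by auto
  then show ?thesis unfolding tm_def by (subst is_block_minus_seq[of L]) (auto simp: L_def)
qed

lemma seq_facts: "sum_list tp = L" "esum tp = esum a + osum b"
    "sum_list tm = L + z" "esum tm = osum a + esum b + z"
  by (simp_all add: tp_def tm_def L_def sum_list_plus_seq esum_plus_seq sum_list_minus_seq esum_minus_seq)

lemma dents_avoid_window: "dents tp \<inter> W = {}" "dents tm \<inter> W = {}"
proof -
  have 1: "psum a i \<le> sum_list a" "L - psum b i \<ge> sum_list a + (x + y)" for i
    using psum_le_sum_list[of a i] psum_le_sum_list[of b i] by (simp_all add: L_def)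
  have "s' \<le> sum_list a \<or> sum_list a + (x + y) \<le> s" if "is_block tp s s'" for s s'
    using that 1 unfolding block_plus by auto
  then show "dents tp \<inter> W = {}" by (force simp: in_dents_iff W_def)
  have "s' \<le> sum_list a \<or> sum_list a + (x + y) \<le> s" if "is_block tm s s'" for s s'
    using that 1 unfolding block_minus by (auto simp: L_def)
  then show "dents tm \<inter> W = {}" by (force simp: in_dents_iff W_def)
qed

text \<open>Left of the window a position lies in the interval of some a_i, right of it in that of
  some b_j or of z; the parity of the index decides on which side of the line the dent lies.\<close>

lemma dents_cover: "{..<L + z} \<subseteq> dents tp \<union> dents tm \<union> W"
proof
  fix p assume p: "p \<in> {..<L + z}"
  consider "p < sum_list a" | "p \<in> W" | "sum_list a + (x + y) \<le> p" "p < L" | "L \<le> p"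
    by (force simp: W_def)
  then show "p \<in> dents tp \<union> dents tm \<union> W"
  proof cases
    case 1
    then have "p < psum a (length a)" by (simp add: psum_length)
    then obtain i where i: "i \<in> {1..length a}" "psum a (i - 1) \<le> p" "p < psum a i"
      using psum_block by blast
    then have lt: "psum a (i - 1) < psum a i" by simp
    show ?thesis
    proof (cases "even i")
      case True
      then have "i \<in> {2..length a}" using i(1) by (auto elim!: evenE)
      then have "is_block tp (psum a (i - 1)) (psum a i)" using True lt unfolding block_plus by blast
      then show ?thesis using i unfolding Un_iff in_dents_iff by blast
    next
      case False
      then have "is_block tm (psum a (i - 1)) (psum a i)" using lt i(1) unfolding block_minus by blast
      then show ?thesis using i unfolding Un_iff in_dents_iff by blast
    qed
  next
    case 3
    \<comment> \<open>The position counted from the east end, where the intervals of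
      \<open>b\<close> begin.\<close>
    define q where "q = L - 1 - p"
    have "q < psum b (length b)" using 3 by (simp add: psum_length q_def L_def)
    then obtain i where i: "i \<in> {1..length b}" "psum b (i - 1) \<le> q" "q < psum b i"
      using psum_block by blast
    have lt: "L - psum b i \<le> p" "p < L - psum b (i - 1)" "L - psum b i < L - psum b (i - 1)"
      using i(2,3) 3(2) psum_b_le[of i] unfolding q_def by linarith+
    show ?thesis
    proof (cases "odd i")
      case True
      then have "is_block tp (L - psum b i) (L - psum b (i - 1))" using lt(3) i(1) unfolding block_plus by blast
      then show ?thesis using lt unfolding Un_iff in_dents_iff by blast
    next
      case False
      then have "is_block tm (L - psum b i) (L - psum b (i - 1))" using lt(3) i(1) unfolding block_minus by blast
      then show ?thesis using lt unfolding Un_iff in_dents_iff by blast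
    qed
  next
    case 4
    then have "is_block tm L (L + z)" using p unfolding block_minus by simp
    then show ?thesis using 4 p unfolding Un_iff in_dents_iff by auto
  qed simp
qed

text \<open>Disjointness is obtained by counting: the two sets cover the complement of the window,
  and their sizes add up to the size of that complement.\<close>

lemma dents_partition:
  "dents tp \<union> dents tm = {..<sum_list a} \<union> {sum_list a + (x + y)..<L + z}" "dents tp \<inter> dents tm = {}"
proof -
  have sub: "dents tp \<subseteq> {..<L + z}" "dents tm \<subseteq> {..<L + z}"
    using dents_subset[of tp] dents_subset[of tm] by (auto simp: seq_facts)
  have eq: "dents tp \<union> dents tm = {..<L + z} - W" using sub dents_cover dents_avoid_window by blast
  show "dents tp \<union> dents tm = {..<sum_list a} \<union> {sum_list a + (x + y)..<L + z}"
    unfolding eq by (auto simp: W_def L_def)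
  have "W \<subseteq> {..<L + z}" by (auto simp: W_def L_def)
  then have "card (dents tp \<union> dents tm) = L + z - (x + y)"
    unfolding eq by (simp add: card_Diff_subset W_def)
  moreover have "card (dents tp) + card (dents tm) = L + z - (x + y)"
    using osum_plus_esum[of a] osum_plus_esum[of b] by (simp add: card_dents seq_facts L_def)
  ultimately have "card (dents tp \<inter> dents tm) = 0"
    using card_Un_Int[OF finite_dents finite_dents, of tp tm] by simp
  then show "dents tp \<inter> dents tm = {}" by (simp add: finite_dents)
qed

lemma tri_in_NR3_upper:
  assumes "0 \<le> j"
  shows "tri j c \<in> NR3 x y z a b \<longleftrightarrow> tri j c \<in> zz_trapezoid zig_out (2 * int L) (2 * int hp) - quartered_dents tp"
proof -
  have up: "tri j c \<in> NR_upper x y a b \<longleftrightarrow> tri j c \<in> zz_trapezoid zig_out (2 * int L) (2 * int hp)"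
    by (simp add: NR_upper_def zz_trapezoid_def NR_params)
  have low: "tri j c \<notin> NR_lower x y z a b" using assms unfolding tri_in_NR_lower tri_in_trapezoid_in by auto
  have "tri j c \<in> NR_a_dents a \<or> tri j c \<in> NR_b_dents x y a b \<longleftrightarrow> tri j c \<in> quartered_dents tp"
  proof
    assume "tri j c \<in> NR_a_dents a \<or> tri j c \<in> NR_b_dents x y a b"
    then show "tri j c \<in> quartered_dents tp"
    proof
      assume "tri j c \<in> NR_a_dents a"
      then obtain i where i: "i \<in> {2..length a}" "even i" "2 * int (psum a (i - 1)) + j + 1 \<le> c" "c \<le> 2 * int (psum a i) - j - 1"
        using assms by (auto simp: tri_in_a_dents tri_in_big_up split: if_splits)
      then have "is_block tp (psum a (i - 1)) (psum a i)" using assms unfolding block_plus by auto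
      then show ?thesis using i assms unfolding tri_in_quartered_dents_block by blast
    next
      assume "tri j c \<in> NR_b_dents x y a b"
      then obtain i where i: "i \<in> {1..length b}" "odd i" "2 * (int L - int (psum b i)) + j + 1 \<le> c" "c \<le> 2 * (int L - int (psum b (i - 1))) - j - 1"
        using assms by (auto simp: tri_in_b_dents tri_in_big_up NR_params split: if_splits)
      have e: "int (L - psum b i) = int L - int (psum b i)" "int (L - psum b (i - 1)) = int L - int (psum b (i - 1))"
        using psum_b_le by (simp_all add: of_nat_diff)
      have "int (L - psum b i) < int (L - psum b (i - 1))"
        unfolding e by (rule int_interval_less[OF i(3,4) assms])
      then have "is_block tp (L - psum b i) (L - psum b (i - 1))" using i(1,2) unfolding block_plus by auto
      then show ?thesis using i assms e unfolding tri_in_quartered_dents_block by metis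
    qed
  next
    assume "tri j c \<in> quartered_dents tp"
    then obtain s s' where s: "is_block tp s s'" "2 * int s + j + 1 \<le> c" "c \<le> 2 * int s' - j - 1"
      unfolding tri_in_quartered_dents_block by blast
    from s(1) consider i where "i \<in> {2..length a}" "even i" "s = psum a (i - 1)" "s' = psum a i"
      | i where "i \<in> {1..length b}" "odd i" "s = L - psum b i" "s' = L - psum b (i - 1)"
      unfolding block_plus by blast
    then show "tri j c \<in> NR_a_dents a \<or> tri j c \<in> NR_b_dents x y a b"
    proof cases
      case 1
      then have "tri j c \<in> NR_a_dents a"
        unfolding tri_in_a_dents using s assms by (intro bexI[of _ i]) (auto simp: tri_in_big_up)
      then show ?thesis ..
    next
      case 2
      have e: "int (L - psum b i) = int L - int (psum b i)" "int (L - psum b (i - 1)) = int L - int (psum b (i - 1))"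
        using psum_b_le by (simp_all add: of_nat_diff)
      have "tri j c \<in> NR_b_dents x y a b"
        unfolding tri_in_b_dents NR_params e[symmetric] using s assms 2
        by (intro bexI[of _ i]) (auto simp: tri_in_big_up e[symmetric])
      then show ?thesis ..
    qed
  qed
  with up low show ?thesis unfolding NR3_def by blast
qed

text \<open>The half dent after reflection, restricted to the axes c \<ge> 1 inside the zigzag and
  written in the form in which \<open>remove_half_triangle\<close> yields it.\<close>

definition half_cells :: region where
  "half_cells = tri_cells (\<lambda>j c. 0 \<le> j \<and> 1 \<le> c \<and> c \<le> 2 * int (entry a 1) - 1 - (j - 0))"

text \<open>Here i is the depth of the row. Two differences in bookkeeping are matched: the block of
  a_1 is not an ordinary dent but lies inside the half dent, and the block of z is not removed from
  the region but lies beyond its border.\<close>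

lemma tri_in_NR3_lower:
  assumes "0 \<le> i"
  shows "tri (- i - 1) c \<in> NR3 x y z a b \<longleftrightarrow>
    tri i c \<in> zz_trapezoid zig_in (2 * int (L + z)) (2 * int hm - 1) - half_cells - quartered_dents tm"
proof -
  let ?j = "- i - 1"
  have i: "- ?j - 1 = i" by simp
  have up: "tri ?j c \<notin> NR_upper x y a b"
  proof -
    have "NR_upper x y a b = zz_trapezoid zig_out (2 * int L) (2 * int hp)"
      by (simp add: NR_upper_def zz_trapezoid_def NR_params)
    then show ?thesis using assms by (simp add: tri_in_trapezoid_out)
  qed
  let ?Z = "tri i c \<in> zz_trapezoid zig_in (2 * int (L + z)) (2 * int hm - 1)"
  have low: "tri ?j c \<in> NR_lower x y z a b \<longleftrightarrow> ?Z \<and> c \<le> 2 * int L + i"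
    unfolding tri_in_NR_lower NR_params i by (simp add: algebra_simps)
  have half: "tri ?j c \<in> NR_half_dent a \<longleftrightarrow> c \<le> 2 * int (entry a 1) - i - 1"
    using assms by (subst tri_in_NR_half_dent) auto
  have hc: "tri i c \<in> half_cells \<longleftrightarrow> 1 \<le> c \<and> c \<le> 2 * int (entry a 1) - i - 1"
    using assms by (auto simp: half_cells_def)
  have Z1: "1 \<le> c" "c \<le> 2 * int (L + z) - i - 1" if ?Z using that unfolding tri_in_trapezoid_in by auto
  have e: "int (L - psum b k) = int L - int (psum b k)" for k
    using psum_b_le[of k] by (simp add: of_nat_diff)
  have a1: "psum a 0 = 0" "psum a 1 = entry a 1" using psum_Suc[of a 0] by simp_all
  have "(c \<le> 2 * int L + i \<and> \<not> c \<le> 2 * int (entry a 1) - i - 1 \<and>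
      tri ?j c \<notin> NR_a_dents a \<and> tri ?j c \<notin> NR_b_dents x y a b) \<longleftrightarrow>
    (\<not> c \<le> 2 * int (entry a 1) - i - 1 \<and> tri i c \<notin> quartered_dents tm)" if Z: ?Z
  proof (cases "c \<le> 2 * int (entry a 1) - i - 1")
    case False
    have "\<not> c \<le> 2 * int L + i \<or> tri ?j c \<in> NR_a_dents a \<or> tri ?j c \<in> NR_b_dents x y a b \<longleftrightarrow> tri i c \<in> quartered_dents tm"
    proof
      assume "\<not> c \<le> 2 * int L + i \<or> tri ?j c \<in> NR_a_dents a \<or> tri ?j c \<in> NR_b_dents x y a b"
      then show "tri i c \<in> quartered_dents tm"
      proof (elim disjE)
        assume c: "\<not> c \<le> 2 * int L + i"
        then have "0 < z" using Z1[OF Z] assms by auto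
        then have "is_block tm L (L + z)" unfolding block_minus by simp
        moreover have "2 * int L + i + 1 \<le> c" using c by simp
        ultimately show ?thesis using Z1(2)[OF Z] assms unfolding tri_in_quartered_dents_block by blast
      next
        assume "tri ?j c \<in> NR_a_dents a"
        then obtain k where k: "k \<in> {2..length a}" "odd k" "2 * int (psum a (k - 1)) + i + 1 \<le> c" "c \<le> 2 * int (psum a k) - i - 1"
          using assms by (auto simp: tri_in_a_dents tri_in_big_up split: if_splits)
        then have "k \<in> {1..length a}" "psum a (k - 1) < psum a k" using assms by auto
        then have "is_block tm (psum a (k - 1)) (psum a k)" using k(2) unfolding block_minus by blast
        then show ?thesis using k assms unfolding tri_in_quartered_dents_block by blast
      next
        assume "tri ?j c \<in> NR_b_dents x y a b"
        then obtain k where k: "k \<in> {1..length b}" "even k" "2 * (int L - int (psum b k)) + i + 1 \<le> c" "c \<le> 2 * (int L - int (psum b (k - 1))) - i - 1"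
          using assms by (auto simp: tri_in_b_dents tri_in_big_up NR_params split: if_splits)
        have "int (L - psum b k) < int (L - psum b (k - 1))"
          unfolding e by (rule int_interval_less[OF k(3,4) assms])
        then have "is_block tm (L - psum b k) (L - psum b (k - 1))" using k(1,2) unfolding block_minus by auto
        then show ?thesis using k assms e unfolding tri_in_quartered_dents_block by metis
      qed
    next
      assume "tri i c \<in> quartered_dents tm"
      then obtain s s' where s: "is_block tm s s'" "2 * int s + i + 1 \<le> c" "c \<le> 2 * int s' - i - 1"
        unfolding tri_in_quartered_dents_block by blast
      from s(1) consider k where "k \<in> {1..length a}" "odd k" "s = psum a (k - 1)" "s' = psum a k"
        | k where "k \<in> {1..length b}" "even k" "s = L - psum b k" "s' = L - psum b (k - 1)"
        | "s = L" "s' = L + z"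
        unfolding block_minus by blast
      then show "\<not> c \<le> 2 * int L + i \<or> tri ?j c \<in> NR_a_dents a \<or> tri ?j c \<in> NR_b_dents x y a b"
      proof cases
        case 1
        \<comment> \<open>Cells of the block of a_1 lie in the half dent, which this case
          excludes.\<close>
        have "k \<noteq> 1" using False s(3) 1(4) a1 by auto
        then have "k \<in> {2..length a}" using 1(1) by auto
        then have "tri ?j c \<in> NR_a_dents a"
          unfolding tri_in_a_dents using s assms 1 by (intro bexI[of _ k]) (auto simp: tri_in_big_up)
        then show ?thesis by blast
      next
        case 2
        have "tri ?j c \<in> NR_b_dents x y a b"
          unfolding tri_in_b_dents NR_params e[symmetric] using s assms 2
          by (intro bexI[of _ k]) (auto simp: tri_in_big_up)
        then show ?thesis by blast
      next
        case 3
        then show ?thesis using s by auto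
      qed
    qed
    then show ?thesis using False by blast
  qed simp
  then show ?thesis using up low half hc Z1 unfolding NR3_def by blast
qed

end

lemma ctr_in_quartered_dents: "tri 0 (ctr p) \<in> quartered_dents t \<longleftrightarrow> p \<in> dents t"
  unfolding tri_in_quartered_dents_block in_dents_iff by (intro iffI; (elim conjE)?; elim exE; force simp: ctr_def)

lemma inj_ctr: "inj ctr"
  by (auto simp: inj_def ctr_def)

lemma entry_1_le_osum: "entry a 1 \<le> osum a"
  by (cases a) (auto simp: osum_Cons entry_def)

lemma minus_seq_start:
  "1 \<le> length (minus_seq u z a b) div 2" "psum (minus_seq u z a b) 1 = 0" "psum (minus_seq u z a b) 2 = entry a 1"
proof -
  define p where "p = 2 * ((terms a + 1) div 2)"
  have "2 \<le> p" using length_le_terms(2)[of a] unfolding p_def by presburger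
  then have "[1..<Suc (p - 1)] = 1 # [Suc 1..<Suc (p - 1)]"
    by (intro upt_conv_Cons) simp
  then obtain us where us: "minus_seq u z a b = 0 # entry a 1 # us"
    unfolding minus_seq_def Let_def p_def[symmetric] joined_def by simp
  show "1 \<le> length (minus_seq u z a b) div 2" "psum (minus_seq u z a b) 1 = 0" "psum (minus_seq u z a b) 2 = entry a 1"
    unfolding us by (simp_all add: psum_take)
qed

context NR_region
begin

definition upper_part :: region where
  "upper_part = zz_trapezoid zig_out (2 * int L) (2 * int hp) - quartered_dents tp"

definition lower_part :: region where
  "lower_part = tri_cells (\<lambda>j c. j < 0 \<and> tri j c \<in> NR3 x y z a b)"

lemma NR3_split: "NR3 x y z a b = upper_part \<union> lower_part"
proof (rule region_eqI)
  show "has_cells (NR3 x y z a b)" unfolding NR3_def NR_upper_def NR_lower_def by simp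
  show "has_cells (upper_part \<union> lower_part)" by (simp add: upper_part_def lower_part_def)
  fix j c
  show "tri j c \<in> NR3 x y z a b \<longleftrightarrow> tri j c \<in> upper_part \<union> lower_part"
  proof (cases "0 \<le> j")
    case True
    then show ?thesis unfolding tri_in_NR3_upper[OF True] by (auto simp: upper_part_def lower_part_def)
  next
    case False
    then have "tri j c \<notin> upper_part" unfolding upper_part_def Diff_iff tri_in_trapezoid_out by simp
    then show ?thesis using False by (simp add: lower_part_def)
  qed
qed

lemma tri_in_lower_part:
  "tri (- i - 1) c \<in> lower_part \<longleftrightarrow> 0 \<le> i \<and>
    tri i c \<in> zz_trapezoid zig_in (2 * int (L + z)) (2 * int hm - 1) - half_cells - quartered_dents tm"
  using tri_in_NR3_lower[of i c] by (auto simp: lower_part_def)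

lemma params_le: "hp \<le> L" "hm \<le> L + z"
  using osum_plus_esum[of a] osum_plus_esum[of b] by (simp_all add: hp_def hm_def L_def)

lemma window_subset: "W \<subseteq> {..<L}"
  by (auto simp: W_def L_def)

text \<open>A crossing lozenge counts as one more unit dent. The height requires hp = y +
  \<open>esum tp\<close> dents, hence the condition on the size of S. The second hypothesis concerns
  height 0, where the part is empty.\<close>

lemma upper_part_sum:
  assumes S: "S \<subseteq> W" "S = {} \<or> 1 \<le> hp"
  shows "tiling_sum (zigzag_weight (2 * int hp)) (upper_part - tri 0 ` ctr ` S) =
    (if card S = y then Q_prod (S \<union> dents tp) else 0)"
proof (cases "hp = 0")
  case True
  have "upper_part = {}"
  proof (rule region_eqI)
    show "has_cells {}" by (simp add: has_cells_def)
    show "tri k c \<in> upper_part \<longleftrightarrow> tri k c \<in> {}" for k c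
      unfolding upper_part_def Diff_iff tri_in_trapezoid_out using True by simp
  qed (simp add: upper_part_def)
  moreover have "y = 0" "esum tp = 0" using True unfolding seq_facts hp_def by simp_all
  moreover have "dents tp = {}" using \<open>esum tp = 0\<close> finite_dents[of tp] card_dents[of tp] by simp
  moreover have "S = {}" using S(2) True by simp
  ultimately show ?thesis by (simp add: tiling_sum_empty Q_prod_def vdm_def)
next
  case False
  let ?Z = "zz_trapezoid zig_out (2 * int L) (2 * int hp)"
  have disj: "S \<inter> dents tp = {}" using S(1) dents_avoid_window(1) by blast
  have "quartered_dents tp \<subseteq> ?Z - tri 0 ` ctr ` S"
  proof
    fix t assume t: "t \<in> quartered_dents tp"
    then obtain j c where jc: "t = tri j c" using has_cells_quartered_dents unfolding has_cells_def by blast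
    have "t \<in> ?Z" using quartered_dents_bounds[of j c tp] t False unfolding jc tri_in_trapezoid_out seq_facts
      by (simp add: hp_def)
    moreover have "t \<notin> tri 0 ` ctr ` S" using t disj by (auto simp: ctr_in_quartered_dents)
    ultimately show "t \<in> ?Z - tri 0 ` ctr ` S" by blast
  qed
  then have "tiling_sum (zigzag_weight (2 * int hp)) (?Z - tri 0 ` ctr ` S - quartered_dents tp) =
      tiling_sum (zigzag_weight (2 * int hp)) (?Z - tri 0 ` ctr ` S - tri 0 ` ctr ` dents tp)"
    by (intro remove_quartered_dents[symmetric] vertical_unit_zigzag_weight finite_Diff finite_trapezoid)
  also have "?Z - tri 0 ` ctr ` S - tri 0 ` ctr ` dents tp = ?Z - tri 0 ` ctr ` (S \<union> dents tp)" by blast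
  also have "tiling_sum (zigzag_weight (2 * int hp)) \<dots> = (if card (S \<union> dents tp) = hp then Q_prod (S \<union> dents tp) else 0)"
  proof (rule Q_trapezoid_tiling_sum)
    show "S \<union> dents tp \<subseteq> {..<L}" using S(1) window_subset dents_subset[of tp] by (auto simp: seq_facts)
  qed (use False params_le in auto)
  also have "card (S \<union> dents tp) = card S + (esum a + osum b)"
    using card_Un_disjoint[OF _ finite_dents disj] S(1) by (simp add: card_dents seq_facts W_def finite_subset)
  finally have "tiling_sum (zigzag_weight (2 * int hp)) (?Z - tri 0 ` ctr ` S - quartered_dents tp) =
      (if card S = y then Q_prod (S \<union> dents tp) else 0)" by (simp add: hp_def)
  moreover have "upper_part - tri 0 ` ctr ` S = ?Z - tri 0 ` ctr ` S - quartered_dents tp"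
    unfolding upper_part_def by blast
  ultimately show ?thesis by simp
qed

lemma base_cells_1: "base_cells 1 n = ctr ` {0..<n}"
proof (rule equalityI; rule subsetI)
  fix c assume c: "c \<in> base_cells 1 n"
  then have "even (c - 1)" by (simp add: base_cells_def)
  then obtain i where "c - 1 = 2 * i" by (rule evenE)
  then show "c \<in> ctr ` {0..<n}" using c
    by (intro image_eqI[of _ _ "nat i"]) (auto simp: ctr_def base_cells_def)
qed (auto simp: ctr_def base_cells_def)

text \<open>Everything is derived from the trapezoid whose unit dents are S and
  \<open>dents tm\<close>, to which the product formula applies; each run of dents is then traded
  for what it forces.\<close>

lemma lower_region_sum:
  assumes S: "S \<subseteq> W" "card S = y" and hm: "1 \<le> hm"
  shows "tiling_sum (\<lambda>_. 1) (zz_trapezoid zig_in (2 * int (L + z)) (2 * int hm - 1) - half_cells - quartered_dents tm - tri 0 ` ctr ` S) =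
    K_prod (S \<union> dents tm)"
proof -
  let ?Z = "zz_trapezoid zig_in (2 * int (L + z)) (2 * int hm - 1)"
  let ?s = "\<lambda>i. psum tm (2 * i - 1)" and ?s' = "\<lambda>i. psum tm (2 * i)"
  let ?I = "{2..length tm div 2}"
  \<comment> \<open>The first block, of length a_1, touches the zigzag and forces the half triangle.
    The remaining blocks, collected here, force ordinary triangles.\<close>
  define D'' where "D'' = (\<Union>i\<in>?I. {?s i..<?s' i})"
  define R1 where "R1 = ?Z - tri 0 ` ctr ` S - tri 0 ` ctr ` D''"
  have start: "1 \<le> length tm div 2" "psum tm 1 = 0" "psum tm 2 = entry a 1"
    unfolding tm_def by (rule minus_seq_start)+
  have I: "{1..length tm div 2} = insert 1 ?I" using start(1) by auto
  have dents: "dents tm = {0..<entry a 1} \<union> D''"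
    unfolding dents_def I D''_def using start(2,3) by simp
  have si: "entry a 1 \<le> ?s i" if "i \<in> ?I" for i
    unfolding start(3)[symmetric] by (rule psum_mono) (use that in auto)
  have a1: "entry a 1 \<le> hm" "entry a 1 \<le> L" "entry a 1 \<le> sum_list a"
    using entry_1_le_osum[of a] osum_plus_esum[of a] by (simp_all add: hm_def L_def)
  have disj: "S \<inter> dents tm = {}" using S(1) dents_avoid_window(2) by blast
  have far: "entry a 1 \<le> p" if "p \<in> S \<union> D''" for p
  proof -
    have "p \<in> S \<or> (\<exists>i\<in>?I. ?s i \<le> p)" using that unfolding D''_def by auto
    then show ?thesis
    proof (elim disjE bexE)
      assume "p \<in> S"
      then show ?thesis using S(1) a1(3) by (auto simp: W_def)
    next
      fix i assume "i \<in> ?I" "?s i \<le> p"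
      then show ?thesis using si[of i] by simp
    qed
  qed
  have qd: "quartered_dents tm = big_up 0 (int (entry a 1)) \<union> (\<Union>i\<in>?I. big_up (int (?s i)) (int (?s' i)))"
    unfolding quartered_dents_def I using start(2,3) by simp
  have "tiling_sum (\<lambda>_. 1) (R1 - tri 0 ` base_cells 1 (entry a 1)) = tiling_sum (\<lambda>_. 1) (R1 - half_cells)"
    unfolding half_cells_def
  proof (rule remove_half_triangle[OF vertical_unit_one])
    show "finite R1" unfolding R1_def by (intro finite_Diff finite_trapezoid)
    show "tri j 0 \<notin> R1" for j unfolding R1_def Diff_iff tri_in_trapezoid_in by simp
    show "tri_cells (\<lambda>j c. 0 \<le> j \<and> 1 \<le> c \<and> c \<le> 2 * int (entry a 1) - 1 - (j - 0)) \<subseteq> R1"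
    proof
      fix t assume "t \<in> tri_cells (\<lambda>j c. 0 \<le> j \<and> 1 \<le> c \<and> c \<le> 2 * int (entry a 1) - 1 - (j - 0))"
      then obtain j c where t: "t = tri j c" and jc: "0 \<le> j" "1 \<le> c" "c \<le> 2 * int (entry a 1) - 1 - j"
        by (auto simp: tri_cells_def)
      have "t \<in> ?Z" unfolding t tri_in_trapezoid_in using jc a1 by simp
      moreover have "t \<notin> tri 0 ` ctr ` (S \<union> D'')"
      proof
        assume "t \<in> tri 0 ` ctr ` (S \<union> D'')"
        then obtain p where "p \<in> S \<union> D''" "j = 0" "c = ctr p" unfolding t tri_in_image by blast
        then show False using far[of p] jc by (simp add: ctr_def)
      qed
      ultimately show "t \<in> R1" unfolding R1_def by blast
    qed
  qed simp
  also have "R1 - half_cells = (?Z - tri 0 ` ctr ` S - half_cells) - tri 0 ` ctr ` D''"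
    unfolding R1_def by blast
  also have "tiling_sum (\<lambda>_. 1) \<dots> = tiling_sum (\<lambda>_. 1) ((?Z - tri 0 ` ctr ` S - half_cells) - (\<Union>i\<in>?I. big_up (int (?s i)) (int (?s' i))))"
    unfolding D''_def
  proof (rule remove_big_ups[OF vertical_unit_one])
    fix i assume i: "i \<in> ?I"
    have "big_up (int (?s i)) (int (?s' i)) \<subseteq> ?Z - tri 0 ` ctr ` S - half_cells"
    proof
      fix t assume t: "t \<in> big_up (int (?s i)) (int (?s' i))"
      then have tq: "t \<in> quartered_dents tm" using i unfolding qd by blast
      then obtain j c where jc: "t = tri j c" using has_cells_quartered_dents unfolding has_cells_def by blast
      have b: "0 \<le> j" "2 * int (?s i) + j + 1 \<le> c" using t unfolding jc tri_in_big_up by auto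
      have "esum tm \<le> hm" by (simp add: seq_facts hm_def)
      then have "t \<in> ?Z" using quartered_dents_bounds[of j c tm] tq hm unfolding jc tri_in_trapezoid_in seq_facts
        by simp
      moreover have "t \<notin> tri 0 ` ctr ` S" using tq disj by (auto simp: ctr_in_quartered_dents)
      moreover have "t \<notin> half_cells" using b si[OF i] unfolding jc half_cells_def by simp
      ultimately show "t \<in> ?Z - tri 0 ` ctr ` S - half_cells" by blast
    qed
    then show "?s i \<le> ?s' i \<and> big_up (int (?s i)) (int (?s' i)) \<subseteq> ?Z - tri 0 ` ctr ` S - half_cells"
      by (simp add: psum_mono)
  next
    fix i j :: nat assume "i \<noteq> j"
    then show "?s' i \<le> ?s j \<or> ?s' j \<le> ?s i"
      using blocks_ordered[of i j tm] blocks_ordered[of j i tm] by (cases i j rule: linorder_cases) auto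
  qed (intro finite_Diff finite_trapezoid | simp)+
  also have "(?Z - tri 0 ` ctr ` S - half_cells) - (\<Union>i\<in>?I. big_up (int (?s i)) (int (?s' i))) =
      ?Z - half_cells - quartered_dents tm - tri 0 ` ctr ` S"
  proof -
    \<comment> \<open>The ordinary triangle on the first block sits inside the half triangle, so
      removing it as well changes nothing.\<close>
    have "big_up 0 (int (entry a 1)) \<subseteq> half_cells"
    proof
      fix t assume t: "t \<in> big_up 0 (int (entry a 1))"
      then obtain j c where jc: "t = tri j c" using has_cells_big_up unfolding has_cells_def by blast
      show "t \<in> half_cells" using t unfolding jc tri_in_big_up half_cells_def by simp
    qed
    then show ?thesis unfolding qd by blast
  qed
  finally have "tiling_sum (\<lambda>_. 1) (?Z - half_cells - quartered_dents tm - tri 0 ` ctr ` S) =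
      tiling_sum (\<lambda>_. 1) (R1 - tri 0 ` base_cells 1 (entry a 1))" by simp
  also have "R1 - tri 0 ` base_cells 1 (entry a 1) = ?Z - tri 0 ` ctr ` (S \<union> dents tm)"
    unfolding R1_def dents base_cells_1 by blast
  also have "tiling_sum (\<lambda>_. 1) \<dots> = (if card (S \<union> dents tm) = hm then K_prod (S \<union> dents tm) else 0)"
  proof (rule K_trapezoid_tiling_sum)
    show "S \<union> dents tm \<subseteq> {..<L + z}" using S(1) window_subset dents_subset[of tm] by (auto simp: seq_facts)
  qed (use hm params_le in auto)
  also have "card (S \<union> dents tm) = hm"
    using card_Un_disjoint[OF _ finite_dents disj] S by (simp add: card_dents seq_facts W_def finite_subset hm_def)
  finally show ?thesis by simp
qed

lemma lower_part_sum:
  assumes S: "S \<subseteq> W" "S = {} \<or> 1 \<le> hm" "card S = y"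
  shows "tiling_sum (zigzag_weight h) (lower_part - tri (- 1) ` ctr ` S) = K_prod (S \<union> dents tm)"
proof -
  let ?Z = "zz_trapezoid zig_in (2 * int (L + z)) (2 * int hm - 1)"
  let ?R = "?Z - half_cells - quartered_dents tm - tri 0 ` ctr ` S"
  have "tiling_sum (zigzag_weight h) (lower_part - tri (- 1) ` ctr ` S) = tiling_sum (\<lambda>_. 1) (lower_part - tri (- 1) ` ctr ` S)"
    by (rule tiling_sum_cong, erule zigzag_weight_below) (auto simp: lower_part_def)
  also have "\<dots> = tiling_sum (\<lambda>_. 1) ?R"
  proof (rule tiling_sum_flip)
    fix k c
    show "tri k c \<in> ?R \<longleftrightarrow> tri (- k - 1) c \<in> lower_part - tri (- 1) ` ctr ` S"
      unfolding Diff_iff[of _ lower_part] tri_in_lower_part tri_in_image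
      unfolding Diff_iff tri_in_image tri_in_trapezoid_in by auto
  qed (auto simp: lower_part_def)
  also have "\<dots> = K_prod (S \<union> dents tm)"
  proof (cases "hm = 0")
    case True
    have R: "?R = {}"
    proof (rule region_eqI)
      show "has_cells {}" by (simp add: has_cells_def)
      show "tri k c \<in> ?R \<longleftrightarrow> tri k c \<in> {}" for k c
        unfolding Diff_iff tri_in_trapezoid_in using True by simp
    qed simp
    have "esum tm = 0" using True unfolding seq_facts hm_def by simp
    then have "dents tm = {}" using finite_dents[of tm] card_dents[of tm] by simp
    moreover have "S = {}" using S(2) True by simp
    ultimately have "K_prod (S \<union> dents tm) = 1" by (simp add: K_prod_def vdm_def)
    then show ?thesis unfolding R tiling_sum_empty by simp
  next
    case False
    then show ?thesis by (intro lower_region_sum S) simp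
  qed
  finally show ?thesis .
qed

theorem NR3_tiling_sum:
  "M_NR3 x y z a b = (\<Sum>S | S \<subseteq> W \<and> card S = y. Q_prod (S \<union> dents tp) * K_prod (S \<union> dents tm))"
proof -
  let ?w = "zigzag_weight (2 * int hp)"
  \<comment> \<open>Positions where both cells of a crossing lozenge exist. The set can be smaller
    than the window only if y = 0, and then S = {} is the only choice in either case.\<close>
  define W0 where "W0 = {p \<in> W. tri 0 (ctr p) \<in> upper_part \<and> tri (- 1) (ctr p) \<in> lower_part}"
  have lp: "tri (- 1) c \<in> lower_part \<longleftrightarrow>
      tri 0 c \<in> zz_trapezoid zig_in (2 * int (L + z)) (2 * int hm - 1) - half_cells - quartered_dents tm" for c
    using tri_in_lower_part[of 0 c] by simp
  have D: "ctr ` W0 = {c. odd (c - 0) \<and> tri 0 c \<in> upper_part \<and> tri (0 - 1) c \<in> lower_part}"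
  proof (rule equalityI; rule subsetI)
    fix c assume c: "c \<in> {c. odd (c - 0) \<and> tri 0 c \<in> upper_part \<and> tri (0 - 1) c \<in> lower_part}"
    then have "odd c" by simp
    then obtain i where i: "c = 2 * i + 1" by (rule oddE)
    have b: "0 \<le> c" "c \<le> 2 * int L - 1" "tri 0 c \<notin> quartered_dents tp" "tri 0 c \<notin> quartered_dents tm"
      using c unfolding upper_part_def mem_Collect_eq Diff_iff tri_in_trapezoid_out by (auto simp: lp)
    have cp: "c = ctr (nat i)" "nat i < L" using b(1,2) i by (auto simp: ctr_def)
    have "nat i \<in> {..<L + z}" using cp(2) by simp
    \<comment> \<open>A crossing lozenge meets a dent on neither side, so by
      \<open>dents_cover\<close> it lies in the window.\<close>
    then have "nat i \<in> dents tp \<union> dents tm \<union> W" using dents_cover by (rule subsetD[rotated])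
    then have "nat i \<in> W" using b(3,4) unfolding cp(1) by (simp add: ctr_in_quartered_dents)
    then show "c \<in> ctr ` W0" using c cp(1) unfolding W0_def by auto
  qed (auto simp: W0_def ctr_def)
  have fin: "finite (NR3 x y z a b)"
  proof -
    have "has_cells (NR3 x y z a b)" unfolding NR3_split by (simp add: upper_part_def lower_part_def)
    then show ?thesis
    proof (rule finite_region[where A = "{- 2 * int hm..2 * int hp}" and B = "{0..2 * int (L + z)}"])
      fix k c assume t: "tri k c \<in> NR3 x y z a b"
      show "k \<in> {- 2 * int hm..2 * int hp} \<and> c \<in> {0..2 * int (L + z)}"
      proof (cases "0 \<le> k")
        case True
        then show ?thesis using t unfolding tri_in_NR3_upper[OF True] Diff_iff tri_in_trapezoid_out by auto
      next
        case False
        have "tri (- (- k - 1) - 1) c \<in> NR3 x y z a b" using t by simp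
        then show ?thesis using False tri_in_NR3_lower[of "- k - 1" c] unfolding Diff_iff tri_in_trapezoid_in by auto
      qed
    qed auto
  qed
  have "M_NR3 x y z a b = tiling_sum ?w (upper_part \<union> lower_part)"
    unfolding M_NR3_def NR3_split NR_params ..
  also have "\<dots> = (\<Sum>X\<in>Pow (ctr ` W0). (\<Prod>c\<in>X. ?w {tri (0 - 1) c, tri 0 c}) *
      tiling_sum ?w (upper_part - tri 0 ` X) * tiling_sum ?w (lower_part - tri (0 - 1) ` X))"
  proof (rule tiling_sum_rows[OF _ _ _ _ D])
    show "finite upper_part" "finite lower_part" using fin unfolding NR3_split by auto
    show "\<exists>k' c. 0 \<le> k' \<and> t = tri k' c" if tU: "t \<in> upper_part" for t
    proof -
      have "has_cells upper_part" by (simp add: upper_part_def)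
      then obtain k c where t: "t = tri k c" using tU unfolding has_cells_def by blast
      have "0 \<le> k" using tU unfolding t upper_part_def Diff_iff tri_in_trapezoid_out by simp
      with t show ?thesis by blast
    qed
    show "\<exists>k' c. k' < 0 \<and> t = tri k' c" if "t \<in> lower_part" for t
      using that by (auto simp: lower_part_def tri_cells_def)
  qed
  also have "\<dots> = (\<Sum>X\<in>Pow (ctr ` W0). tiling_sum ?w (upper_part - tri 0 ` X) * tiling_sum ?w (lower_part - tri (- 1) ` X))"
  proof (rule sum.cong[OF refl])
    \<comment> \<open>Weighted lozenges have their lower cell in a row of index at least 0, so
      crossing ones are unweighted.\<close>
    have "?w {tri (0 - 1) c, tri 0 c} = 1" for c using zigzag_weight_vertical[of "2 * int hp" "- 1" c] by simp
    then show "(\<Prod>c\<in>X. ?w {tri (0 - 1) c, tri 0 c}) * tiling_sum ?w (upper_part - tri 0 ` X) * tiling_sum ?w (lower_part - tri (0 - 1) ` X) =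
      tiling_sum ?w (upper_part - tri 0 ` X) * tiling_sum ?w (lower_part - tri (- 1) ` X)" for X by simp
  qed
  also have "\<dots> = (\<Sum>S\<in>Pow W0. tiling_sum ?w (upper_part - tri 0 ` ctr ` S) * tiling_sum ?w (lower_part - tri (- 1) ` ctr ` S))"
  proof -
    have "Pow (ctr ` W0) = (\<lambda>S. ctr ` S) ` Pow W0" by (rule image_Pow_surj[symmetric]) simp
    moreover have "inj_on (\<lambda>S. ctr ` S) (Pow W0)" using inj_ctr by (simp add: inj_on_def inj_image_eq_iff)
    ultimately show ?thesis by (simp add: sum.reindex)
  qed
  also have "\<dots> = (\<Sum>S\<in>Pow W0. if card S = y then Q_prod (S \<union> dents tp) * K_prod (S \<union> dents tm) else 0)"
  proof (rule sum.cong[OF refl])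
    fix S assume S: "S \<in> Pow W0"
    have SW: "S \<subseteq> W" using S by (auto simp: W0_def)
    have ne: "S = {} \<or> 1 \<le> hp" "S = {} \<or> 1 \<le> hm"
      using S unfolding W0_def lp upper_part_def Diff_iff tri_in_trapezoid_out tri_in_trapezoid_in by auto
    show "tiling_sum ?w (upper_part - tri 0 ` ctr ` S) * tiling_sum ?w (lower_part - tri (- 1) ` ctr ` S) =
        (if card S = y then Q_prod (S \<union> dents tp) * K_prod (S \<union> dents tm) else 0)"
      using upper_part_sum[OF SW ne(1)] lower_part_sum[OF SW ne(2)] by simp
  qed
  also have "\<dots> = (\<Sum>S | S \<in> Pow W0 \<and> card S = y. Q_prod (S \<union> dents tp) * K_prod (S \<union> dents tm))"
    by (rule sum.inter_filter[symmetric]) (simp add: W0_def W_def)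
  also have "{S. S \<in> Pow W0 \<and> card S = y} = {S. S \<subseteq> W \<and> card S = y}"
  proof (cases "y = 0")
    case True
    have fin: "finite S" if "S \<subseteq> W" for S using that by (rule finite_subset) (simp add: W_def)
    have "W0 \<subseteq> W" by (auto simp: W0_def)
    then have "S \<subseteq> W \<and> card S = 0 \<longleftrightarrow> S = {}" "S \<subseteq> W0 \<and> card S = 0 \<longleftrightarrow> S = {}" for S
      using fin[of S] by auto
    then show ?thesis unfolding True by simp
  next
    case False
    have "W0 = W"
    proof (intro equalityI subsetI)
      fix p assume p: "p \<in> W"
      have "p \<notin> dents tp" "p \<notin> dents tm" using p dents_avoid_window by blast+
      then have q: "tri 0 (ctr p) \<notin> quartered_dents tp" "tri 0 (ctr p) \<notin> quartered_dents tm"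
        by (simp_all add: ctr_in_quartered_dents)
      have "p < L" "entry a 1 \<le> p"
        using p window_subset entry_1_le_osum[of a] osum_plus_esum[of a] by (auto simp: W_def)
      moreover have "1 \<le> hp" "1 \<le> hm" using False by (simp_all add: hp_def hm_def)
      ultimately show "p \<in> W0" using p q unfolding W0_def lp upper_part_def Diff_iff tri_in_trapezoid_out tri_in_trapezoid_in
        by (simp add: ctr_def half_cells_def)
    qed (auto simp: W0_def)
    then show ?thesis by auto
  qed
  finally show ?thesis .
qed

end

section \<open>Closed forms\<close>

text \<open>In a mixed pair the larger position comes first, whichever set it belongs to; collecting
  these pairs by their element of S gives absolute values.\<close>

lemma vdm_union:
  assumes "finite S" "finite D" "S \<inter> D = {}"
  shows "vdm (S \<union> D) = vdm S * vdm D * (\<Prod>s\<in>S. \<Prod>d\<in>D. \<bar>sqh d - sqh s\<bar>)"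
proof -
  let ?f = "\<lambda>q p. sqh q - sqh p"
  have in1: "(\<Prod>p\<in>{p \<in> S \<union> D. p < q}. ?f q p) = (\<Prod>p\<in>{p \<in> S. p < q}. ?f q p) * (\<Prod>p\<in>{p \<in> D. p < q}. ?f q p)" for q
  proof -
    have eq: "{p \<in> S \<union> D. p < q} = {p \<in> S. p < q} \<union> {p \<in> D. p < q}" by blast
    show ?thesis unfolding eq by (rule prod.union_disjoint) (use assms in auto)
  qed
  have swap: "(\<Prod>q\<in>D. \<Prod>p\<in>{p \<in> S. p < q}. ?f q p) = (\<Prod>p\<in>S. \<Prod>q\<in>{q \<in> D. p < q}. ?f q p)"
    by (rule prod.swap_restrict[OF assms(2,1)])
  have abs: "(\<Prod>p\<in>{p \<in> D. p < s}. ?f s p) * (\<Prod>q\<in>{q \<in> D. s < q}. ?f q s) = (\<Prod>d\<in>D. \<bar>sqh d - sqh s\<bar>)"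
    if "s \<in> S" for s
  proof -
    have eq: "D = {p \<in> D. p < s} \<union> {q \<in> D. s < q}" using that assms(3) by (auto simp: linorder_neq_iff)
    have "(\<Prod>d\<in>{p \<in> D. p < s} \<union> {q \<in> D. s < q}. \<bar>sqh d - sqh s\<bar>) =
        (\<Prod>d\<in>{p \<in> D. p < s}. \<bar>sqh d - sqh s\<bar>) * (\<Prod>d\<in>{q \<in> D. s < q}. \<bar>sqh d - sqh s\<bar>)"
      by (rule prod.union_disjoint) (use assms in auto)
    moreover have "(\<Prod>d\<in>{p \<in> D. p < s}. \<bar>sqh d - sqh s\<bar>) = (\<Prod>p\<in>{p \<in> D. p < s}. ?f s p)"
      by (intro prod.cong) (auto simp: sqh_less_iff abs_if)
    moreover have "(\<Prod>d\<in>{q \<in> D. s < q}. \<bar>sqh d - sqh s\<bar>) = (\<Prod>q\<in>{q \<in> D. s < q}. ?f q s)"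
    proof (intro prod.cong refl)
      fix q assume "q \<in> {q \<in> D. s < q}"
      then have "sqh s < sqh q" by (simp add: sqh_less_iff)
      then show "\<bar>sqh q - sqh s\<bar> = sqh q - sqh s" by simp
    qed
    ultimately show ?thesis by (simp only: eq[symmetric])
  qed
  have "vdm (S \<union> D) = (\<Prod>q\<in>S. \<Prod>p\<in>{p \<in> S \<union> D. p < q}. ?f q p) * (\<Prod>q\<in>D. \<Prod>p\<in>{p \<in> S \<union> D. p < q}. ?f q p)"
    unfolding vdm_def by (rule prod.union_disjoint[OF assms])
  also have "\<dots> = vdm S * vdm D * ((\<Prod>s\<in>S. \<Prod>p\<in>{p \<in> D. p < s}. ?f s p) * (\<Prod>q\<in>D. \<Prod>p\<in>{p \<in> S. p < q}. ?f q p))"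
    unfolding in1 prod.distrib vdm_def by (simp only: mult_ac)
  also have "(\<Prod>s\<in>S. \<Prod>p\<in>{p \<in> D. p < s}. ?f s p) * (\<Prod>q\<in>D. \<Prod>p\<in>{p \<in> S. p < q}. ?f q p) =
      (\<Prod>s\<in>S. \<Prod>d\<in>D. \<bar>sqh d - sqh s\<bar>)"
    unfolding swap prod.distrib[symmetric] by (rule prod.cong[OF refl]) (rule abs)
  finally show ?thesis .
qed

text \<open>\<open>H2\<close> multiplies factorials of one parity. This formula and its even
  companion identify the constants of \<open>Q_prod\<close> and \<open>K_prod\<close> as values of
  \<open>H2\<close>.\<close>

lemma H2_odd: "H2 (2 * n + 1) = (\<Prod>j<n. fact (2 * j + 1))"
proof -
  have "H2 (2 * n + 1) = (\<Prod>i=1..n. fact (2 * n + 1 - 2 * i))" by (simp add: H2_def)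
  also have "\<dots> = (\<Prod>j<n. fact (2 * j + 1))"
    by (rule prod.reindex_bij_witness[where i = "\<lambda>j. n - j" and j = "\<lambda>i. n - i"])
      (auto simp: diff_mult_distrib2 Suc_diff_le)
  finally show ?thesis .
qed

lemma H2_even: "H2 (2 * n) = (\<Prod>j<n. fact (2 * j))"
proof -
  have "H2 (2 * n) = (\<Prod>i=1..n. fact (2 * n - 2 * i))" by (simp add: H2_def)
  also have "\<dots> = (\<Prod>j<n. fact (2 * j))"
    by (rule prod.reindex_bij_witness[where i = "\<lambda>j. n - j" and j = "\<lambda>i. n - i"])
      (auto simp: diff_mult_distrib2)
  finally show ?thesis .
qed

lemma H2_pos: "H2 n > 0"
  by (simp add: H2_def prod_pos)

lemma Q_prod_H2: "Q_prod P = (\<Prod>p\<in>P. real p + 1 / 2) * vdm P / H2 (2 * card P + 1)"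
  unfolding Q_prod_def H2_odd ..

lemma K_prod_H2: "K_prod P = vdm P / H2 (2 * card P)"
  unfolding K_prod_def H2_even ..

definition selberg :: "nat \<Rightarrow> nat \<Rightarrow> nat \<Rightarrow> nat \<Rightarrow> real" where
  "selberg a c G y = (\<Prod>k<y. fact (a + k) * fact (c + k) * fact k / fact (a + c + k + y)
      * (fact (G + c + k) / fact (G - 1 - k)) * (fact (G + a + c + k) / fact (G - a - 1 - k)) / 2)"

text \<open>Each s in S meets P through \<open>Q_prod\<close> and R through \<open>K_prod\<close>.
  Together these are all positions outside the window, so the product of mixed differences does not
  depend on how they are split. The two copies of \<open>vdm S\<close> give the square, and
  \<open>Q_prod\<close> contributes the factor s + 1/2.\<close>

lemma window_sum:
  assumes fin: "finite P" "finite R" and PR: "P \<inter> R = {}" "P \<union> R = {..<a} \<union> {G..<G + c}"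
    and aG: "a \<le> G" "y \<le> G - a"
  shows "(\<Sum>S | S \<subseteq> {a..<G} \<and> card S = y. Q_prod (S \<union> P) * K_prod (S \<union> R)) =
    Q_prod P * K_prod R * (H2 (2 * card P + 1) * H2 (2 * card R) /
      (H2 (2 * card P + 2 * y + 1) * H2 (2 * card R + 2 * y))) * selberg a c G y"
proof -
  define C where "C = Q_prod P * K_prod R * (H2 (2 * card P + 1) * H2 (2 * card R) /
      (H2 (2 * card P + 2 * y + 1) * H2 (2 * card R + 2 * y)))"
  define \<omega> where "\<omega> s = (real s + 1 / 2) * (\<Prod>d<a. sqh s - sqh d) * (\<Prod>t<c. sqh (G + t) - sqh s)" for s
  have nz: "H2 n \<noteq> 0" for n using H2_pos[of n] by simp
  have "Q_prod (S \<union> P) * K_prod (S \<union> R) = C * ((vdm S)\<^sup>2 * (\<Prod>s\<in>S. \<omega> s))"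
    if S: "S \<subseteq> {a..<G}" "card S = y" for S
  proof -
    have finS: "finite S" using S(1) by (rule finite_subset) simp
    have "S \<inter> ({..<a} \<union> {G..<G + c}) = {}" using S(1) by auto
    then have disj: "S \<inter> P = {}" "S \<inter> R = {}" unfolding PR(2)[symmetric] by blast+
    have card: "card (S \<union> P) = card P + y" "card (S \<union> R) = card R + y"
      using card_Un_disjoint[OF finS fin(1) disj(1)] card_Un_disjoint[OF finS fin(2) disj(2)] S(2) by simp_all
    have inner: "(\<Prod>d\<in>P. \<bar>sqh d - sqh s\<bar>) * (\<Prod>d\<in>R. \<bar>sqh d - sqh s\<bar>) =
        (\<Prod>d<a. sqh s - sqh d) * (\<Prod>t<c. sqh (G + t) - sqh s)" if "s \<in> S" for s
    proof -
      have s: "a \<le> s" "s < G" using S(1) that by auto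
      have "(\<Prod>d\<in>P. \<bar>sqh d - sqh s\<bar>) * (\<Prod>d\<in>R. \<bar>sqh d - sqh s\<bar>) = (\<Prod>d\<in>{..<a} \<union> {G..<G + c}. \<bar>sqh d - sqh s\<bar>)"
        unfolding PR(2)[symmetric] by (rule prod.union_disjoint[OF fin PR(1), symmetric])
      also have "\<dots> = (\<Prod>d<a. \<bar>sqh d - sqh s\<bar>) * (\<Prod>d\<in>{G..<G + c}. \<bar>sqh d - sqh s\<bar>)"
        by (rule prod.union_disjoint) (use aG in auto)
      also have "(\<Prod>d<a. \<bar>sqh d - sqh s\<bar>) = (\<Prod>d<a. sqh s - sqh d)"
      proof (intro prod.cong refl)
        fix d assume "d \<in> {..<a}"
        then have "sqh d < sqh s" using s by (simp add: sqh_less_iff)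
        then show "\<bar>sqh d - sqh s\<bar> = sqh s - sqh d" by simp
      qed
      also have "(\<Prod>d\<in>{G..<G + c}. \<bar>sqh d - sqh s\<bar>) = (\<Prod>t<c. sqh (G + t) - sqh s)"
      proof (rule prod.reindex_bij_witness[where i = "\<lambda>t. G + t" and j = "\<lambda>d. d - G"])
        fix d assume "d \<in> {G..<G + c}"
        then have "sqh s < sqh d" "G + (d - G) = d" using s by (simp_all add: sqh_less_iff)
        then show "sqh (G + (d - G)) - sqh s = \<bar>sqh d - sqh s\<bar>" by simp
      qed auto
      finally show ?thesis .
    qed
    have "(\<Prod>s\<in>S. \<omega> s) = (\<Prod>s\<in>S. real s + 1 / 2) * ((\<Prod>s\<in>S. \<Prod>d\<in>P. \<bar>sqh d - sqh s\<bar>) * (\<Prod>s\<in>S. \<Prod>d\<in>R. \<bar>sqh d - sqh s\<bar>))"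
      unfolding prod.distrib[symmetric] \<omega>_def by (rule prod.cong[OF refl]) (simp add: inner mult.assoc)
    moreover have "(\<Prod>p\<in>S \<union> P. real p + 1 / 2) = (\<Prod>p\<in>S. real p + 1 / 2) * (\<Prod>p\<in>P. real p + 1 / 2)"
      by (rule prod.union_disjoint[OF finS fin(1) disj(1)])
    ultimately show ?thesis
      unfolding C_def Q_prod_H2 K_prod_H2 card vdm_union[OF finS fin(1) disj(1)] vdm_union[OF finS fin(2) disj(2)]
      using nz by (simp add: power2_eq_square distrib_left mult_ac)
  qed
  then have "(\<Sum>S | S \<subseteq> {a..<G} \<and> card S = y. Q_prod (S \<union> P) * K_prod (S \<union> R)) =
      (\<Sum>S | S \<subseteq> {a..<G} \<and> card S = y. C * ((vdm S)\<^sup>2 * (\<Prod>s\<in>S. \<omega> s)))"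
    by (intro sum.cong) auto
  also have "\<dots> = C * selberg a c G y"
    unfolding sum_distrib_left[symmetric] \<omega>_def selberg_def discrete_selberg[OF aG] ..
  finally show ?thesis unfolding C_def .
qed

text \<open>The hypothesis gives 2i \<le> N for all i < y, so no Pochhammer length is truncated. The
  index is reversed to match the order of the factors in \<open>selberg\<close>.\<close>

lemma T_fact:
  assumes "2 * int y - 1 \<le> N + 1"
  shows "T (real n + 1) (int N) y = (\<Prod>k<y. fact (n + N - (y - 1 - k)) / fact (n + (y - 1 - k)))"
proof -
  have "T (real n + 1) (int N) y = (\<Prod>i<y. fact (n + N - i) / fact (n + i))"
    unfolding T_def
  proof (rule prod.cong[OF refl])
    fix i assume "i \<in> {..<y}"
    then have i: "2 * i \<le> N" using assms by auto
    have "nat (int N - 2 * int i) = N - 2 * i" using i by simp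
    moreover have "real n + 1 + real i = real (n + i + 1)" by simp
    moreover have "n + i + 1 + (N - 2 * i) - 1 = n + N - i" using i by simp
    moreover have "n + i + 1 - 1 = n + i" "1 \<le> n + i + 1" by simp_all
    ultimately show "pochhammer (real n + 1 + real i) (nat (int N - 2 * int i)) = fact (n + N - i) / fact (n + i)"
      using pochhammer_fact_ratio[of "n + i + 1" "N - 2 * i"] by (simp only:)
  qed
  also have "\<dots> = (\<Prod>k<y. fact (n + N - (y - 1 - k)) / fact (n + (y - 1 - k)))"
    by (rule prod.reindex_bij_witness[where i = "\<lambda>k. y - 1 - k" and j = "\<lambda>k. y - 1 - k"]) auto
  finally show ?thesis .
qed

lemma T_window:
  assumes "int N = int e + 2 * int y - 1"
  shows "T (real n + 1) (int e + 2 * int y - 1) y = (\<Prod>k<y. fact (n + e + y + k) / fact (n + y - 1 - k))"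
proof -
  have "T (real n + 1) (int e + 2 * int y - 1) y = (\<Prod>k<y. fact (n + N - (y - 1 - k)) / fact (n + (y - 1 - k)))"
    unfolding assms[symmetric] by (rule T_fact) (use assms in simp)
  also have "\<dots> = (\<Prod>k<y. fact (n + e + y + k) / fact (n + y - 1 - k))"
  proof (rule prod.cong[OF refl])
    fix k assume "k \<in> {..<y}"
    then have "n + N - (y - 1 - k) = n + e + y + k" "n + (y - 1 - k) = n + y - 1 - k"
      using assms by auto
    then show "fact (n + N - (y - 1 - k)) / fact (n + (y - 1 - k)) = (fact (n + e + y + k) / fact (n + y - 1 - k) :: real)"
      by simp
  qed
  finally show ?thesis .
qed

text \<open>For e = y = 0 the second argument is -1 and no natural number N represents it; there
  both products are empty.\<close>

lemma T_closed: "T (real n + 1) (int e + 2 * int y - 1) y = (\<Prod>k<y. fact (n + e + y + k) / fact (n + y - 1 - k))"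
proof (cases "e + 2 * y = 0")
  case True
  then show ?thesis by (simp add: T_def)
next
  case False
  then show ?thesis by (intro T_window[of "e + 2 * y - 1"]) auto
qed

lemma prod_fact_reverse: "(\<Prod>k<y. fact (n + y - 1 - k)) = (\<Prod>k<y. fact (n + k) :: real)"
  by (rule prod.reindex_bij_witness[where i = "\<lambda>k. y - 1 - k" and j = "\<lambda>k. y - 1 - k"]) auto

lemma H_add: "H (n + y) = H n * (\<Prod>k<y. fact (n + k))"
  unfolding H_def by (rule prod_lessThan_add)

lemma H_pos: "H n > 0"
  by (simp add: H_def prod_pos)

text \<open>For G = a + x + y the two ratios of factorials that contain x are the values of
  \<open>T\<close> in the numerator. The values at x = 0 supply the remaining factors except (c +
  k)!, which comes from the quotient of \<open>H\<close>; that quotient also cancels the surplus (2a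
  + c + y + k)!.\<close>

lemma selberg_T:
  "selberg a c (a + x + y) y = 1 / 2 ^ y *
    (H (2 * a + c + 2 * y) * H (c + y) / (H (2 * a + c + y) * H c)) *
    (T (real x + 1) (2 * int a + int c + 2 * int y - 1) y * T (real x + real a + 1) (int c + 2 * int y - 1) y /
     (T 1 (2 * int a + int c + 2 * int y - 1) y * T (real a + 1) (int c + 2 * int y - 1) y))"
proof -
  have T1: "T (real n + 1) (2 * int a + int c + 2 * int y - 1) y = (\<Prod>k<y. fact (n + (2 * a + c) + y + k) / fact (n + y - 1 - k))" for n
    using T_closed[of n "2 * a + c" y] by simp
  have T2: "T (real n + real a + 1) (int c + 2 * int y - 1) y = (\<Prod>k<y. fact (n + a + c + y + k) / fact (n + a + y - 1 - k))" for n
    using T_closed[of "n + a" c y] by simp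
  have A: "T 1 (2 * int a + int c + 2 * int y - 1) y = (\<Prod>k<y. fact (2 * a + c + y + k)) / (\<Prod>k<y. fact k)"
    using T1[of 0] prod_fact_reverse[of 0 y] by (simp add: prod_dividef)
  have B: "T (real a + 1) (int c + 2 * int y - 1) y = (\<Prod>k<y. fact (a + c + y + k)) / (\<Prod>k<y. fact (a + k))"
    using T2[of 0] prod_fact_reverse[of a y] by (simp add: prod_dividef)
  have H1: "H (2 * a + c + 2 * y) = H (2 * a + c + y) * (\<Prod>k<y. fact (2 * a + c + y + k))"
    using H_add[of "2 * a + c + y" y] by (simp add: mult_2 add.assoc)
  have H2: "H (c + y) = H c * (\<Prod>k<y. fact (c + k))" by (rule H_add)
  have s1: "(\<Prod>k<y. fact (a + x + y + c + k) / fact (a + x + y - 1 - k) :: real) = T (real x + real a + 1) (int c + 2 * int y - 1) y"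
    unfolding T2 by (rule prod.cong) (simp_all add: add_ac)
  have s2: "(\<Prod>k<y. fact (a + x + y + a + c + k) / fact (a + x + y - a - 1 - k) :: real) = T (real x + 1) (2 * int a + int c + 2 * int y - 1) y"
    unfolding T1 by (rule prod.cong) (simp_all add: add_ac mult_2)
  have s3: "(\<Prod>k<y. fact (a + k) * fact (c + k) * fact k / fact (a + c + k + y) :: real) =
      (\<Prod>k<y. fact (a + k)) * (\<Prod>k<y. fact (c + k)) * (\<Prod>k<y. fact k) / (\<Prod>k<y. fact (a + c + y + k))"
    by (simp add: prod.distrib prod_dividef add_ac)
  have "selberg a c (a + x + y) y =
      (\<Prod>k<y. fact (a + k) * fact (c + k) * fact k / fact (a + c + k + y)) *
      (\<Prod>k<y. fact (a + x + y + c + k) / fact (a + x + y - 1 - k)) *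
      (\<Prod>k<y. fact (a + x + y + a + c + k) / fact (a + x + y - a - 1 - k)) / 2 ^ y"
    unfolding selberg_def prod_dividef[of _ "\<lambda>_. 2"] prod.distrib by simp
  also have "\<dots> = (\<Prod>k<y. fact (a + k)) * (\<Prod>k<y. fact (c + k)) * (\<Prod>k<y. fact k) / (\<Prod>k<y. fact (a + c + y + k)) *
      T (real x + real a + 1) (int c + 2 * int y - 1) y * T (real x + 1) (2 * int a + int c + 2 * int y - 1) y / 2 ^ y"
    unfolding s1 s2 s3 ..
  finally have L: "selberg a c (a + x + y) y = \<dots>" .
  \<comment> \<open>The letters stand for the products of factorials, for the two values of
    \<open>T\<close> that contain x, for 2^y and for values of \<open>H\<close>.\<close>
  have alg: "p * q * r / s * u * v / t = 1 / t * (h * w * (g * q) / (h * g)) * (v * u / (w / r * (s / p)))"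
    if "p \<noteq> 0" "r \<noteq> 0" "s \<noteq> 0" "w \<noteq> 0" "h \<noteq> 0" "g \<noteq> 0" for p q r s u v t h w g :: real
    using that by (simp add: divide_simps)
  show ?thesis unfolding L A B H1 H2
    by (rule alg) (use H_pos in \<open>simp_all add: less_imp_neq[symmetric]\<close>)
qed

section \<open>Closed forms of the tiling sums of the regions\<close>

lemma M_NR3_closed:
  "M_NR3 x y z a b = Q' (plus_seq (x + y) a b) * K (minus_seq (x + y) z a b) *
    (H2 (2 * (esum a + osum b) + 1) * H2 (2 * (osum a + esum b + z)) /
      (H2 (2 * (esum a + osum b) + 2 * y + 1) * H2 (2 * (osum a + esum b + z) + 2 * y))) *
    selberg (sum_list a) (sum_list b + z) (sum_list a + x + y) y"
proof -
  interpret NR_region x y z a b .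
  have G: "L + z = (sum_list a + (x + y)) + (sum_list b + z)" by (simp add: L_def)
  have "M_NR3 x y z a b = Q_prod (dents tp) * K_prod (dents tm) * (H2 (2 * card (dents tp) + 1) * H2 (2 * card (dents tm)) /
      (H2 (2 * card (dents tp) + 2 * y + 1) * H2 (2 * card (dents tm) + 2 * y))) *
      selberg (sum_list a) (sum_list b + z) (sum_list a + (x + y)) y"
    unfolding NR3_tiling_sum W_def
    by (rule window_sum) (use dents_partition G finite_dents in auto)
  then show ?thesis
    unfolding card_dents Q'_eq[symmetric] K_eq[symmetric] tp_def tm_def esum_plus_seq esum_minus_seq
    by (simp only: add.assoc)
qed

lemma Q'_pos: "Q' t > 0" and K_pos: "K t > 0"
  by (simp_all add: Q'_eq K_eq Q_prod_pos K_prod_pos finite_dents)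

lemma M_NR3_product:
  "M_NR3 x y z a b = Q' (plus_seq (x + y) a b) * K (minus_seq (x + y) z a b) *
    (H2 (2 * (esum a + osum b) + 1) * H2 (2 * (osum a + esum b + z)) /
      (H2 (2 * (esum a + osum b) + 2 * y + 1) * H2 (2 * (osum a + esum b + z) + 2 * y))) *
    (1 / 2 ^ y * (H (2 * sum_list a + (sum_list b + z) + 2 * y) * H (sum_list b + z + y) / (H (2 * sum_list a + (sum_list b + z) + y) * H (sum_list b + z))) *
    (T (real x + 1) (2 * int (sum_list a) + int (sum_list b + z) + 2 * int y - 1) y *
     T (real x + real (sum_list a) + 1) (int (sum_list b + z) + 2 * int y - 1) y /
     (T 1 (2 * int (sum_list a) + int (sum_list b + z) + 2 * int y - 1) y *
      T (real (sum_list a) + 1) (int (sum_list b + z) + 2 * int y - 1) y)))"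
  unfolding M_NR3_closed selberg_T ..

text \<open>For y = 0 the Selberg product is empty and the quotient of \<open>H2\<close> values is
  1.\<close>

lemma M_NR3_no_crossing:
  "M_NR3 u 0 z a b = Q' (plus_seq u a b) * K (minus_seq u z a b)"
proof -
  have "H2 n \<noteq> 0" for n using H2_pos[of n] by simp
  then show ?thesis unfolding M_NR3_closed by (simp add: selberg_def)
qed

theorem theorem2p18:
  fixes x y z :: nat and a b :: "nat list"
    and m n \<mu> \<mu>' \<nu> \<nu>' sa sb :: nat and t_plus t_minus :: "nat list"
  assumes "m = terms a" and "n = terms b"
    and "sa = sum_list a" and "sb = sum_list b"
    and "\<mu> = 2 * nat \<lfloor>(real m + 1) / 2\<rfloor>" and "\<mu>' = 2 * nat \<lceil>(real m - 1) / 2\<rceil>"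
    and "\<nu> = 2 * nat \<lfloor>(real n + 1) / 2\<rfloor>" and "\<nu>' = 2 * nat \<lceil>(real n - 1) / 2\<rceil>"
    and "t_plus = map (entry a) [1..<\<mu>' + 1]
           @ [entry a (\<mu>' + 1) + x + y + entry b \<nu>]
           @ rev (map (entry b) [1..<\<nu>])"
    and "t_minus = [0] @ map (entry a) [1..<\<mu>]
           @ [entry a \<mu> + x + y + entry b (\<nu>' + 1)]
           @ rev (map (entry b) [1..<\<nu>' + 1]) @ [z]"
  shows
    "M_NR3 x y z a b =
       M_NR3 (x + y) 0 z a b * M_NR3 0 y z a b / M_NR3 y 0 z a b
       * ((T (real x + 1) (2 * int sa + int sb + 2 * int y + int z - 1) y
           * T (real x + real sa + 1) (int sb + 2 * int y + int z - 1) y)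
         / (T 1 (2 * int sa + int sb + 2 * int y + int z - 1) y
           * T (real sa + 1) (int sb + 2 * int y + int z - 1) y))
     \<and>
     M_NR3 x y z a b =
       1 / 2 ^ y * Q' t_plus * K t_minus
       * ((H2 (2 * esum a + 2 * osum b + 1) * H2 (2 * osum a + 2 * esum b + 2 * z))
         / (H2 (2 * esum a + 2 * osum b + 2 * y + 1)
           * H2 (2 * osum a + 2 * esum b + 2 * y + 2 * z)))
       * ((H (2 * sa + sb + 2 * y + z) * H (sb + y + z))
         / (H (2 * sa + sb + y + z) * H (sb + z)))
       * ((T (real x + 1) (2 * int sa + int sb + 2 * int y + int z - 1) y
           * T (real x + real sa + 1) (int sb + 2 * int y + int z - 1) y)
         / (T 1 (2 * int sa + int sb + 2 * int y + int z - 1) y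
           * T (real sa + 1) (int sb + 2 * int y + int z - 1) y))"
proof -
  have mn: "1 \<le> m" "1 \<le> n" using assms(1,2) length_le_terms(2) by auto
  have fl: "nat \<lfloor>(real k + 1) / 2\<rfloor> = (k + 1) div 2" for k
    using floor_divide_of_nat_eq[of "k + 1" 2, where ?'a = real] by (simp add: add.commute)
  \<comment> \<open>For an integer k the ceiling of (k - 1)/2 is the floor of k/2.\<close>
  have ce: "nat \<lceil>(real k - 1) / 2\<rceil> = k div 2" if "1 \<le> k" for k
  proof -
    have "\<lceil>(real k - 1) / 2\<rceil> = int (k div 2)"
    proof (rule ceiling_unique)
      have "k = 2 * (k div 2) + k mod 2" "k mod 2 \<le> 1" by simp_all
      then have "real k = 2 * real (k div 2) + real (k mod 2)" "real (k mod 2) \<le> 1"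
        by (metis of_nat_add of_nat_mult of_nat_numeral) (simp add: \<open>k mod 2 \<le> 1\<close>)
      then show "real_of_int (int (k div 2)) - 1 < (real k - 1) / 2" "(real k - 1) / 2 \<le> real_of_int (int (k div 2))"
        by auto
    qed
    then show ?thesis by simp
  qed
  have idx: "\<mu> = 2 * ((terms a + 1) div 2)" "\<mu>' = 2 * (terms a div 2)"
    "\<nu> = 2 * ((terms b + 1) div 2)" "\<nu>' = 2 * (terms b div 2)"
    using assms(1,2,5-8) fl ce mn by simp_all
  have pos: "1 \<le> \<mu>" "1 \<le> \<nu>" unfolding idx using length_le_terms(2)[of a] length_le_terms(2)[of b] by presburger+
  have tp: "t_plus = plus_seq (x + y) a b"
    unfolding assms(9) plus_seq_def Let_def idx[symmetric] joined_def using pos by (simp add: add.assoc)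
  have tm: "t_minus = minus_seq (x + y) z a b"
    unfolding assms(10) minus_seq_def Let_def idx[symmetric] joined_def using pos by (simp add: add.assoc)
  \<comment> \<open>Kept as a function of x: the numerator is its value at x and the denominator its
    value at 0.\<close>
  define T4 where "T4 = (\<lambda>x. T (real x + 1) (2 * int sa + int sb + 2 * int y + int z - 1) y
           * T (real x + real sa + 1) (int sb + 2 * int y + int z - 1) y)"
  define H4 where "H4 = (H2 (2 * esum a + 2 * osum b + 1) * H2 (2 * osum a + 2 * esum b + 2 * z))
         / (H2 (2 * esum a + 2 * osum b + 2 * y + 1) * H2 (2 * osum a + 2 * esum b + 2 * y + 2 * z))"
  define G4 where "G4 = (H (2 * sa + sb + 2 * y + z) * H (sb + y + z)) / (H (2 * sa + sb + y + z) * H (sb + z))"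
  \<comment> \<open>Stated for every u, since both u = x and u = 0 are needed.\<close>
  have main: "M_NR3 u y z a b = Q' (plus_seq (u + y) a b) * K (minus_seq (u + y) z a b) * H4 * (1 / 2 ^ y * G4 * (T4 u / T4 0))" for u
  proof -
    have e: "2 * (esum a + osum b) = 2 * esum a + 2 * osum b"
      "2 * (osum a + esum b + z) = 2 * osum a + 2 * esum b + 2 * z"
      "2 * osum a + 2 * esum b + 2 * z + 2 * y = 2 * osum a + 2 * esum b + 2 * y + 2 * z"
      "2 * sa + (sb + z) + 2 * y = 2 * sa + sb + 2 * y + z"
      "sb + z + y = sb + y + z"
      "2 * sa + (sb + z) + y = 2 * sa + sb + y + z"
      "2 * int sa + int (sb + z) + 2 * int y - 1 = 2 * int sa + int sb + 2 * int y + int z - 1"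
      "int (sb + z) + 2 * int y - 1 = int sb + 2 * int y + int z - 1"
      by simp_all
    have T0: "T4 0 = T 1 (2 * int sa + int sb + 2 * int y + int z - 1) y * T (real sa + 1) (int sb + 2 * int y + int z - 1) y"
      by (simp add: T4_def)
    show ?thesis unfolding M_NR3_product assms(3,4)[symmetric] e T0 H4_def G4_def T4_def by simp
  qed
  have T0: "T4 0 = T 1 (2 * int sa + int sb + 2 * int y + int z - 1) y * T (real sa + 1) (int sb + 2 * int y + int z - 1) y"
    by (simp add: T4_def)
  have T4_pos: "T4 0 \<noteq> 0"
  proof -
    have "T (real k + 1) N y > 0" for k N
      unfolding T_def by (intro prod_pos) (auto intro!: pochhammer_pos)
    from this[of 0 "2 * int sa + int sb + 2 * int y + int z - 1"] this[of sa "int sb + 2 * int y + int z - 1"]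
    show ?thesis unfolding T0 by simp
  qed
  have ne: "Q' t \<noteq> 0" "K t \<noteq> 0" for t using Q'_pos[of t] K_pos[of t] by simp_all
  \<comment> \<open>For u = 0 the sequences are those of a window of length y, so dividing by the
    sum for (y, 0) leaves exactly the factors free of x. The sum for (x + y, 0) supplies
    \<open>Q'\<close> and \<open>K\<close>.\<close>
  have 1: "M_NR3 x y z a b = M_NR3 (x + y) 0 z a b * M_NR3 0 y z a b / M_NR3 y 0 z a b * (T4 x / T4 0)"
    unfolding main M_NR3_no_crossing using ne T4_pos by simp
  have 2: "M_NR3 x y z a b = 1 / 2 ^ y * Q' t_plus * K t_minus * H4 * G4 * (T4 x / T4 0)"
    unfolding main tp tm by simp
  show ?thesis
    using 1 2 unfolding T0 H4_def G4_def by (simp only: T4_def simp_thms)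
qed

end
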